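(* In the differential game with infinitely many players described in the context, there exists a Nash equilibrium profile of strategies: there is $\hat\gamma\in\mathcal{D}$ such that, with $(\hat y,\hat\mu)=X[\hat\gamma]$ the process generated by $\hat\gamma$, for $\eta$-almost every $\omega\in\Omega$ and every $\varrho\in\mathcal{P}(\mathcal{U})$ $$\int_{\mathcal{U}}J[\omega,\alpha,\hat\mu]\,\varrho(d\alpha)\le\int_{\mathcal{U}}J[\omega,\alpha,\hat\mu]\,\frac{\partial\hat\gamma}{\partial\eta}(\omega,d\alpha).$$
   Context: Spaces of measures. $\mathcal{P}(S)$ is the set of Borel probability measures on a space $S$. On $\mathbb{R}^n$ we consider Borel probability measures with finite first moment; this set is denoted $\mathcal{P}(\mathbb{R}^n)$ and is metrized by $W(m',m'')=\sup\{\int\phi\,d(m'-m''):\phi:\mathbb{R}^n\to\mathbb{R}\ \text{1-Lipschitz}\}$ (Kantorovich--Rubinstein distance). $\mathcal{M}$ is the set of continuous maps $\mu:[0,T]\to\mathcal{P}(\mathbb{R}^n)$, $t\mapsto\mu[t]$; its elements are called external fields. Data and standing assumptions. $T>0$; $P$ is a nonempty compact metric space; $f:[0,T]\times\mathbb{R}^n\times\mathcal{P}(\mathbb{R}^n)\times P\to\mathbb{R}^n$ and $g:[0,T]\times\mathbb{R}^n\times\mathcal{P}(\mathbb{R}^n)\times P\to\mathbb{R}$ are continuous; there are constants $L_{f,x},L_{f,m}$ with $\|f(t,x',m,u)-f(t,x'',m,u)\|\le L_{f,x}\|x'-x''\|$ and $\|f(t,x,m',u)-f(t,x,m'',u)\|\le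 L_{f,m}W(m',m'')$; $\sigma:\mathbb{R}^n\times\mathcal{P}(\mathbb{R}^n)\to\mathbb{R}$ is continuous; $G_0\subset\mathbb{R}^n$ is a compact set. There is a compact set $G\subset\mathbb{R}^n$ such that for every $\mu\in\mathcal{M}$, every measurable $u:[0,T]\to P$ and every solution of $\dot x(t)=f(t,x(t),\mu[t],u(t))$ with $x(0)\in G_0$, one has $x(t)\in G$ for all $t\in[0,T]$. Game. The set of players $\Omega$ is a compact metric space, $\eta$ is a nonatomic Borel probability measure on $\Omega$, and $x_0:\Omega\to G_0$ is continuous. For compact metric spaces $S,R$ and a finite Borel measure $\theta$ on $S$, $\Lambda(S,\theta,R)$ is the set of nonnegative Borel measures $\varkappa$ on $S\times R$ with $\varkappa(Y\times R)=\theta(Y)$ for all Borel $Y\subset S$, with the topology of weak convergence (it is compact and metrizable). For $\varkappa\in\Lambda(S,\theta,R)$, $\frac{\partial\varkappa}{\partial\theta}(s,dr)$ denotes its disintegration with respect to $\theta$, i.e. a measurable family of probability measures on $R$ with $\int\varphi\,d\varkappa=\int_S\theta(ds)\int_R\varphi(s,r)\frac{\partial\varkappa}{\partial\theta}(s,dr)$ for all $\varphi\in C(S\times R)$. Put $\mathcal{U}=\Lambda([0,T],\lambda,P)$ ($\lambda$ = Lebesgue measure on $[0,T]$; elements are control measures) and $\mathcal{D}=\Lambda(\Omega,\eta,\mathcal{U})$ (profiles of strategies). For $\omega\in\Omega$, $\alpha\in\mathcal{U}$, $\mu\in\mathcal{M}$, $x[\cdot,\omega,\alpha,\mu]$ is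 the solution of $x(t)=x_0(\omega)+\int_{[0,t]\times P}f(\tau,x(\tau),\mu[\tau],u)\,\alpha(d(\tau,u))$, and $$J[\omega,\alpha,\mu]=\sigma(x[T,\omega,\alpha,\mu],\mu[T])-\int_{[0,T]\times P}g(\tau,x[\tau,\omega,\alpha,\mu],\mu[\tau],u)\,\alpha(d(\tau,u)).$$ A process generated by $\gamma\in\mathcal{D}$ is a pair $(y,\mu)$ with $y:[0,T]\times\Omega\times\mathcal{U}\to\mathbb{R}^n$, $\mu\in\mathcal{M}$, such that $y[\cdot,\omega,\alpha]=x[\cdot,\omega,\alpha,\mu]$ for all $\omega,\alpha$, and $\mu[t]$ is the push-forward of $\gamma$ under $(\omega,\alpha)\mapsto y[t,\omega,\alpha]$ for all $t\in[0,T]$. For each $\gamma$ there is exactly one such process; it is denoted $X[\gamma]$. *)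

theory Defs
  imports "HOL-Probability.Probability"
begin

typedef (overloaded) 'a prob1 =
    "{m :: 'a::euclidean_space measure. m \<in> space (prob_algebra borel) \<and> integrable m norm}"
  morphisms measure_of_prob1 Abs_prob1
proof
  show "return borel (0::'a) \<in> {m. m \<in> space (prob_algebra borel) \<and> integrable m norm}"
    by (auto simp: space_prob_algebra prob_space_return nn_integral_return integrable_iff_bounded)
qed

lemma prob_space_prob1 [simp]: "prob_space (measure_of_prob1 m)"
  and sets_prob1 [simp, measurable_cong]: "sets (measure_of_prob1 m) = sets borel"
  and space_prob1 [simp]: "space (measure_of_prob1 m) = UNIV"
  and integrable_norm_prob1: "integrable (measure_of_prob1 m) norm"
  using measure_of_prob1[of m] sets_eq_imp_space_eq[of "measure_of_prob1 m" borel]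
  by (auto simp: space_prob_algebra)

instantiation prob1 :: (euclidean_space) metric_space
begin

text \<open>The Kantorovich--Rubinstein distance.\<close>

definition dist_prob1 :: "'a prob1 \<Rightarrow> 'a prob1 \<Rightarrow> real" where
  "dist m' m'' = (SUP \<phi> \<in> {\<phi> :: 'a \<Rightarrow> real. 1-lipschitz_on UNIV \<phi>}.
     (\<integral>x. \<phi> x \<partial>measure_of_prob1 m') - (\<integral>x. \<phi> x \<partial>measure_of_prob1 m''))"

definition uniformity_prob1 :: "('a prob1 \<times> 'a prob1) filter" where
  "uniformity_prob1 = (INF e\<in>{0 <..}. principal {(x, y). dist x y < e})"

definition open_prob1 :: "'a prob1 set \<Rightarrow> bool" where
  "open_prob1 U \<longleftrightarrow> (\<forall>x\<in>U. eventually (\<lambda>(x', y). x' = x \<longrightarrow> y \<in> U) uniformity)"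

lemma integrable_lipschitz_prob1:
  fixes \<phi> :: "'a::euclidean_space \<Rightarrow> real"
  assumes "L-lipschitz_on UNIV \<phi>"
  shows "integrable (measure_of_prob1 m) \<phi>"
proof (rule Bochner_Integration.integrable_bound)
  interpret prob_space "measure_of_prob1 m" by simp
  show "integrable (measure_of_prob1 m) (\<lambda>x. \<bar>\<phi> 0\<bar> + L * norm x)"
    using integrable_norm_prob1[of m] by auto
  have "continuous_on UNIV \<phi>"
    using assms by (rule lipschitz_on_continuous_on)
  then show "\<phi> \<in> borel_measurable (measure_of_prob1 m)"
    using borel_measurable_continuous_onI[of \<phi>] by simp
  have "\<bar>\<phi> x\<bar> \<le> \<bar>\<phi> 0\<bar> + L * norm x" for x
    using lipschitz_onD[OF assms, of x 0] by (simp add: dist_real_def)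
  then show "AE x in measure_of_prob1 m. norm (\<phi> x) \<le> norm (\<bar>\<phi> 0\<bar> + L * norm x)"
    by (auto intro!: AE_I2 order_trans[OF _ abs_ge_self])
qed

lemma bdd_above_dist_prob1:
  fixes m' m'' :: "'a::euclidean_space prob1"
  shows "bdd_above ((\<lambda>\<phi>. (\<integral>x. \<phi> x \<partial>measure_of_prob1 m') - (\<integral>x. \<phi> x \<partial>measure_of_prob1 m''))
    ` {\<phi> :: 'a \<Rightarrow> real. 1-lipschitz_on UNIV \<phi>})"
proof (rule bdd_aboveI2)
  interpret p: prob_space "measure_of_prob1 m'" by simp
  interpret q: prob_space "measure_of_prob1 m''" by simp
  fix \<phi> :: "'a \<Rightarrow> real" assume "\<phi> \<in> {\<phi>. 1-lipschitz_on UNIV \<phi>}"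
  then have L: "1-lipschitz_on UNIV \<phi>" by simp
  have *: "\<bar>\<phi> x - \<phi> 0\<bar> \<le> norm x" for x
    using lipschitz_onD[OF L, of x 0] by (simp add: dist_real_def)
  have 1: "(\<integral>x. \<phi> x \<partial>measure_of_prob1 m') \<le> (\<integral>x. \<phi> 0 + norm x \<partial>measure_of_prob1 m')"
    using * integrable_norm_prob1[of m'] integrable_lipschitz_prob1[OF L, of m']
    by (intro integral_mono) (auto simp: abs_le_iff algebra_simps)
  have 2: "(\<integral>x. \<phi> 0 - norm x \<partial>measure_of_prob1 m'') \<le> (\<integral>x. \<phi> x \<partial>measure_of_prob1 m'')"
  proof (rule integral_mono)
    show "\<phi> 0 - norm x \<le> \<phi> x" for x
      using *[of x] by linarith
  qed (use integrable_norm_prob1[of m''] integrable_lipschitz_prob1[OF L, of m''] in auto)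
  show "(\<integral>x. \<phi> x \<partial>measure_of_prob1 m') - (\<integral>x. \<phi> x \<partial>measure_of_prob1 m'')
    \<le> (\<integral>x. norm x \<partial>measure_of_prob1 m') + (\<integral>x. norm x \<partial>measure_of_prob1 m'')"
    using 1 2 integrable_norm_prob1[of m'] integrable_norm_prob1[of m'']
    by (simp add: p.prob_space[simplified] q.prob_space[simplified])
qed

lemma integral_diff_le_dist_prob1:
  fixes \<phi> :: "'a::euclidean_space \<Rightarrow> real"
  assumes "1-lipschitz_on UNIV \<phi>"
  shows "(\<integral>x. \<phi> x \<partial>measure_of_prob1 m') - (\<integral>x. \<phi> x \<partial>measure_of_prob1 m'') \<le> dist m' m''"
  unfolding dist_prob1_def by (rule cSUP_upper[OF _ bdd_above_dist_prob1]) (use assms in simp)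

lemma dist_prob1_least:
  fixes m' m'' :: "'a::euclidean_space prob1"
  assumes "\<And>\<phi> :: 'a \<Rightarrow> real. 1-lipschitz_on UNIV \<phi> \<Longrightarrow>
    (\<integral>x. \<phi> x \<partial>measure_of_prob1 m') - (\<integral>x. \<phi> x \<partial>measure_of_prob1 m'') \<le> c"
  shows "dist m' m'' \<le> c"
proof -
  have "1-lipschitz_on UNIV (\<lambda>_. 0 :: real)" for S :: "'a set"
    by (auto intro: lipschitz_onI)
  then have "{\<phi> :: 'a \<Rightarrow> real. 1-lipschitz_on UNIV \<phi>} \<noteq> {}" by blast
  then show ?thesis
    unfolding dist_prob1_def by (rule cSUP_least) (use assms in simp)
qed

lemma prob1_eqI:
  fixes m' m'' :: "'a::euclidean_space prob1"
  assumes eq: "\<And>\<phi> :: 'a \<Rightarrow> real. 1-lipschitz_on UNIV \<phi> \<Longrightarrow>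
    (\<integral>x. \<phi> x \<partial>measure_of_prob1 m') = (\<integral>x. \<phi> x \<partial>measure_of_prob1 m'')"
  shows "m' = m''"
proof -
  interpret p: prob_space "measure_of_prob1 m'" by simp
  interpret q: prob_space "measure_of_prob1 m''" by simp
  define h where "h C k x = max 0 (1 - real (Suc k) * infdist x C)" for C :: "'a set" and k x
  have h_lip: "1-lipschitz_on UNIV (\<lambda>x. h C k x / real (Suc k))" for C k
  proof (rule lipschitz_onI)
    fix x y :: 'a
    have "\<bar>infdist x C - infdist y C\<bar> \<le> dist x y" by (rule infdist_triangle_abs)
    then have "real (Suc k) * \<bar>infdist x C - infdist y C\<bar> \<le> real (Suc k) * dist x y"
      by (intro mult_left_mono) auto
    then have "\<bar>real (Suc k) * infdist x C - real (Suc k) * infdist y C\<bar> \<le> real (Suc k) * dist x y"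
      by (simp add: abs_mult flip: right_diff_distrib)
    then have "\<bar>h C k x - h C k y\<bar> \<le> real (Suc k) * dist x y"
      unfolding h_def by (auto simp: max_def abs_le_iff)
    then show "dist (h C k x / real (Suc k)) (h C k y / real (Suc k)) \<le> 1 * dist x y"
      by (simp add: dist_real_def divide_simps mult.commute flip: diff_divide_distrib)
  qed simp
  have h_int: "(\<integral>x. h C k x \<partial>measure_of_prob1 m') = (\<integral>x. h C k x \<partial>measure_of_prob1 m'')" for C k
    using eq[OF h_lip[of C k]] by simp
  have h_lim: "(\<lambda>k. \<integral>x. h C k x \<partial>measure_of_prob1 m) \<longlonglongrightarrow> measure (measure_of_prob1 m) C"
    if C: "closed C" "C \<noteq> {}" for C and m :: "'a prob1"
  proof -
    interpret m: prob_space "measure_of_prob1 m" by simp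
    have "(\<lambda>k. \<integral>x. h C k x \<partial>measure_of_prob1 m) \<longlonglongrightarrow> (\<integral>x. indicator C x \<partial>measure_of_prob1 m)"
    proof (rule integral_dominated_convergence[where w = "\<lambda>_. 1"])
      show "(\<lambda>x. h C k x) \<in> borel_measurable (measure_of_prob1 m)" for k
      proof -
        have "h C k = (\<lambda>x. real (Suc k) * (h C k x / real (Suc k)))" by auto
        moreover have "integrable (measure_of_prob1 m) (\<lambda>x. real (Suc k) * (h C k x / real (Suc k)))"
          using integrable_lipschitz_prob1[OF h_lip[of C k], of m] by (rule integrable_mult_right)
        ultimately show ?thesis by (metis borel_measurable_integrable)
      qed
      show "AE x in measure_of_prob1 m. norm (h C k x) \<le> 1" for k
        by (auto simp: h_def infdist_nonneg)
      have "(\<lambda>k. h C k x) \<longlonglongrightarrow> indicator C x" for x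
      proof (cases "x \<in> C")
        case True
        then show ?thesis by (simp add: h_def)
      next
        case False
        then have pos: "infdist x C > 0"
          using C by (metis in_closed_iff_infdist_zero infdist_nonneg less_eq_real_def)
        obtain N where N: "1 < real N * infdist x C"
          using reals_Archimedean3[OF pos] by blast
        have "h C k x = 0" if "k \<ge> N" for k
        proof -
          have "real N * infdist x C \<le> real (Suc k) * infdist x C"
            using that pos by (intro mult_right_mono) auto
          then show ?thesis using N by (simp add: h_def)
        qed
        then have "eventually (\<lambda>k. h C k x = indicator C x) sequentially"
          using False by (auto intro: eventually_sequentiallyI[of N])
        then show ?thesis by (rule tendsto_eventually)
      qed
      then show "AE x in measure_of_prob1 m. (\<lambda>k. h C k x) \<longlonglongrightarrow> indicator C x" by simp
      show "indicator C \<in> borel_measurable (measure_of_prob1 m)"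
        using C by (auto intro!: borel_measurable_indicator borel_closed)
    qed simp
    then show ?thesis using C by simp
  qed
  have closed_eq: "emeasure (measure_of_prob1 m') C = emeasure (measure_of_prob1 m'') C"
    if "closed C" for C
  proof (cases "C = {}")
    case False
    then have "measure (measure_of_prob1 m') C = measure (measure_of_prob1 m'') C"
      using h_lim[OF that, of m'] h_lim[OF that, of m''] unfolding h_int
      by (intro LIMSEQ_unique)
    then show ?thesis by (simp add: p.emeasure_eq_measure q.emeasure_eq_measure)
  qed simp
  have "measure_of_prob1 m' = measure_of_prob1 m''"
  proof (rule measure_eqI_generator_eq[where E = "Collect closed" and \<Omega> = UNIV and A = "\<lambda>_. UNIV"])
    show "Int_stable (Collect closed)" by (auto simp: Int_stable_def)
    have "sets (borel :: 'a measure) = sigma_sets UNIV (Collect closed)"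
      by (simp add: borel_eq_closed)
    then show "sets (measure_of_prob1 m') = sigma_sets UNIV (Collect closed)"
      "sets (measure_of_prob1 m'') = sigma_sets UNIV (Collect closed)" by simp_all
  qed (auto simp: closed_eq)
  then show ?thesis by (simp add: measure_of_prob1_inject)
qed

lemma dist_prob1_sym_le: "dist x y \<le> dist y x" for x y :: "'a::euclidean_space prob1"
proof (rule dist_prob1_least)
  fix \<phi> :: "'a \<Rightarrow> real" assume "1-lipschitz_on UNIV \<phi>"
  then have "1-lipschitz_on UNIV (\<lambda>x. - \<phi> x)"
    by (auto simp: lipschitz_on_def dist_real_def abs_minus_commute)
  from integral_diff_le_dist_prob1[OF this, of y x]
  show "(\<integral>t. \<phi> t \<partial>measure_of_prob1 x) - (\<integral>t. \<phi> t \<partial>measure_of_prob1 y) \<le> dist y x"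
    by simp
qed

lemma dist_prob1_eq_0_iff: "dist x y = 0 \<longleftrightarrow> x = y" for x y :: "'a::euclidean_space prob1"
proof
  assume dist0: "dist x y = 0"
  then have "dist y x \<le> 0" using dist_prob1_sym_le[of y x] by simp
  show "x = y"
  proof (rule prob1_eqI)
    fix \<phi> :: "'a \<Rightarrow> real" assume L: "1-lipschitz_on UNIV \<phi>"
    show "(\<integral>t. \<phi> t \<partial>measure_of_prob1 x) = (\<integral>t. \<phi> t \<partial>measure_of_prob1 y)"
      using integral_diff_le_dist_prob1[OF L, of x y] integral_diff_le_dist_prob1[OF L, of y x]
        dist0 \<open>dist y x \<le> 0\<close> by linarith
  qed
next
  assume "x = y"
  have "1-lipschitz_on UNIV (\<lambda>_ :: 'a. 0 :: real)" by (auto intro: lipschitz_onI)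
  from integral_diff_le_dist_prob1[OF this, of y y] have "0 \<le> dist y y" by simp
  moreover have "dist y y \<le> 0" by (rule dist_prob1_least) simp
  ultimately show "dist x y = 0" using \<open>x = y\<close> by simp
qed

lemma dist_prob1_triangle: "dist x y \<le> dist x z + dist y z" for x y z :: "'a::euclidean_space prob1"
proof (rule dist_prob1_least)
  fix \<phi> :: "'a \<Rightarrow> real" assume L: "1-lipschitz_on UNIV \<phi>"
  show "(\<integral>t. \<phi> t \<partial>measure_of_prob1 x) - (\<integral>t. \<phi> t \<partial>measure_of_prob1 y) \<le> dist x z + dist y z"
    using integral_diff_le_dist_prob1[OF L, of x z] integral_diff_le_dist_prob1[OF L, of z y]
      dist_prob1_sym_le[of z y] by linarith
qed

instance
  by standard
    (fact uniformity_prob1_def open_prob1_def dist_prob1_eq_0_iff dist_prob1_triangle)+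

end

definition borel_of :: "'a topology \<Rightarrow> 'a measure" where
  "borel_of X = sigma (topspace X) {U. openin X U}"

text \<open>
  The set \<open>\<Lambda>(S, \<theta>, R)\<close> of Borel measures on \<open>S \<times> R\<close> with first marginal \<open>\<theta>\<close>.
  Members are finite because \<open>\<theta>\<close> is finite wherever this is used.
\<close>

definition marginal_measures ::
  "'s topology \<Rightarrow> 's measure \<Rightarrow> 'r topology \<Rightarrow> ('s \<times> 'r) measure set" where
  "marginal_measures S \<theta> R =
    {\<kappa>. sets \<kappa> = sets (borel_of (prod_topology S R)) \<and>
         (\<forall>Y \<in> sets (borel_of S). emeasure \<kappa> (Y \<times> topspace R) = emeasure \<theta> Y)}"

text \<open>
  The topology of weak convergence on a set \<open>A\<close> of finite Borel measures on the space \<open>X\<close>: the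
  coarsest one making integration of each bounded continuous function continuous.
\<close>

definition weak_topology :: "'a topology \<Rightarrow> 'a measure set \<Rightarrow> 'a measure topology" where
  "weak_topology X A = topology_generated_by
    {{\<kappa> \<in> A. (\<integral>z. \<phi> z \<partial>\<kappa>) \<in> V} | \<phi> V.
       continuous_map X euclideanreal \<phi> \<and> bounded (\<phi> ` topspace X) \<and> open V}"

definition is_disintegration ::
  "'s topology \<Rightarrow> 's measure \<Rightarrow> 'r topology \<Rightarrow> ('s \<times> 'r) measure \<Rightarrow> ('s \<Rightarrow> 'r measure) \<Rightarrow> bool" where
  "is_disintegration S \<theta> R \<kappa> k \<longleftrightarrow>
    k \<in> measurable (borel_of S) (prob_algebra (borel_of R)) \<and>
    (\<forall>\<phi>. continuous_map (prod_topology S R) euclideanreal \<phi> \<longrightarrow>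
      (\<integral>z. \<phi> z \<partial>\<kappa>) = (\<integral>s. (\<integral>r. \<phi> (s, r) \<partial>k s) \<partial>\<theta>))"

definition nonatomic :: "'a measure \<Rightarrow> bool" where
  "nonatomic M \<longleftrightarrow>
    (\<forall>A \<in> sets M. 0 < emeasure M A \<longrightarrow>
      (\<exists>B \<in> sets M. B \<subseteq> A \<and> 0 < emeasure M B \<and> emeasure M B < emeasure M A))"

text \<open>
  Compact metric spaces of players and of control values are rendered by type variables of class
  \<open>metric_space\<close> whose universe is assumed to be compact.
\<close>

definition control_measures :: "real \<Rightarrow> (real \<times> 'p::metric_space) measure set" where
  "control_measures T =
    marginal_measures (top_of_set {0..T}) (restrict_space lborel {0..T}) euclidean"

definition control_topology :: "real \<Rightarrow> (real \<times> 'p::metric_space) measure topology" where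
  "control_topology T =
    weak_topology (prod_topology (top_of_set {0..T}) euclidean) (control_measures T)"

lemma topspace_control_topology [simp]: "topspace (control_topology T) = control_measures T"
proof -
  have "control_measures T \<in> {{\<kappa> \<in> control_measures T. (\<integral>z. \<phi> z \<partial>\<kappa>) \<in> V} | \<phi> V.
     continuous_map (prod_topology (top_of_set {0..T}) euclidean) euclideanreal \<phi> \<and>
     bounded (\<phi> ` topspace (prod_topology (top_of_set {0..T}) euclidean)) \<and> open V}"
    by (rule CollectI, rule exI[of _ "\<lambda>_. 0"], rule exI[of _ UNIV])
       (auto simp: bounded_iff intro!: exI[of _ 0])
  then show ?thesis
    unfolding control_topology_def weak_topology_def by auto
qed

definition strategy_profiles ::
  "real \<Rightarrow> 'w::metric_space measure \<Rightarrow> ('w \<times> (real \<times> 'p::metric_space) measure) measure set" where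
  "strategy_profiles T \<eta> = marginal_measures euclidean \<eta> (control_topology T)"

text \<open>Only the restriction of an external field to \<open>{0..T}\<close> is relevant.\<close>

definition external_fields :: "real \<Rightarrow> (real \<Rightarrow> 'a::euclidean_space prob1) set" where
  "external_fields T = {\<mu>. continuous_on {0..T} \<mu>}"

text \<open>
  Solutions of \<open>x'(t) = f(t, x(t), \<mu>(t), u(t))\<close> for a measurable control \<open>u\<close>, in the sense of
  Caratheodory, that is, in integral form.
\<close>

definition is_solution ::
  "real \<Rightarrow> (real \<Rightarrow> 'a \<Rightarrow> 'a prob1 \<Rightarrow> 'p \<Rightarrow> 'a::euclidean_space) \<Rightarrow> (real \<Rightarrow> 'a prob1) \<Rightarrow>
    (real \<Rightarrow> 'p) \<Rightarrow> (real \<Rightarrow> 'a) \<Rightarrow> bool" where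
  "is_solution T f \<mu> u x \<longleftrightarrow>
    continuous_on {0..T} x \<and>
    (\<forall>t\<in>{0..T}. x t = x 0 + (LINT s:{0..t}|lebesgue. f s (x s) (\<mu> s) (u s)))"

text \<open>
  Continuity excludes functions for which the integral would be undefined (and hence \<open>0\<close>);
  membership in \<open>extensional {0..T}\<close> makes the solution on \<open>{0..T}\<close> unique as a function on
  \<open>real\<close>, so that the definite description in \<open>trajectory\<close> is meaningful.
\<close>

definition is_trajectory ::
  "real \<Rightarrow> (real \<Rightarrow> 'a \<Rightarrow> 'a prob1 \<Rightarrow> 'p \<Rightarrow> 'a::euclidean_space) \<Rightarrow> 'a \<Rightarrow> (real \<times> 'p) measure \<Rightarrow>
    (real \<Rightarrow> 'a prob1) \<Rightarrow> (real \<Rightarrow> 'a) \<Rightarrow> bool" where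
  "is_trajectory T f \<xi> \<alpha> \<mu> x \<longleftrightarrow>
    x \<in> extensional {0..T} \<and> continuous_on {0..T} x \<and>
    (\<forall>t\<in>{0..T}. x t =
      \<xi> + (LINT z:({0..t} \<times> UNIV)|\<alpha>. (case z of (\<tau>, u) \<Rightarrow> f \<tau> (x \<tau>) (\<mu> \<tau>) u)))"

definition trajectory ::
  "real \<Rightarrow> (real \<Rightarrow> 'a \<Rightarrow> 'a prob1 \<Rightarrow> 'p \<Rightarrow> 'a::euclidean_space) \<Rightarrow> ('w \<Rightarrow> 'a) \<Rightarrow> 'w \<Rightarrow>
    (real \<times> 'p) measure \<Rightarrow> (real \<Rightarrow> 'a prob1) \<Rightarrow> real \<Rightarrow> 'a" where
  "trajectory T f x0 \<omega> \<alpha> \<mu> = (THE x. is_trajectory T f (x0 \<omega>) \<alpha> \<mu> x)"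

definition payoff ::
  "real \<Rightarrow> (real \<Rightarrow> 'a \<Rightarrow> 'a prob1 \<Rightarrow> 'p \<Rightarrow> 'a::euclidean_space) \<Rightarrow>
    (real \<Rightarrow> 'a \<Rightarrow> 'a prob1 \<Rightarrow> 'p \<Rightarrow> real) \<Rightarrow> ('a \<Rightarrow> 'a prob1 \<Rightarrow> real) \<Rightarrow> ('w \<Rightarrow> 'a) \<Rightarrow>
    'w \<Rightarrow> (real \<times> 'p) measure \<Rightarrow> (real \<Rightarrow> 'a prob1) \<Rightarrow> real" where
  "payoff T f g \<sigma> x0 \<omega> \<alpha> \<mu> =
    \<sigma> (trajectory T f x0 \<omega> \<alpha> \<mu> T) (\<mu> T) -
    (\<integral>(\<tau>, u). g \<tau> (trajectory T f x0 \<omega> \<alpha> \<mu> \<tau>) (\<mu> \<tau>) u \<partial>\<alpha>)"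

definition is_process ::
  "real \<Rightarrow> (real \<Rightarrow> 'a \<Rightarrow> 'a prob1 \<Rightarrow> 'p \<Rightarrow> 'a::euclidean_space) \<Rightarrow> ('w \<Rightarrow> 'a) \<Rightarrow>
    ('w \<times> (real \<times> 'p::metric_space) measure) measure \<Rightarrow>
    (real \<Rightarrow> 'w \<Rightarrow> (real \<times> 'p) measure \<Rightarrow> 'a) \<Rightarrow> (real \<Rightarrow> 'a prob1) \<Rightarrow> bool" where
  "is_process T f x0 \<gamma> y \<mu> \<longleftrightarrow>
    \<mu> \<in> external_fields T \<and>
    (\<forall>t\<in>{0..T}. \<forall>\<omega>. \<forall>\<alpha>\<in>control_measures T. y t \<omega> \<alpha> = trajectory T f x0 \<omega> \<alpha> \<mu> t) \<and>
    (\<forall>t\<in>{0..T}. measure_of_prob1 (\<mu> t) = distr \<gamma> borel (\<lambda>(\<omega>, \<alpha>). y t \<omega> \<alpha>))"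

end

theory Submission
  imports Defs
begin

text \<open>
  A profile of strategies is tested in integrated form: it is an equilibrium as soon as
  \<open>\<integral> \<psi>(\<omega>) (J[\<omega>, \<alpha>, \<mu>] - J[\<omega>, \<alpha>\<^sub>l, \<mu>]) d\<gamma> \<ge> 0\<close> for all continuous \<open>\<psi> \<ge> 0\<close> and all \<open>\<alpha>\<^sub>l\<close> from a
  countable dense set of control measures, because disintegrating \<open>\<gamma>\<close> turns this into an inequality
  for almost every player. Restricting the players to finitely many types and the controls to
  \<open>\<alpha>\<^sub>0, \<dots>, \<alpha>\<^sub>N\<close> gives a finite game, which has a mixed equilibrium by Brouwer's theorem. The inequality
  survives weak limits of these equilibria, since the process, and with it \<open>J\<close>, depends continuously
  on the profile: a Gronwall estimate bounds the distance of two fields by the distance of the laws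
  of one fixed flow.
\<close>

section \<open>Brouwer's theorem and finite games\<close>

text \<open>An inequality for almost every player need not survive weak convergence, because the
  disintegrations of converging profiles need not converge, whereas integrals against continuous
  tests do. The integrated form also tolerates that the finite games have only approximately the
  right distribution of players. In these games the payoff of a type depends on the whole mixed
  profile through the field that it generates, and not linearly; Nash's argument still applies,
  since deviations are evaluated in a frozen field and payoffs only have to be continuous. Control
  measures carry an abstract weak topology; they are coded by a compact set of real sequences, on
  which sequential arguments suffice. Codes by single reals serve a second purpose: a compact metric
  space is a continuous image of a compact set of reals, so weak compactness and disintegration are
  drawn from distribution functions on the line. The property carried through the limit is
  convergence of the payoff when law, player and control vary simultaneously.\<close>

lemma tendsto_fun_iff:
  fixes X :: "'b \<Rightarrow> 'i::countable \<Rightarrow> 'a::topological_space"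
  shows "(X \<longlongrightarrow> L) F \<longleftrightarrow> (\<forall>i. ((\<lambda>n. X n i) \<longlongrightarrow> L i) F)"
  using limitin_componentwise[of "\<lambda>_. euclidean" UNIV X L F]
  by (simp add: euclidean_product_topology)

lemma compact_fun_box:
  fixes S :: "'i \<Rightarrow> 'a::topological_space set"
  assumes "\<And>i. compact (S i)"
  shows "compact {x. \<forall>i. x i \<in> S i}"
proof -
  have "compactin (product_topology (\<lambda>_. euclidean) UNIV) (PiE UNIV S)"
    using assms by (simp add: compactin_PiE)
  then show ?thesis
    by (simp add: euclidean_product_topology PiE_UNIV_domain Pi_def)
qed

text \<open>Kuhn's labelling at grid points \<open>x / p\<close>, in the limit \<open>p \<rightarrow> \<infinity>\<close>.\<close>

lemma brouwer_fun_cube: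
  fixes F :: "(nat \<Rightarrow> real) \<Rightarrow> nat \<Rightarrow> real" and n :: nat
  defines "C \<equiv> {x. (\<forall>i<n. 0 \<le> x i \<and> x i \<le> 1) \<and> (\<forall>i\<ge>n. x i = 0)}"
  assumes cont: "continuous_on C F" and F: "F \<in> C \<rightarrow> C"
  shows "\<exists>x\<in>C. F x = x"
proof -
  have "C = {x. \<forall>i. x i \<in> (if i < n then {0..1} else {0})}"
  proof (intro set_eqI iffI)
    fix x :: "nat \<Rightarrow> real" assume "x \<in> {x. \<forall>i. x i \<in> (if i < n then {0..1} else {0})}"
    then have i: "x i \<in> (if i < n then {0..1} else {0})" for i by blast
    have "0 \<le> x i \<and> x i \<le> 1" if "i < n" for i using i[of i] that by simp
    moreover have "x i = 0" if "i \<ge> n" for i using i[of i] that by simp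
    ultimately show "x \<in> C" by (simp add: C_def)
  qed (auto simp: C_def)
  moreover have "compact {x :: nat \<Rightarrow> real. \<forall>i. x i \<in> (if i < n then {0..1} else {0})}"
    by (rule compact_fun_box) auto
  ultimately have "compact C" by metis
  define gp where "gp p q i = (if i < n then real (q i) / real p else 0)" for p :: nat and q :: "nat \<Rightarrow> nat" and i
  have gpC: "gp p q \<in> C" if "\<forall>i<n. q i \<le> p" "p > 0" for p q
    using that by (auto simp: gp_def C_def)
  \<comment> \<open>In the interior the label is the sign of the displacement in coordinate
    \<open>i\<close>. On the two faces the values demanded by \<open>kuhn_lemma\<close> are imposed,
    which agrees with that sign because \<open>F\<close> maps the cube into itself.\<close>
  define lab where "lab p q i = (if q i = p then 1 else if q i = 0 then 0 else
      if F (gp p q) i \<ge> gp p q i then 0 else (1::nat))" for p q i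
  have lab0: "gp p q i \<le> F (gp p q) i" if "lab p q i = 0" "\<forall>i<n. q i \<le> p" "p > 0" "i < n" for p q i
  proof -
    have "F (gp p q) \<in> C" using F gpC[OF that(2,3)] by auto
    then show ?thesis using that by (auto simp: lab_def gp_def C_def split: if_splits)
  qed
  have lab1: "F (gp p q) i \<le> gp p q i" if "lab p q i \<noteq> 0" "\<forall>i<n. q i \<le> p" "p > 0" "i < n" for p q i
  proof -
    have "F (gp p q) \<in> C" using F gpC[OF that(2,3)] by auto
    then show ?thesis using that by (auto simp: lab_def gp_def C_def split: if_splits)
  qed
  define P where "P p q \<longleftrightarrow> (\<forall>i<n. q i < p) \<and> (\<forall>i<n. \<exists>r s. (\<forall>j<n. q j \<le> r j \<and> r j \<le> q j + 1)
      \<and> (\<forall>j<n. q j \<le> s j \<and> s j \<le> q j + 1) \<and> lab p r i \<noteq> lab p s i)" for p q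
  have "\<exists>q. P (Suc k) q" for k
  proof (rule kuhn_lemma[of "Suc k" n "lab (Suc k)"])
    show "\<forall>x. (\<forall>i<n. x i \<le> Suc k) \<longrightarrow> (\<forall>i<n. lab (Suc k) x i = 0 \<or> lab (Suc k) x i = 1)"
      by (simp add: lab_def)
    show "\<forall>x. (\<forall>i<n. x i \<le> Suc k) \<longrightarrow> (\<forall>i<n. x i = 0 \<longrightarrow> lab (Suc k) x i = 0)"
      by (simp add: lab_def)
    show "\<forall>x. (\<forall>i<n. x i \<le> Suc k) \<longrightarrow> (\<forall>i<n. x i = Suc k \<longrightarrow> lab (Suc k) x i = 1)"
      by (simp add: lab_def)
    show "\<exists>q. P (Suc k) q" if "\<forall>i<n. q i < Suc k"
      "\<forall>i<n. \<exists>r s. (\<forall>j<n. q j \<le> r j \<and> r j \<le> q j + 1) \<and> (\<forall>j<n. q j \<le> s j \<and> s j \<le> q j + 1)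
        \<and> lab (Suc k) r i \<noteq> lab (Suc k) s i" for q
      using that unfolding P_def by (intro exI[of _ q] conjI)
  qed simp
  then obtain q where q: "P (Suc k) (q k)" for k by metis
  have qC: "gp (Suc k) (q k) \<in> C" for k
    using q[of k] by (intro gpC) (auto simp: P_def less_imp_le)
  have "seq_compact C" using \<open>compact C\<close> by (simp add: compact_eq_seq_compact_metric)
  then obtain z r where z: "z \<in> C" and r: "strict_mono (r::nat\<Rightarrow>nat)" and lim: "((\<lambda>k. gp (Suc k) (q k)) \<circ> r) \<longlonglongrightarrow> z"
    using qC by (elim seq_compactE[of C "\<lambda>k. gp (Suc k) (q k)"]) auto
  \<comment> \<open>In each coordinate, any vertices of the cells found at stage \<open>r k\<close>
    stay within one mesh width of \<open>gp (Suc (r k)) (q (r k))\<close>, so every choice of them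
    has the same limit.\<close>
  have near: "(\<lambda>k. gp (Suc (r k)) (s k)) \<longlonglongrightarrow> z"
    if s: "\<And>k. \<forall>j<n. q (r k) j \<le> s k j \<and> s k j \<le> q (r k) j + 1" for s
    unfolding tendsto_fun_iff
  proof
    fix i
    have 1: "(\<lambda>k. gp (Suc (r k)) (q (r k)) i) \<longlonglongrightarrow> z i"
      using lim unfolding tendsto_fun_iff by (simp add: o_def)
    have "(\<lambda>k. inverse (real (Suc (r k)))) \<longlonglongrightarrow> 0"
      using LIMSEQ_subseq_LIMSEQ[OF LIMSEQ_inverse_real_of_nat r] by (simp add: o_def)
    from tendsto_add[OF 1 this]
    have 2: "(\<lambda>k. gp (Suc (r k)) (q (r k)) i + inverse (real (Suc (r k)))) \<longlonglongrightarrow> z i" by simp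
    show "(\<lambda>k. gp (Suc (r k)) (s k) i) \<longlonglongrightarrow> z i"
    proof (rule tendsto_sandwich[OF _ _ 1 2])
      show "\<forall>\<^sub>F k in sequentially. gp (Suc (r k)) (q (r k)) i \<le> gp (Suc (r k)) (s k) i"
        using s by (auto simp: gp_def divide_right_mono)
      have "gp (Suc (r k)) (s k) i \<le> gp (Suc (r k)) (q (r k)) i + inverse (real (Suc (r k)))" for k
      proof (cases "i < n")
        case True
        then have "real (s k i) \<le> real (q (r k) i) + 1" using s[of k] by (metis of_nat_1 of_nat_add of_nat_mono)
        then have "real (s k i) / real (Suc (r k)) \<le> (real (q (r k) i) + 1) / real (Suc (r k))"
          by (intro divide_right_mono) auto
        then show ?thesis using True by (simp only: gp_def if_True add_divide_distrib inverse_eq_divide)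
      qed (simp add: gp_def)
      then show "\<forall>\<^sub>F k in sequentially. gp (Suc (r k)) (s k) i \<le> gp (Suc (r k)) (q (r k)) i + inverse (real (Suc (r k)))"
        by simp
    qed
  qed
  have Flim: "(\<lambda>k. F (X k) i) \<longlonglongrightarrow> F z i" if "X \<longlonglongrightarrow> z" "\<And>k. X k \<in> C" for X i
    using continuous_on_tendsto_compose[OF cont that(1) z] that(2) by (simp add: tendsto_fun_iff)
  have "F z i = z i" for i
  proof (cases "i < n")
    case True
    \<comment> \<open>A cell carries both labels in every coordinate. Vertices labelled 0 and
      vertices labelled 1 both run to \<open>z\<close>, so the displacement of \<open>z\<close> is
      at once nonnegative and nonpositive.\<close>
    have "\<exists>r' s. (\<forall>j<n. q (r k) j \<le> r' j \<and> r' j \<le> q (r k) j + 1) \<and> (\<forall>j<n. q (r k) j \<le> s j \<and> s j \<le> q (r k) j + 1)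
        \<and> lab (Suc (r k)) r' i = 0 \<and> lab (Suc (r k)) s i \<noteq> 0" for k
    proof -
      obtain r' s where rs: "\<forall>j<n. q (r k) j \<le> r' j \<and> r' j \<le> q (r k) j + 1"
          "\<forall>j<n. q (r k) j \<le> s j \<and> s j \<le> q (r k) j + 1" "lab (Suc (r k)) r' i \<noteq> lab (Suc (r k)) s i"
        using q[of "r k"] True unfolding P_def by blast
      have lab01: "lab (Suc (r k)) w i = 0 \<or> lab (Suc (r k)) w i = 1" for w by (simp add: lab_def)
      show ?thesis
      proof (cases "lab (Suc (r k)) r' i = 0")
        case True
        then show ?thesis using rs by (intro exI[of _ r'] exI[of _ s]) auto
      next
        case False
        then show ?thesis using rs lab01[of r'] lab01[of s] by (intro exI[of _ s] exI[of _ r']) auto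
      qed
    qed
    then obtain u v where u: "\<And>k. \<forall>j<n. q (r k) j \<le> u k j \<and> u k j \<le> q (r k) j + 1"
      and v: "\<And>k. \<forall>j<n. q (r k) j \<le> v k j \<and> v k j \<le> q (r k) j + 1"
      and uv: "\<And>k. lab (Suc (r k)) (u k) i = 0" "\<And>k. lab (Suc (r k)) (v k) i \<noteq> 0" by metis
    have le: "\<forall>j<n. u k j \<le> Suc (r k)" "\<forall>j<n. v k j \<le> Suc (r k)" for k
      using u[of k] v[of k] q[of "r k"] unfolding P_def by fastforce+
    have "z i \<le> F z i"
    proof (rule LIMSEQ_le)
      show "(\<lambda>k. gp (Suc (r k)) (u k) i) \<longlonglongrightarrow> z i" using near[OF u] by (simp add: tendsto_fun_iff)
      show "(\<lambda>k. F (gp (Suc (r k)) (u k)) i) \<longlonglongrightarrow> F z i" using Flim[OF near[OF u]] gpC[OF le(1)] by simp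
      show "\<exists>N. \<forall>k\<ge>N. gp (Suc (r k)) (u k) i \<le> F (gp (Suc (r k)) (u k)) i"
        using lab0[OF uv(1) le(1) _ True] by auto
    qed
    moreover have "F z i \<le> z i"
    proof (rule LIMSEQ_le)
      show "(\<lambda>k. gp (Suc (r k)) (v k) i) \<longlonglongrightarrow> z i" using near[OF v] by (simp add: tendsto_fun_iff)
      show "(\<lambda>k. F (gp (Suc (r k)) (v k)) i) \<longlonglongrightarrow> F z i" using Flim[OF near[OF v]] gpC[OF le(2)] by simp
      show "\<exists>N. \<forall>k\<ge>N. F (gp (Suc (r k)) (v k)) i \<le> gp (Suc (r k)) (v k) i"
        using lab1[OF uv(2) le(2) _ True] by auto
    qed
    ultimately show ?thesis by simp
  next
    case False
    moreover have "F z \<in> C" using z F by blast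
    ultimately show ?thesis using z by (auto simp: C_def)
  qed
  then show ?thesis using z by blast
qed


text \<open>Nash's map \<open>p \<mapsto> (p + \<phi>) / (1 + \<Sum>\<phi>)\<close>, precomposed with a retraction of the cube onto the
  product of simplices.\<close>

lemma finite_nash_equilibrium:
  fixes v :: "(nat \<Rightarrow> nat \<Rightarrow> real) \<Rightarrow> nat \<Rightarrow> nat \<Rightarrow> real" and n m :: nat
  defines "S \<equiv> {p. \<forall>i<n. (\<forall>j<m. 0 \<le> p i j) \<and> (\<Sum>j<m. p i j) = 1}"
  assumes m: "m > 0"
    and v: "\<And>p ps i j. p \<in> S \<Longrightarrow> (\<And>k. ps k \<in> S) \<Longrightarrow> (\<And>i j. i < n \<Longrightarrow> j < m \<Longrightarrow> (\<lambda>k. ps k i j) \<longlonglongrightarrow> p i j) \<Longrightarrow>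
      i < n \<Longrightarrow> j < m \<Longrightarrow> (\<lambda>k. v (ps k) i j) \<longlonglongrightarrow> v p i j"
  shows "\<exists>p\<in>S. \<forall>i<n. \<forall>l<m. v p i l \<le> (\<Sum>j<m. p i j * v p i j)"
proof -
  define C :: "(nat \<Rightarrow> real) set" where "C = {x. (\<forall>i<n*m. 0 \<le> x i \<and> x i \<le> 1) \<and> (\<forall>i\<ge>n*m. x i = 0)}"
  define c where "c x i j = x (i * m + j)" for x :: "nat \<Rightarrow> real" and i j
  \<comment> \<open>A row with sum below 1 gets the missing mass in equal shares, a row with sum
    above 1 is rescaled; one of the two corrections is always idle. The formula is continuous on the
    whole cube and leaves rows with sum 1 unchanged.\<close>
  define r where "r x i j = (c x i j + max 0 (1 - (\<Sum>j<m. c x i j)) / real m) / max 1 (\<Sum>j<m. c x i j)" for x i j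
  define vb where "vb p i = (\<Sum>j<m. p i j * v p i j)" for p i
  define \<phi> where "\<phi> p i j = max 0 (v p i j - vb p i)" for p i j
  define N where "N p i j = (p i j + \<phi> p i j) / (1 + (\<Sum>l<m. \<phi> p i l))" for p i j
  define F where "F x k = (if k < n * m then N (r x) (k div m) (k mod m) else 0)" for x k
  have ij: "i * m + j < n * m" if "i < n" "j < m" for i j
    using that by (metis add.commute add_lessD1 mult.commute mult_Suc_right nat_add_left_cancel_less Suc_leI le_trans less_le_trans mult_le_mono2)
  have div_mod: "k div m < n" "k mod m < m" if "k < n * m" for k
    using that m by (auto simp: less_mult_imp_div_less)
  have rS: "r x \<in> S" if "x \<in> C" for x
  proof -
    have "0 \<le> c x i j" if "i < n" "j < m" for i j
      using \<open>x \<in> C\<close> ij[OF that] by (auto simp: C_def c_def)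
    moreover have "(\<Sum>j<m. r x i j) = 1" if "i < n" for i
    proof -
      have "(\<Sum>j<m. r x i j) = ((\<Sum>j<m. c x i j) + max 0 (1 - (\<Sum>j<m. c x i j))) / max 1 (\<Sum>j<m. c x i j)"
        using m by (simp add: r_def sum.distrib flip: sum_divide_distrib)
      then show ?thesis by (auto simp: max_def split: if_splits)
    qed
    ultimately show ?thesis by (auto simp: S_def r_def)
  qed
  have \<phi>0: "0 \<le> \<phi> p i j" for p i j by (simp add: \<phi>_def)
  have \<phi>s: "0 \<le> (\<Sum>l<m. \<phi> p i l)" for p i by (simp add: \<phi>0 sum_nonneg)
  have Nsum: "(\<Sum>j<m. N p i j) = 1" if "p \<in> S" "i < n" for p i
    using that \<phi>s[of p i] by (simp add: N_def S_def sum.distrib flip: sum_divide_distrib)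
  have Npos: "0 \<le> N p i j" if "p \<in> S" "i < n" "j < m" for p i j
    using that \<phi>s[of p i] \<phi>0[of p i j] by (simp add: N_def S_def)
  have N1: "N p i j \<le> 1" if "p \<in> S" "i < n" "j < m" for p i j
  proof -
    have "N p i j \<le> (\<Sum>j<m. N p i j)"
      using that Npos by (intro member_le_sum) auto
    then show ?thesis using Nsum that by simp
  qed
  have cont: "continuous_on C F"
    unfolding continuous_on_sequentially
  proof (intro allI ballI impI, elim conjE)
    fix xs x assume x: "x \<in> C" and xs: "\<forall>k. xs k \<in> C" and lim: "xs \<longlonglongrightarrow> x"
    have lc: "(\<lambda>k. c (xs k) i j) \<longlonglongrightarrow> c x i j" for i j
      using lim by (simp add: c_def tendsto_fun_iff)
    have lr: "(\<lambda>k. r (xs k) i j) \<longlonglongrightarrow> r x i j" for i j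
      unfolding r_def using m by (intro tendsto_intros tendsto_max lc) auto
    have lv: "(\<lambda>k. v (r (xs k)) i j) \<longlonglongrightarrow> v (r x) i j" if "i < n" "j < m" for i j
      using v[of "r x" "\<lambda>k. r (xs k)"] rS x xs lr that by auto
    have lvb: "(\<lambda>k. vb (r (xs k)) i) \<longlonglongrightarrow> vb (r x) i" if "i < n" for i
      unfolding vb_def using that by (intro tendsto_intros lv lr) auto
    have l\<phi>: "(\<lambda>k. \<phi> (r (xs k)) i j) \<longlonglongrightarrow> \<phi> (r x) i j" if "i < n" "j < m" for i j
      unfolding \<phi>_def using that by (intro tendsto_intros tendsto_max lv lvb) auto
    have lN: "(\<lambda>k. N (r (xs k)) i j) \<longlonglongrightarrow> N (r x) i j" if "i < n" "j < m" for i j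
      unfolding N_def using that \<phi>s[of "r x" i] by (intro tendsto_intros l\<phi> lr) auto
    show "(F \<circ> xs) \<longlonglongrightarrow> F x"
      unfolding tendsto_fun_iff o_def F_def using lN div_mod by auto
  qed
  have "F \<in> C \<rightarrow> C"
  proof
    fix x assume "x \<in> C"
    then have "0 \<le> F x k \<and> F x k \<le> 1" if "k < n * m" for k
      using Npos[OF rS] N1[OF rS] div_mod[OF that] that by (simp add: F_def)
    then show "F x \<in> C" by (simp add: C_def F_def)
  qed
  then obtain x where x: "x \<in> C" "F x = x"
    using brouwer_fun_cube[of "n*m" F] cont unfolding C_def by blast
  define p where "p = r x"
  have pS: "p \<in> S" using rS x p_def by simp
  \<comment> \<open>The fixed point is a value of \<open>N\<close> and hence already lies in the
    product of simplices; the retraction leaves it unchanged, and it is a fixed point of Nash's map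
    itself.\<close>
  have cN: "c x i j = N p i j" if "i < n" "j < m" for i j
  proof -
    have "c x i j = F x (i * m + j)" using x by (simp add: c_def)
    then show ?thesis using ij[OF that] that by (simp add: F_def p_def)
  qed
  have pN: "p i j = N p i j" if "i < n" "j < m" for i j
  proof -
    have "(\<Sum>j<m. c x i j) = 1" using cN Nsum[OF pS] that by simp
    then have "p i j = c x i j" by (simp add: p_def r_def)
    then show ?thesis using cN that by simp
  qed
  have "v p i l \<le> vb p i" if i: "i < n" and l: "l < m" for i l
  proof -
    define \<Phi> where "\<Phi> = (\<Sum>l<m. \<phi> p i l)"
    have \<Phi>: "\<phi> p i j = p i j * \<Phi>" if "j < m" for j
    proof -
      have "p i j * (1 + \<Phi>) = p i j + \<phi> p i j"
        using pN[OF i that] \<phi>s[of p i] by (simp add: N_def \<Phi>_def field_simps)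
      then show ?thesis by (simp add: algebra_simps)
    qed
    \<comment> \<open>At a fixed point \<phi> is proportional to \<open>p\<close>, and the excess
      \<open>v p i j - vb p i\<close> has \<open>p\<close>-mean zero. So the squares of the positive
      parts sum to zero and no pure strategy beats the average.\<close>
    have "(\<Sum>j<m. (\<phi> p i j)\<^sup>2) = (\<Sum>j<m. \<phi> p i j * (v p i j - vb p i))"
      by (intro sum.cong) (auto simp: \<phi>_def power2_eq_square max_def)
    also have "\<dots> = \<Phi> * (\<Sum>j<m. p i j * (v p i j - vb p i))"
      using \<Phi> by (simp add: sum_distrib_left mult_ac)
    also have "(\<Sum>j<m. p i j * (v p i j - vb p i)) = vb p i - (\<Sum>j<m. p i j) * vb p i"
      by (simp add: vb_def right_diff_distrib sum_subtractf sum_distrib_right)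
    also have "\<dots> = 0" using pS i by (simp add: S_def)
    finally have "(\<phi> p i l)\<^sup>2 = 0"
      using l by (subst (asm) mult_zero_right, subst (asm) sum_nonneg_eq_0_iff) auto
    then show ?thesis by (simp add: \<phi>_def max_def split: if_splits)
  qed
  then show ?thesis using pS by (auto simp: vb_def)
qed

section \<open>Weak convergence on compact sets\<close>

abbreviation borel_on :: "'a::topological_space set \<Rightarrow> 'a measure" where
  "borel_on X \<equiv> restrict_space borel X"

lemma space_borel_onI: "sets M = sets (borel_on X) \<Longrightarrow> space M = X"
  using sets_eq_imp_space_eq[of M "borel_on X"] by (simp add: space_restrict_space)

lemma borel_measurable_borel_on:
  assumes "sets M = sets (borel_on X)" "continuous_on X \<phi>"
  shows "\<phi> \<in> borel_measurable M"
  using borel_measurable_continuous_on_restrict[OF assms(2)] measurable_cong_sets[OF assms(1) refl] by blast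

lemma id_measurable_borel_on: "sets M = sets (borel_on X) \<Longrightarrow> (\<lambda>x. x) \<in> measurable M borel"
  using borel_measurable_borel_on[OF _ continuous_on_id] .

lemma integrable_continuous_on_compact:
  fixes \<phi> :: "'a::topological_space \<Rightarrow> 'b::{banach, second_countable_topology}"
  assumes "finite_measure M" "sets M = sets (borel_on X)" "compact X" "continuous_on X \<phi>"
  shows "integrable M \<phi>"
proof -
  have "bounded (\<phi> ` X)" using assms by (intro compact_imp_bounded compact_continuous_image)
  then obtain B where "\<And>x. x \<in> X \<Longrightarrow> norm (\<phi> x) \<le> B" by (auto simp: bounded_iff)
  then show ?thesis
    using assms space_borel_onI[OF assms(2)]
    by (intro finite_measure.integrable_const_bound[where B=B] borel_measurable_borel_on) auto
qed

lemma indicator_closed_limit: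
  fixes C :: "'a::metric_space set"
  assumes C: "closed C"
  shows "\<exists>\<psi>::nat \<Rightarrow> 'a \<Rightarrow> real. (\<forall>k. continuous_on UNIV (\<psi> k)) \<and> (\<forall>k x. 0 \<le> \<psi> k x \<and> \<psi> k x \<le> 1)
    \<and> (\<forall>x. (\<lambda>k. \<psi> k x) \<longlonglongrightarrow> indicator C x)"
proof (cases "C = {}")
  case True
  then show ?thesis by (intro exI[of _ "\<lambda>_ _. 0"]) auto
next
  case False
  define \<psi> where "\<psi> k x = max 0 (1 - real (Suc k) * infdist x C)" for k x
  have "(\<lambda>k. \<psi> k x) \<longlonglongrightarrow> indicator C x" for x
  proof (cases "x \<in> C")
    case True
    then show ?thesis by (simp add: \<psi>_def)
  next
    case x: False
    then have pos: "infdist x C > 0"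
      using C False by (metis in_closed_iff_infdist_zero infdist_nonneg less_eq_real_def)
    obtain N where N: "1 < real N * infdist x C"
      using reals_Archimedean3[OF pos] by blast
    have "\<psi> k x = 0" if "k \<ge> N" for k
    proof -
      have "real N * infdist x C \<le> real (Suc k) * infdist x C"
        using that pos by (intro mult_right_mono) auto
      then show ?thesis using N by (simp add: \<psi>_def)
    qed
    then have "eventually (\<lambda>k. \<psi> k x = indicator C x) sequentially"
      using x by (auto intro: eventually_sequentiallyI[of N])
    then show ?thesis by (rule tendsto_eventually)
  qed
  moreover have "continuous_on UNIV (\<psi> k)" for k
    unfolding \<psi>_def by (intro continuous_intros)
  moreover have "0 \<le> \<psi> k x \<and> \<psi> k x \<le> 1" for k x
    by (simp add: \<psi>_def infdist_nonneg)
  ultimately show ?thesis by blast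
qed

text \<open>Pushed forward along the identity into \<open>borel\<close>, the measures can be
  compared on closed sets of the whole type, an intersection-stable generator; there they are limits
  of integrals of continuous functions.\<close>

lemma measure_eqI_continuous:
  fixes M N :: "'a::metric_space measure"
  assumes M: "finite_measure M" "sets M = sets (borel_on X)"
    and N: "finite_measure N" "sets N = sets (borel_on X)"
    and eq: "\<And>\<phi>::'a \<Rightarrow> real. continuous_on X \<phi> \<Longrightarrow> (\<integral>x. \<phi> x \<partial>M) = (\<integral>x. \<phi> x \<partial>N)"
  shows "M = N"
proof -
  interpret M: finite_measure M by fact
  interpret N: finite_measure N by fact
  note [measurable] = id_measurable_borel_on[OF M(2)] id_measurable_borel_on[OF N(2)]
  have sp: "space M = X" "space N = X" using M N space_borel_onI by auto
  have lim: "(\<lambda>k. \<integral>x. \<psi> k x \<partial>L) \<longlonglongrightarrow> measure (distr L borel (\<lambda>x. x)) C"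
    if C: "closed C" and \<psi>: "\<And>k. continuous_on UNIV (\<psi> k :: 'a \<Rightarrow> real)" "\<And>k x. 0 \<le> \<psi> k x \<and> \<psi> k x \<le> 1"
      "\<And>x. (\<lambda>k. \<psi> k x) \<longlonglongrightarrow> indicator C x"
      and L: "finite_measure L" "sets L = sets (borel_on X)" for C \<psi> L
  proof -
    interpret L: finite_measure L by fact
    note [measurable] = id_measurable_borel_on[OF L(2)]
    have "C \<in> sets borel" using C by auto
    have "(\<lambda>k. \<integral>x. \<psi> k x \<partial>L) \<longlonglongrightarrow> (\<integral>x. indicator C x \<partial>L)"
    proof (rule integral_dominated_convergence[where w = "\<lambda>_. 1"])
      show "\<psi> k \<in> borel_measurable L" for k
        using borel_measurable_borel_on[OF L(2)] \<psi>(1) continuous_on_subset by blast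
      show "(indicator C :: 'a \<Rightarrow> real) \<in> borel_measurable L"
        using measurable_compose[OF id_measurable_borel_on[OF L(2)] borel_measurable_indicator[OF \<open>C \<in> sets borel\<close>]] .
    qed (use \<psi> in auto)
    also have "(\<integral>x. indicator C x \<partial>L) = (\<integral>x. indicator C x \<partial>distr L borel (\<lambda>x. x) :: real)"
      by (rule integral_distr[OF id_measurable_borel_on[OF L(2)] borel_measurable_indicator[OF \<open>C \<in> sets borel\<close>], symmetric])
    also have "\<dots> = measure (distr L borel (\<lambda>x. x)) C"
      using \<open>C \<in> sets borel\<close> by simp
    finally show ?thesis .
  qed
  interpret M': finite_measure "distr M borel (\<lambda>x. x)" by (rule M.finite_measure_distr) simp
  interpret N': finite_measure "distr N borel (\<lambda>x. x)" by (rule N.finite_measure_distr) simp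
  have closed_eq: "emeasure (distr M borel (\<lambda>x. x)) C = emeasure (distr N borel (\<lambda>x. x)) C" if C: "closed C" for C
  proof -
    obtain \<psi> :: "nat \<Rightarrow> 'a \<Rightarrow> real" where \<psi>: "\<And>k. continuous_on UNIV (\<psi> k)" "\<And>k x. 0 \<le> \<psi> k x \<and> \<psi> k x \<le> 1"
      "\<And>x. (\<lambda>k. \<psi> k x) \<longlonglongrightarrow> indicator C x" using indicator_closed_limit[OF C] by blast
    have "(\<integral>x. \<psi> k x \<partial>M) = (\<integral>x. \<psi> k x \<partial>N)" for k
      using \<psi>(1) continuous_on_subset by (intro eq) blast
    then have "measure (distr M borel (\<lambda>x. x)) C = measure (distr N borel (\<lambda>x. x)) C"
      using lim[OF C \<psi> M] lim[OF C \<psi> N] by (simp add: LIMSEQ_unique)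
    then show ?thesis by (simp add: M'.emeasure_eq_measure N'.emeasure_eq_measure)
  qed
  have d: "distr M borel (\<lambda>x. x) = distr N borel (\<lambda>x. x)"
  proof (rule measure_eqI_generator_eq[where E = "Collect closed" and \<Omega> = UNIV and A = "\<lambda>_. UNIV"])
    show "Int_stable (Collect closed)" by (auto simp: Int_stable_def)
    have "sets (borel :: 'a measure) = sigma_sets UNIV (Collect closed)"
      by (simp add: borel_eq_closed)
    then show "sets (distr M borel (\<lambda>x. x)) = sigma_sets UNIV (Collect closed)"
      "sets (distr N borel (\<lambda>x. x)) = sigma_sets UNIV (Collect closed)" by simp_all
  qed (auto simp: closed_eq)
  show ?thesis
  proof (rule measure_eqI)
    show "sets M = sets N" using M N by simp
    fix A assume "A \<in> sets M"
    then obtain A' where A': "A = X \<inter> A'" "A' \<in> sets borel" using M(2) by (auto simp: sets_restrict_space)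
    have "emeasure M A = emeasure (distr M borel (\<lambda>x. x)) A'"
      using A' sp by (subst emeasure_distr) (auto simp: Int_commute)
    also have "\<dots> = emeasure N A"
      unfolding d using A' sp by (subst emeasure_distr) (auto simp: Int_commute)
    finally show "emeasure M A = emeasure N A" .
  qed
qed

text \<open>Each bump lives within \<delta> of its centre, and finitely many centres suffice. A
  continuous function is thereby replaced by finitely many of its values, with an error that depends
  on its modulus of continuity alone. The same bumps later cut the players into finitely many
  types.\<close>

lemma partition_of_unity_compact:
  fixes X :: "'a::metric_space set"
  assumes "compact X" "\<delta> > 0"
  obtains F and \<psi> :: "'a \<Rightarrow> 'a \<Rightarrow> real" where "finite F" "F \<subseteq> X" "\<And>y. continuous_on X (\<psi> y)"
    "\<And>y x. x \<in> X \<Longrightarrow> 0 \<le> \<psi> y x" "\<And>x. x \<in> X \<Longrightarrow> (\<Sum>y\<in>F. \<psi> y x) = 1"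
    "\<And>x y. x \<in> X \<Longrightarrow> \<psi> y x \<noteq> 0 \<Longrightarrow> dist x y < \<delta>"
proof -
  have "X \<subseteq> (\<Union>y\<in>X. ball y \<delta>)" using assms by auto
  then obtain F where F: "F \<subseteq> X" "finite F" "X \<subseteq> (\<Union>y\<in>F. ball y \<delta>)"
    using compactE_image[OF assms(1), of X "\<lambda>y. ball y \<delta>"] by auto
  define w where "w y x = max 0 (\<delta> - dist x y)" for x y :: 'a
  have w0: "0 \<le> w y x" for x y by (simp add: w_def)
  have pos: "0 < (\<Sum>y\<in>F. w y x)" if "x \<in> X" for x
  proof -
    have "x \<in> (\<Union>y\<in>F. ball y \<delta>)" using F(3) that by blast
    then obtain y where "y \<in> F" "dist y x < \<delta>" by auto
    then show ?thesis using F(2) w0 by (intro sum_pos2[of F y]) (auto simp: w_def dist_commute)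
  qed
  show thesis
  proof
    show "continuous_on X (\<lambda>x. w y x / (\<Sum>y\<in>F. w y x))" for y
      using pos unfolding w_def by (intro continuous_intros) force
    show "(\<Sum>y\<in>F. w y x / (\<Sum>y\<in>F. w y x)) = 1" if "x \<in> X" for x
      using pos[OF that] by (simp flip: sum_divide_distrib)
    show "0 \<le> w y x / (\<Sum>y\<in>F. w y x)" for x y by (simp add: w0 sum_nonneg)
    show "dist x y < \<delta>" if "w y x / (\<Sum>y\<in>F. w y x) \<noteq> 0" for x y
      using that by (auto simp: w_def max_def split: if_splits)
  qed (use F in auto)
qed

lemma partition_of_unity_approx:
  fixes h :: "'a::metric_space \<Rightarrow> 'b::real_normed_vector"
  assumes "finite F" "F \<subseteq> X" "x \<in> X"
    and \<psi>: "\<And>y. 0 \<le> \<psi> y x" "(\<Sum>y\<in>F. \<psi> y x) = 1" "\<And>y. \<psi> y x \<noteq> 0 \<Longrightarrow> dist x y < \<delta>"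
    and h: "\<And>y. y \<in> X \<Longrightarrow> dist x y < \<delta> \<Longrightarrow> norm (h x - h y) \<le> \<epsilon>"
  shows "norm (h x - (\<Sum>y\<in>F. \<psi> y x *\<^sub>R h y)) \<le> \<epsilon>"
proof -
  have "h x = (\<Sum>y\<in>F. \<psi> y x) *\<^sub>R h x" using \<psi> by simp
  then have "h x - (\<Sum>y\<in>F. \<psi> y x *\<^sub>R h y) = (\<Sum>y\<in>F. \<psi> y x *\<^sub>R (h x - h y))"
    by (simp add: scaleR_sum_left sum_subtractf scaleR_diff_right)
  also have "norm \<dots> \<le> (\<Sum>y\<in>F. \<psi> y x * \<epsilon>)"
  proof (rule sum_norm_le)
    fix y assume "y \<in> F"
    then show "norm (\<psi> y x *\<^sub>R (h x - h y)) \<le> \<psi> y x * \<epsilon>"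
      using \<psi>(1)[of y] \<psi>(3)[of y] h[of y] assms(2) by (cases "\<psi> y x = 0") (auto intro!: mult_left_mono)
  qed
  also have "\<dots> = \<epsilon>" using \<psi> by (simp flip: sum_distrib_right)
  finally show ?thesis .
qed

lemma integral_partition_approx:
  fixes h :: "'a::metric_space \<Rightarrow> 'b::{banach, second_countable_topology}"
  assumes X: "compact X"
    and N: "finite_measure N" "sets N = sets (borel_on X)" "measure N X \<le> C"
    and F: "finite F" "F \<subseteq> X" and c\<psi>: "\<And>y. continuous_on X (\<psi> y)"
    and \<psi>: "\<And>y x. x \<in> X \<Longrightarrow> 0 \<le> \<psi> y x" "\<And>x. x \<in> X \<Longrightarrow> (\<Sum>y\<in>F. \<psi> y x) = (1::real)"
      "\<And>x y. x \<in> X \<Longrightarrow> \<psi> y x \<noteq> 0 \<Longrightarrow> dist x y < \<delta>"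
    and h: "continuous_on X h" "\<And>x y. x \<in> X \<Longrightarrow> y \<in> X \<Longrightarrow> dist x y < \<delta> \<Longrightarrow> norm (h x - h y) \<le> \<epsilon>"
    and \<epsilon>: "0 \<le> \<epsilon>"
  shows "norm ((\<integral>x. h x \<partial>N) - (\<Sum>y\<in>F. (\<integral>x. \<psi> y x \<partial>N) *\<^sub>R h y)) \<le> \<epsilon> * C"
proof -
  interpret N: finite_measure N by fact
  have i\<psi>: "integrable N (\<psi> y)" for y by (rule integrable_continuous_on_compact[OF N(1,2) X c\<psi>])
  have ih: "integrable N h" by (rule integrable_continuous_on_compact[OF N(1,2) X h(1)])
  have sp: "space N = X" using space_borel_onI[OF N(2)] .
  have "(\<integral>x. h x \<partial>N) - (\<Sum>y\<in>F. (\<integral>x. \<psi> y x \<partial>N) *\<^sub>R h y) = (\<integral>x. h x - (\<Sum>y\<in>F. \<psi> y x *\<^sub>R h y) \<partial>N)"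
    using ih i\<psi> by (subst Bochner_Integration.integral_diff) (auto intro!: Bochner_Integration.integrable_sum)
  also have "norm \<dots> \<le> (\<integral>x. norm (h x - (\<Sum>y\<in>F. \<psi> y x *\<^sub>R h y)) \<partial>N)"
    by (rule integral_norm_bound)
  also have "\<dots> \<le> (\<integral>x. \<epsilon> \<partial>N)"
  proof (rule integral_mono)
    show "integrable N (\<lambda>x. norm (h x - (\<Sum>y\<in>F. \<psi> y x *\<^sub>R h y)))"
      using ih i\<psi> by (intro integrable_norm Bochner_Integration.integrable_diff Bochner_Integration.integrable_sum) auto
    fix x assume "x \<in> space N"
    then have "x \<in> X" by (simp add: sp)
    then show "norm (h x - (\<Sum>y\<in>F. \<psi> y x *\<^sub>R h y)) \<le> \<epsilon>"
      by (intro partition_of_unity_approx[OF F _ \<psi>(1) \<psi>(2) \<psi>(3) h(2)])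
  qed auto
  also have "\<dots> = \<epsilon> * measure N X" by (simp add: sp mult.commute)
  also have "\<dots> \<le> \<epsilon> * C" using N(3) \<epsilon> by (intro mult_left_mono) auto
  finally show ?thesis .
qed

section \<open>Weak convergence along sequences\<close>

definition weakly_converges :: "'a::metric_space set \<Rightarrow> (nat \<Rightarrow> 'a measure) \<Rightarrow> 'a measure \<Rightarrow> bool" where
  "weakly_converges X Ms M \<longleftrightarrow>
    (\<forall>\<phi>::'a \<Rightarrow> real. continuous_on X \<phi> \<longrightarrow> (\<lambda>n. \<integral>x. \<phi> x \<partial>Ms n) \<longlonglongrightarrow> (\<integral>x. \<phi> x \<partial>M))"

text \<open>For an equicontinuous family one partition of unity serves all members: every integral
  is within \<open>e / 4\<close> of a combination of the integrals of finitely many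
  \<open>\<psi> y\<close>, and these converge. The common bound \<open>B\<close> controls the
  coefficients.\<close>

lemma weakly_converges_uniform:
  fixes H :: "('a::metric_space \<Rightarrow> 'b::{banach, second_countable_topology}) set"
  assumes X: "compact X"
    and M: "finite_measure M" "sets M = sets (borel_on X)" "measure M X \<le> C"
    and Ms: "\<And>n. finite_measure (Ms n)" "\<And>n. sets (Ms n) = sets (borel_on X)" "\<And>n. measure (Ms n) X \<le> C"
    and conv: "weakly_converges X Ms M"
    and equi: "\<And>\<epsilon>. \<epsilon> > 0 \<Longrightarrow> \<exists>\<delta>>0. \<forall>h\<in>H. \<forall>x\<in>X. \<forall>y\<in>X. dist x y < \<delta> \<longrightarrow> norm (h x - h y) \<le> \<epsilon>"
    and B: "\<And>h x. h \<in> H \<Longrightarrow> x \<in> X \<Longrightarrow> norm (h x) \<le> B"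
    and e: "e > 0"
  shows "\<forall>\<^sub>F n in sequentially. \<forall>h\<in>H. norm ((\<integral>x. h x \<partial>Ms n) - (\<integral>x. h x \<partial>M)) < e"
proof -
  have C0: "0 \<le> C" using M(3) measure_nonneg order_trans by blast
  \<comment> \<open>The summand 1 keeps the divisor positive even when \<open>C\<close> is 0. Two
    approximation errors and the change of the finite sum take \<open>e / 4\<close> each.\<close>
  define \<epsilon> where "\<epsilon> = e / (4 * (C + 1))"
  have \<epsilon>: "\<epsilon> > 0" "\<epsilon> * C \<le> e / 4" using e C0 by (auto simp: \<epsilon>_def field_simps)
  obtain \<delta> where \<delta>: "\<delta> > 0" "\<And>h x y. h \<in> H \<Longrightarrow> x \<in> X \<Longrightarrow> y \<in> X \<Longrightarrow> dist x y < \<delta> \<Longrightarrow> norm (h x - h y) \<le> \<epsilon>"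
    using equi[OF \<epsilon>(1)] by blast
  obtain F and \<psi> :: "'a \<Rightarrow> 'a \<Rightarrow> real" where F: "finite F" "F \<subseteq> X" and c\<psi>: "\<And>y. continuous_on X (\<psi> y)"
    and \<psi>: "\<And>y x. x \<in> X \<Longrightarrow> 0 \<le> \<psi> y x" "\<And>x. x \<in> X \<Longrightarrow> (\<Sum>y\<in>F. \<psi> y x) = 1"
    "\<And>x y. x \<in> X \<Longrightarrow> \<psi> y x \<noteq> 0 \<Longrightarrow> dist x y < \<delta>"
    using partition_of_unity_compact[OF X \<delta>(1)] by metis
  have hc: "continuous_on X h" if "h \<in> H" for h
    unfolding continuous_on_iff
  proof (intro ballI allI impI)
    fix x r assume "x \<in> X" "(0::real) < r"
    then obtain d where "d > 0" "\<forall>h\<in>H. \<forall>x\<in>X. \<forall>y\<in>X. dist x y < d \<longrightarrow> norm (h x - h y) \<le> r / 2"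
      using equi[of "r/2"] by auto
    then show "\<exists>d>0. \<forall>y\<in>X. dist y x < d \<longrightarrow> dist (h y) (h x) < r"
      using that \<open>x \<in> X\<close> \<open>0 < r\<close> by (intro exI[of _ d]) (force simp: dist_norm)
  qed
  have approx: "norm ((\<integral>x. h x \<partial>N) - (\<Sum>y\<in>F. (\<integral>x. \<psi> y x \<partial>N) *\<^sub>R h y)) \<le> e / 4"
    if N: "finite_measure N" "sets N = sets (borel_on X)" "measure N X \<le> C" and h: "h \<in> H" for N h
    using integral_partition_approx[OF X N F c\<psi> \<psi> hc[OF h] \<delta>(2)[OF h] less_imp_le[OF \<epsilon>(1)]] \<epsilon>(2) by simp
  define D where "D n = (\<Sum>y\<in>F. \<bar>(\<integral>x. \<psi> y x \<partial>Ms n) - (\<integral>x. \<psi> y x \<partial>M)\<bar> * \<bar>B\<bar>)" for n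
  have "D \<longlonglongrightarrow> (\<Sum>y\<in>F. \<bar>(\<integral>x. \<psi> y x \<partial>M) - (\<integral>x. \<psi> y x \<partial>M)\<bar> * \<bar>B\<bar>)"
    unfolding D_def using conv c\<psi> by (intro tendsto_intros) (auto simp: weakly_converges_def)
  then have "D \<longlonglongrightarrow> 0" by simp
  then have "\<forall>\<^sub>F n in sequentially. D n < e / 4" using e by (intro order_tendstoD(2)) auto
  then show ?thesis
  proof eventually_elim
    case (elim n)
    show ?case
    proof
      fix h assume h: "h \<in> H"
      let ?a = "\<integral>x. h x \<partial>Ms n" and ?b = "\<integral>x. h x \<partial>M"
      let ?a' = "\<Sum>y\<in>F. (\<integral>x. \<psi> y x \<partial>Ms n) *\<^sub>R h y" and ?b' = "\<Sum>y\<in>F. (\<integral>x. \<psi> y x \<partial>M) *\<^sub>R h y"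
      have "?a' - ?b' = (\<Sum>y\<in>F. ((\<integral>x. \<psi> y x \<partial>Ms n) - (\<integral>x. \<psi> y x \<partial>M)) *\<^sub>R h y)"
        by (simp add: sum_subtractf scaleR_diff_left)
      also have "norm \<dots> \<le> D n"
        unfolding D_def
      proof (rule sum_norm_le)
        fix y assume "y \<in> F"
        then have "norm (h y) \<le> \<bar>B\<bar>" using B[OF h, of y] F(2) by force
        then show "norm (((\<integral>x. \<psi> y x \<partial>Ms n) - (\<integral>x. \<psi> y x \<partial>M)) *\<^sub>R h y) \<le> \<bar>(\<integral>x. \<psi> y x \<partial>Ms n) - (\<integral>x. \<psi> y x \<partial>M)\<bar> * \<bar>B\<bar>"
          by (simp add: mult_left_mono)
      qed
      finally have ab: "norm (?a' - ?b') \<le> D n" .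
      have "norm (?a - ?b) = norm ((?a - ?a') + (?a' - ?b') - (?b - ?b'))" by simp
      also have "\<dots> \<le> norm (?a - ?a') + norm (?a' - ?b') + norm (?b - ?b')"
        by (meson norm_triangle_ineq4 norm_triangle_ineq order_trans add_right_mono)
      finally show "norm (?a - ?b) < e"
        using ab approx[OF Ms(1)[of n] Ms(2)[of n] Ms(3)[of n] h] approx[OF M h] elim e by linarith
    qed
  qed
qed

text \<open>If uniformity failed, a gap of at least \<open>e\<close> would occur at points
  \<open>z n\<close> along a subsequence of indices; by compactness these points accumulate, which
  contradicts convergence along moving arguments.\<close>

lemma continuous_convergence_uniform:
  fixes h :: "nat \<Rightarrow> 'a::metric_space \<Rightarrow> 'b::metric_space"
  assumes X: "compact X" and cont: "continuous_on X h0"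
    and conv: "\<And>xs x. (\<And>n. xs n \<in> X) \<Longrightarrow> x \<in> X \<Longrightarrow> xs \<longlonglongrightarrow> x \<Longrightarrow> (\<lambda>n. h n (xs n)) \<longlonglongrightarrow> h0 x"
  shows "uniform_limit X h h0 sequentially"
proof (rule uniform_limitI, rule ccontr)
  fix e :: real assume e: "e > 0" and "\<not> (\<forall>\<^sub>F n in sequentially. \<forall>x\<in>X. dist (h n x) (h0 x) < e)"
  then have "\<forall>N. \<exists>n\<ge>N. \<exists>x\<in>X. e \<le> dist (h n x) (h0 x)"
    by (auto simp: eventually_sequentially not_less)
  then have "infinite {n. \<exists>x\<in>X. e \<le> dist (h n x) (h0 x)}"
    by (auto simp: infinite_nat_iff_unbounded_le)
  from infinite_enumerate[OF this] obtain r :: "nat \<Rightarrow> nat" where r: "strict_mono r"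
    and "\<forall>n. r n \<in> {n. \<exists>x\<in>X. e \<le> dist (h n x) (h0 x)}" by blast
  then have "\<forall>n. \<exists>x\<in>X. e \<le> dist (h (r n) x) (h0 x)" by simp
  then obtain z where z: "\<And>n. z n \<in> X" "\<And>n. e \<le> dist (h (r n) (z n)) (h0 (z n))" by metis
  obtain l s where l: "l \<in> X" and s: "strict_mono (s::nat\<Rightarrow>nat)" and lim: "(z \<circ> s) \<longlonglongrightarrow> l"
    using X z(1) unfolding compact_eq_seq_compact_metric by (elim seq_compactE[of X z]) auto
  define t where "t = r \<circ> s"
  have t: "strict_mono t" using r s by (simp add: t_def strict_mono_o)
  \<comment> \<open>The hypothesis speaks of full sequences, so the indices missed by the
    subsequence are filled with the limit \<open>l\<close>.\<close>
  define x where "x n = (if n \<in> range t then z (s (the_inv t n)) else l)" for n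
  have xt: "x (t k) = z (s k)" for k
    using t by (simp add: x_def the_inv_f_f strict_mono_imp_inj_on)
  have "x \<longlonglongrightarrow> l"
  proof (rule metric_LIMSEQ_I)
    fix d :: real assume "d > 0"
    then obtain K where K: "\<And>k. k \<ge> K \<Longrightarrow> dist (z (s k)) l < d"
      using metric_LIMSEQ_D[OF lim] by auto
    have "dist (x n) l < d" if "n \<ge> t K" for n
    proof (cases "n \<in> range t")
      case True
      then obtain k where k: "n = t k" by blast
      then have "k \<ge> K" using that t by (simp add: strict_mono_less_eq)
      then show ?thesis using K xt k by simp
    qed (use \<open>d > 0\<close> in \<open>simp add: x_def\<close>)
    then show "\<exists>N. \<forall>n\<ge>N. dist (x n) l < d" by blast
  qed
  moreover have "x n \<in> X" for n using z l by (simp add: x_def)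
  ultimately have "(\<lambda>n. h n (x n)) \<longlonglongrightarrow> h0 l" using conv l by blast
  from LIMSEQ_subseq_LIMSEQ[OF this t] have 1: "(\<lambda>k. h (t k) (z (s k))) \<longlonglongrightarrow> h0 l" by (simp add: o_def xt)
  have 2: "(\<lambda>k. h0 (z (s k))) \<longlonglongrightarrow> h0 l"
    using continuous_on_tendsto_compose[OF cont lim l] z by (simp add: o_def)
  have "(\<lambda>k. dist (h (t k) (z (s k))) (h0 (z (s k)))) \<longlonglongrightarrow> 0"
    using tendsto_dist[OF 1 2] by simp
  then have "\<forall>\<^sub>F k in sequentially. dist (h (t k) (z (s k))) (h0 (z (s k))) < e"
    using e by (rule order_tendstoD(2))
  then show False using z(2) by (auto simp: t_def o_def not_le dest!: eventually_happens) (metis leD)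
qed

text \<open>Meant for payoffs that change together with the law they are integrated against. The
  integrands converge uniformly on the compact set, which costs at most the uniform distance times
  \<open>C\<close>; what remains is weak convergence for the fixed \<open>h0\<close>.\<close>

lemma weakly_converges_integral:
  fixes h :: "nat \<Rightarrow> 'a::metric_space \<Rightarrow> 'b::{banach, second_countable_topology}"
  assumes X: "compact X"
    and M: "finite_measure M" "sets M = sets (borel_on X)" "measure M X \<le> C"
    and Ms: "\<And>n. finite_measure (Ms n)" "\<And>n. sets (Ms n) = sets (borel_on X)" "\<And>n. measure (Ms n) X \<le> C"
    and conv: "weakly_converges X Ms M"
    and h: "\<And>n. integrable (Ms n) (h n)" "continuous_on X h0"
    and hconv: "\<And>xs x. (\<And>n. xs n \<in> X) \<Longrightarrow> x \<in> X \<Longrightarrow> xs \<longlonglongrightarrow> x \<Longrightarrow> (\<lambda>n. h n (xs n)) \<longlonglongrightarrow> h0 x"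
  shows "(\<lambda>n. \<integral>x. h n x \<partial>Ms n) \<longlonglongrightarrow> (\<integral>x. h0 x \<partial>M)"
proof -
  have u: "uniform_limit X h h0 sequentially"
    by (rule continuous_convergence_uniform[OF X h(2) hconv])
  have C0: "0 \<le> C" using M(3) measure_nonneg order_trans by blast
  have i0: "integrable (Ms n) h0" for n
    by (rule integrable_continuous_on_compact[OF Ms(1,2) X h(2)])
  have 1: "(\<lambda>n. (\<integral>x. h n x \<partial>Ms n) - (\<integral>x. h0 x \<partial>Ms n)) \<longlonglongrightarrow> 0"
  proof (rule metric_LIMSEQ_I)
    fix e :: real assume e: "e > 0"
    define d where "d = e / 2 / (C + 1)"
    have d: "d > 0" using e C0 by (simp add: d_def)
    have "d * (C + 1) = e / 2" using C0 unfolding d_def by (metis add_pos_nonneg add.commute less_irrefl nonzero_eq_divide_eq zero_less_one)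
    then have "d * C < e" using d e by (simp add: algebra_simps)
    note d = d this
    obtain N where N: "\<And>n x. n \<ge> N \<Longrightarrow> x \<in> X \<Longrightarrow> dist (h n x) (h0 x) < d"
      using uniform_limitD[OF u d(1)] by (auto simp: eventually_sequentially)
    have "dist ((\<integral>x. h n x \<partial>Ms n) - (\<integral>x. h0 x \<partial>Ms n)) 0 < e" if "n \<ge> N" for n
    proof -
      interpret Mn: finite_measure "Ms n" by fact
      have sp: "space (Ms n) = X" using space_borel_onI[OF Ms(2)] .
      have "norm ((\<integral>x. h n x \<partial>Ms n) - (\<integral>x. h0 x \<partial>Ms n)) = norm (\<integral>x. h n x - h0 x \<partial>Ms n)"
        using h i0 by simp
      also have "\<dots> \<le> (\<integral>x. norm (h n x - h0 x) \<partial>Ms n)" by (rule integral_norm_bound)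
      also have "\<dots> \<le> (\<integral>x. d \<partial>Ms n)"
        using h(1) i0 N[OF that] sp by (intro integral_mono) (auto simp: dist_norm intro: less_imp_le)
      also have "\<dots> = d * measure (Ms n) X" by (simp add: sp mult.commute)
      also have "\<dots> \<le> d * C" using d Ms(3) by (intro mult_left_mono) auto
      finally show ?thesis using d by (simp add: dist_norm)
    qed
    then show "\<exists>N. \<forall>n\<ge>N. dist ((\<integral>x. h n x \<partial>Ms n) - (\<integral>x. h0 x \<partial>Ms n)) 0 < e" by blast
  qed
  have 2: "(\<lambda>n. \<integral>x. h0 x \<partial>Ms n) \<longlonglongrightarrow> (\<integral>x. h0 x \<partial>M)"
  proof (rule metric_LIMSEQ_I)
    fix e :: real assume e: "e > 0"
    have un: "uniformly_continuous_on X h0" using X h(2) by (rule compact_uniformly_continuous[rotated])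
    have "bounded (h0 ` X)" using X h(2) by (intro compact_imp_bounded compact_continuous_image)
    then obtain B where B: "\<And>x. x \<in> X \<Longrightarrow> norm (h0 x) \<le> B" by (auto simp: bounded_iff)
    have "\<forall>\<^sub>F n in sequentially. \<forall>h\<in>{h0}. norm ((\<integral>x. h x \<partial>Ms n) - (\<integral>x. h x \<partial>M)) < e"
    proof (rule weakly_converges_uniform[OF X M Ms conv _ _ e])
      fix \<epsilon> :: real assume "\<epsilon> > 0"
      then obtain \<delta> where "\<delta> > 0" "\<And>x y. x \<in> X \<Longrightarrow> y \<in> X \<Longrightarrow> dist y x < \<delta> \<Longrightarrow> dist (h0 y) (h0 x) < \<epsilon>"
        using un unfolding uniformly_continuous_on_def by metis
      then show "\<exists>\<delta>>0. \<forall>h\<in>{h0}. \<forall>x\<in>X. \<forall>y\<in>X. dist x y < \<delta> \<longrightarrow> norm (h x - h y) \<le> \<epsilon>"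
        by (auto simp: dist_norm intro!: exI[of _ \<delta>] less_imp_le)
    qed (use B in auto)
    then show "\<exists>N. \<forall>n\<ge>N. dist (\<integral>x. h0 x \<partial>Ms n) (\<integral>x. h0 x \<partial>M) < e"
      by (simp add: eventually_sequentially dist_norm)
  qed
  show ?thesis using tendsto_add[OF 1 2] by simp
qed


text \<open>Partitions of unity of mesh \<open>1 / (k + 1)\<close>, for all \<open>k\<close>.\<close>

lemma countable_test_functions:
  fixes X :: "'a::metric_space set"
  assumes X: "compact X" "X \<noteq> {}"
  obtains \<psi> :: "nat \<Rightarrow> 'a \<Rightarrow> real" where "\<And>n. continuous_on X (\<psi> n)"
    "\<And>x y. x \<in> X \<Longrightarrow> y \<in> X \<Longrightarrow> x \<noteq> y \<Longrightarrow> \<exists>n. \<psi> n x \<noteq> \<psi> n y"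
    "\<And>Ms M C. \<lbrakk>finite_measure M; sets M = sets (borel_on X); measure M X \<le> C;
      \<And>k. finite_measure (Ms k); \<And>k. sets (Ms k) = sets (borel_on X); \<And>k. measure (Ms k) X \<le> C;
      \<And>n. (\<lambda>k. \<integral>x. \<psi> n x \<partial>Ms k) \<longlonglongrightarrow> (\<integral>x. \<psi> n x \<partial>M)\<rbrakk> \<Longrightarrow> weakly_converges X Ms M"
proof -
  have "\<exists>F (\<Psi> :: 'a \<Rightarrow> 'a \<Rightarrow> real). finite F \<and> F \<subseteq> X \<and> (\<forall>y. continuous_on X (\<Psi> y)) \<and> (\<forall>y. \<forall>x\<in>X. 0 \<le> \<Psi> y x)
      \<and> (\<forall>x\<in>X. (\<Sum>y\<in>F. \<Psi> y x) = 1) \<and> (\<forall>x\<in>X. \<forall>y. \<Psi> y x \<noteq> 0 \<longrightarrow> dist x y < 1 / real (Suc k))" for k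
  proof -
    have "1 / real (Suc k) > 0" by simp
    from partition_of_unity_compact[OF X(1) this] show ?thesis by metis
  qed
  then obtain F and \<Psi> :: "nat \<Rightarrow> 'a \<Rightarrow> 'a \<Rightarrow> real" where F: "\<And>k. finite (F k)" "\<And>k. F k \<subseteq> X"
    and c\<Psi>: "\<And>k y. continuous_on X (\<Psi> k y)" and \<Psi>: "\<And>k y x. x \<in> X \<Longrightarrow> 0 \<le> \<Psi> k y x"
      "\<And>k x. x \<in> X \<Longrightarrow> (\<Sum>y\<in>F k. \<Psi> k y x) = 1" "\<And>k x y. x \<in> X \<Longrightarrow> \<Psi> k y x \<noteq> 0 \<Longrightarrow> dist x y < 1 / real (Suc k)"
    by metis
  define Q where "Q = Sigma UNIV F"
  have Qc: "countable Q" unfolding Q_def using F(1) by (intro countable_SIGMA) (auto intro: countable_finite)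
  define \<psi> where "\<psi> n = (case from_nat_into Q n of (k, y) \<Rightarrow> \<Psi> k y)" for n
  have code: "\<exists>n. \<psi> n = \<Psi> k y" if "y \<in> F k" for k y
    using that Qc by (intro exI[of _ "to_nat_on Q (k, y)"]) (simp add: \<psi>_def Q_def)
  show thesis
  proof
    show "continuous_on X (\<psi> n)" for n by (simp add: \<psi>_def c\<Psi> split: prod.split)
    show "\<exists>n. \<psi> n x \<noteq> \<psi> n y" if xy: "x \<in> X" "y \<in> X" "x \<noteq> y" for x y
    proof -
      \<comment> \<open>The support radius is below half of the distance: some bump is nonzero at
        \<open>x\<close>, because the bumps sum to 1, and it cannot reach \<open>y\<close>.\<close>
      obtain k where k: "2 / real (Suc k) < dist x y"
        using reals_Archimedean[of "dist x y / 2"] xy by (auto simp: inverse_eq_divide field_simps)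
      obtain z where z: "z \<in> F k" "\<Psi> k z x \<noteq> 0"
        using \<Psi>(2)[OF xy(1), of k] by (metis sum.neutral zero_neq_one)
      have "\<Psi> k z y = 0"
      proof (rule ccontr)
        assume "\<Psi> k z y \<noteq> 0"
        then have "dist x y < 1 / real (Suc k) + 1 / real (Suc k)"
          using \<Psi>(3)[OF xy(1) z(2)] \<Psi>(3)[OF xy(2)] dist_triangle2[of x y z] by fastforce
        then show False using k by simp
      qed
      then show ?thesis using code[OF z(1)] z(2) by metis
    qed
    fix Ms M C
    assume M: "finite_measure M" "sets M = sets (borel_on X)" "measure M X \<le> C"
      and Ms: "\<And>k. finite_measure (Ms k)" "\<And>k. sets (Ms k) = sets (borel_on X)" "\<And>k. measure (Ms k) X \<le> C"
      and lim: "\<And>n. (\<lambda>k. \<integral>x. \<psi> n x \<partial>Ms k) \<longlonglongrightarrow> (\<integral>x. \<psi> n x \<partial>M)"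
    have C0: "0 \<le> C" using M(3) measure_nonneg order_trans by blast
    show "weakly_converges X Ms M"
      unfolding weakly_converges_def
    proof (intro allI impI metric_LIMSEQ_I)
      fix \<phi> :: "'a \<Rightarrow> real" and e :: real assume \<phi>: "continuous_on X \<phi>" and e: "0 < e"
      define \<epsilon> where "\<epsilon> = e / (4 * (C + 1))"
      have \<epsilon>: "\<epsilon> > 0" "\<epsilon> * C \<le> e / 4" using e C0 by (auto simp: \<epsilon>_def field_simps)
      have "uniformly_continuous_on X \<phi>" using X(1) \<phi> by (rule compact_uniformly_continuous[rotated])
      then obtain \<delta> where \<delta>: "\<delta> > 0" "\<And>x y. x \<in> X \<Longrightarrow> y \<in> X \<Longrightarrow> dist y x < \<delta> \<Longrightarrow> dist (\<phi> y) (\<phi> x) < \<epsilon>"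
        using \<epsilon>(1) unfolding uniformly_continuous_on_def by metis
      obtain k where k: "1 / real (Suc k) < \<delta>" using reals_Archimedean[OF \<delta>(1)] by (auto simp: inverse_eq_divide)
      have mod: "norm (\<phi> x - \<phi> y) \<le> \<epsilon>" if "x \<in> X" "y \<in> X" "dist x y < 1 / real (Suc k)" for x y
        using \<delta>(2)[of y x] that k by (simp add: dist_real_def)
      note approx = integral_partition_approx[OF X(1) _ _ _ F c\<Psi> \<Psi>(1) \<Psi>(2) \<Psi>(3) \<phi> mod less_imp_le[OF \<epsilon>(1)]]
      define A where "A L = (\<Sum>y\<in>F k. (\<integral>x. \<Psi> k y x \<partial>L) *\<^sub>R \<phi> y)" for L
      have "(\<lambda>j. A (Ms j)) \<longlonglongrightarrow> A M"
        unfolding A_def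
      proof (intro tendsto_sum tendsto_scaleR tendsto_const)
        fix y assume "y \<in> F k"
        then obtain n where "\<psi> n = \<Psi> k y" using code by blast
        then show "(\<lambda>j. \<integral>x. \<Psi> k y x \<partial>Ms j) \<longlonglongrightarrow> (\<integral>x. \<Psi> k y x \<partial>M)" using lim[of n] by simp
      qed
      then obtain N where N: "\<And>j. j \<ge> N \<Longrightarrow> dist (A (Ms j)) (A M) < e / 4"
        using metric_LIMSEQ_D[of "\<lambda>j. A (Ms j)" "A M" "e/4"] e by auto
      have "dist (\<integral>x. \<phi> x \<partial>Ms j) (\<integral>x. \<phi> x \<partial>M) < e" if "j \<ge> N" for j
      proof -
        have "norm ((\<integral>x. \<phi> x \<partial>Ms j) - A (Ms j)) \<le> \<epsilon> * C"
          unfolding A_def by (rule approx[OF Ms(1)[of j] Ms(2)[of j] Ms(3)[of j]])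
        moreover have "norm ((\<integral>x. \<phi> x \<partial>M) - A M) \<le> \<epsilon> * C"
          unfolding A_def by (rule approx[OF M])
        ultimately show ?thesis using N[OF that] e \<epsilon>(2) unfolding dist_real_def real_norm_def by linarith
      qed
      then show "\<exists>N. \<forall>j\<ge>N. dist (\<integral>x. \<phi> x \<partial>Ms j) (\<integral>x. \<phi> x \<partial>M) < e" by blast
    qed
  qed
qed

text \<open>The digits are 0 and 2, as in the Cantor set. At the first index \<open>n\<close> of
  disagreement the terms differ by \<open>2 / 3 ^ Suc n\<close>, and all later digits together undo
  at most \<open>1 / 3 ^ Suc n\<close>; so numbers closer than that share their digits up to
  there.\<close>

lemma ternary_digits_agree:
  fixes a b :: "nat \<Rightarrow> bool"
  defines "t \<equiv> \<lambda>a. \<Sum>i. 2 * of_bool (a i) / 3 ^ Suc i :: real"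
  assumes "\<bar>t a - t b\<bar> < 1 / 3 ^ Suc N" and "i \<le> N"
  shows "a i \<longleftrightarrow> b i"
proof (rule ccontr)
  assume "a i \<noteq> b i"
  define n where "n = (LEAST i. a i \<noteq> b i)"
  have n: "a n \<noteq> b n" unfolding n_def using LeastI[of "\<lambda>i. a i \<noteq> b i" i] \<open>a i \<noteq> b i\<close> by blast
  have before: "a j = b j" if "j < n" for j
    using not_less_Least that unfolding n_def by blast
  have "n \<le> N" using \<open>i \<le> N\<close> \<open>a i \<noteq> b i\<close> Least_le[of "\<lambda>i. a i \<noteq> b i" i] by (simp add: n_def)
  have geo: "(\<lambda>j. 2 / 3 ^ Suc (j + k)) sums (1 / 3 ^ k :: real)" for k :: nat
  proof -
    have "(\<lambda>j. (2 / 3 ^ Suc k) * (1/3) ^ j) sums ((2 / 3 ^ Suc k) * (1 / (1 - 1/3)) :: real)"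
      by (intro sums_mult geometric_sums) simp
    then show ?thesis by (simp add: power_add power_one_over divide_simps mult_ac)
  qed
  have sm: "summable (\<lambda>i. 2 * of_bool (c i) / 3 ^ Suc i :: real)" for c
    by (rule summable_comparison_test'[OF sums_summable[OF geo[of 0]], of 0]) auto
  define e where "e j = (2 * of_bool (a j) / 3 ^ Suc j - 2 * of_bool (b j) / 3 ^ Suc j :: real)" for j
  have sme: "summable e" unfolding e_def by (intro summable_diff sm)
  have "t a - t b = (\<Sum>j. e j)" unfolding t_def e_def by (intro suminf_diff sm)
  also have "\<dots> = (\<Sum>j. e (j + Suc n)) + (\<Sum>j<Suc n. e j)"
    by (rule suminf_split_initial_segment[OF sme])
  also have "(\<Sum>j<Suc n. e j) = e n" using before by (simp add: e_def)
  finally have eq: "t a - t b = (\<Sum>j. e (j + Suc n)) + e n" .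
  have "norm (\<Sum>j. e (j + Suc n)) \<le> (\<Sum>j. 2 / 3 ^ Suc (j + Suc n))"
    by (rule norm_suminf_le[OF _ sums_summable[OF geo]]) (auto simp: e_def)
  also have "\<dots> = 1 / 3 ^ Suc n" using geo by (rule sums_unique[symmetric])
  finally have "\<bar>\<Sum>j. e (j + Suc n)\<bar> \<le> 1 / 3 ^ Suc n" by simp
  moreover have "\<bar>e n\<bar> = 2 / 3 ^ Suc n" using n by (cases "a n") (auto simp: e_def)
  ultimately have "1 / 3 ^ Suc n \<le> \<bar>t a - t b\<bar>" unfolding eq by linarith
  moreover have "1 / 3 ^ Suc N \<le> (1 / 3 ^ Suc n :: real)"
    using \<open>n \<le> N\<close> by (intro divide_left_mono) (auto intro: power_increasing)
  ultimately show False using assms(2) by linarith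
qed

text \<open>The digits of \<open>s x\<close> record membership of \<open>x\<close> in countably many small balls; thus \<open>c\<close> exhibits
  \<open>X\<close> as a continuous image of a compact set of reals.\<close>

lemma compact_real_coding:
  fixes X :: "'a::metric_space set"
  assumes X: "compact X" "X \<noteq> {}"
  obtains s :: "'a \<Rightarrow> real" and c :: "real \<Rightarrow> 'a" where "s \<in> borel_measurable borel" "\<And>x. 0 \<le> s x \<and> s x \<le> 1"
    "c \<in> measurable borel (borel_on X)" "\<And>x. x \<in> X \<Longrightarrow> c (s x) = x" "continuous_on (closure (s ` X)) c"
proof -
  have "\<exists>F. finite F \<and> F \<subseteq> X \<and> X \<subseteq> (\<Union>y\<in>F. ball y (1 / real (Suc k)))" for k
  proof -
    have "X \<subseteq> (\<Union>y\<in>X. ball y (1 / real (Suc k)))" by force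
    from compactE_image[OF X(1) _ this] show ?thesis by (metis Elementary_Metric_Spaces.open_ball)
  qed
  then obtain F where F: "\<And>k. finite (F k)" "\<And>k. F k \<subseteq> X" "\<And>k. X \<subseteq> (\<Union>y\<in>F k. ball y (1 / real (Suc k)))"
    by metis
  define Q where "Q = Sigma UNIV F"
  have Qc: "countable Q" unfolding Q_def using F(1) by (intro countable_SIGMA) (auto intro: countable_finite)
  have Q0: "Q \<noteq> {}" using F(3)[of 0] X(2) unfolding Q_def by auto
  define Bl where "Bl n = (case from_nat_into Q n of (k, y) \<Rightarrow> ball y (1 / real (Suc k)))" for n
  have Blm: "Bl n \<in> sets borel" for n by (auto simp: Bl_def split: prod.split)
  define s where "s x = (\<Sum>i. 2 * of_bool (x \<in> Bl i) / 3 ^ Suc i :: real)" for x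
  have geo: "(\<lambda>j. 2 / 3 ^ Suc j) sums (1::real)"
  proof -
    have "(\<lambda>j. (2 / 3) * (1/3) ^ j) sums ((2 / 3) * (1 / (1 - 1/3)) :: real)"
      by (intro sums_mult geometric_sums) simp
    then show ?thesis by (simp add: power_one_over divide_simps mult_ac)
  qed
  have sm: "summable (\<lambda>i. 2 * of_bool (x \<in> Bl i) / 3 ^ Suc i :: real)" for x
    by (rule summable_comparison_test'[OF sums_summable[OF geo], of 0]) auto
  have sb: "s \<in> borel_measurable borel"
  proof -
    have "(\<lambda>x. 2 * of_bool (x \<in> Bl i) / 3 ^ Suc i :: real) = (\<lambda>x. 2 * indicator (Bl i) x / 3 ^ Suc i)" for i
      by (auto simp: indicator_def)
    then show ?thesis unfolding s_def[abs_def] using Blm by (intro borel_measurable_suminf) auto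
  qed
  have s01: "0 \<le> s x \<and> s x \<le> 1" for x
  proof
    show "0 \<le> s x" unfolding s_def by (rule suminf_nonneg[OF sm]) auto
    have "s x \<le> (\<Sum>j. 2 / 3 ^ Suc j)" unfolding s_def by (intro suminf_le sm sums_summable[OF geo]) auto
    then show "s x \<le> 1" using sums_unique[OF geo] by simp
  qed
  \<comment> \<open>The code \<open>s\<close> jumps, but its inverse is uniformly continuous: points
    with close codes share their first digits and hence lie in a common small ball.\<close>
  have mod: "\<exists>\<delta>>0. \<forall>x\<in>X. \<forall>y\<in>X. \<bar>s x - s y\<bar> < \<delta> \<longrightarrow> dist x y < \<epsilon>" if e: "\<epsilon> > 0" for \<epsilon>
  proof -
    obtain k where k: "2 / real (Suc k) < \<epsilon>"
      using reals_Archimedean[of "\<epsilon>/2"] e by (auto simp: inverse_eq_divide field_simps)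
    define N where "N = Max ((\<lambda>y. to_nat_on Q (k, y)) ` F k)"
    have "dist x y < \<epsilon>" if xy: "x \<in> X" "y \<in> X" "\<bar>s x - s y\<bar> < 1 / 3 ^ Suc N" for x y
    proof -
      obtain z where z: "z \<in> F k" "dist z x < 1 / real (Suc k)" using F(3)[of k] xy by auto
      have "to_nat_on Q (k, z) \<le> N" unfolding N_def using F(1) z by (intro Max_ge) auto
      from ternary_digits_agree[OF xy(3)[unfolded s_def] this]
      have "x \<in> Bl (to_nat_on Q (k, z)) \<longleftrightarrow> y \<in> Bl (to_nat_on Q (k, z))" .
      moreover have "Bl (to_nat_on Q (k, z)) = ball z (1 / real (Suc k))"
        using z Qc by (simp add: Bl_def Q_def from_nat_into_to_nat_on)
      ultimately have "dist z y < 1 / real (Suc k)" using z by simp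
      then have "dist x y < 1 / real (Suc k) + 1 / real (Suc k)"
        using z dist_triangle2[of x y z] by (simp add: dist_commute)
      then show ?thesis using k by simp
    qed
    then show ?thesis by (intro exI[of _ "1 / 3 ^ Suc N"]) auto
  qed
  define K where "K = closure (s ` X)"
  \<comment> \<open>This is the closure of the graph of the inverse of \<open>s\<close>. Compactness
    of \<open>X\<close> provides a partner for every \<open>t\<close> in the closure of the codes,
    and \<open>near\<close> yields its uniqueness together with continuity.\<close>
  define R where "R t x \<longleftrightarrow> x \<in> X \<and> (\<exists>xs. (\<forall>n. xs n \<in> X) \<and> (\<lambda>n. s (xs n)) \<longlonglongrightarrow> t \<and> xs \<longlonglongrightarrow> x)" for t x
  have exR: "\<exists>x. R t x" if "t \<in> K" for t
  proof -
    have "\<exists>ts. (\<forall>n. ts n \<in> s ` X) \<and> ts \<longlonglongrightarrow> t"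
      using that unfolding K_def closure_sequential .
    then obtain ts :: "nat \<Rightarrow> real" where ts: "\<And>n. ts n \<in> s ` X" "ts \<longlonglongrightarrow> t" by blast
    then obtain xs where xs: "\<And>n. xs n \<in> X" "\<And>n. ts n = s (xs n)" unfolding image_iff by metis
    obtain x r where x: "x \<in> X" "strict_mono (r::nat\<Rightarrow>nat)" "(xs \<circ> r) \<longlonglongrightarrow> x"
      using seq_compactE[of X xs] xs(1) X(1) by (metis compact_eq_seq_compact_metric)
    have "(\<lambda>n. s ((xs \<circ> r) n)) \<longlonglongrightarrow> t"
      using LIMSEQ_subseq_LIMSEQ[OF ts(2) x(2)] xs(2) by (simp add: o_def)
    then show ?thesis unfolding R_def using x xs by (intro exI[of _ x] conjI exI[of _ "xs \<circ> r"]) auto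
  qed
  define x0 where "x0 = (SOME x. x \<in> X)"
  have x0: "x0 \<in> X" unfolding x0_def using X(2) by (meson someI_ex ex_in_conv)
  \<comment> \<open>The default value makes \<open>c\<close> total with values in \<open>X\<close>,
    so that every law on the line is carried to a law on \<open>X\<close>.\<close>
  define c where "c t = (if t \<in> K then SOME x. R t x else x0)" for t
  have cR: "R t (c t)" if "t \<in> K" for t
    using someI_ex[OF exR[OF that]] that by (simp add: c_def)
  have near: "dist x x' \<le> \<epsilon>" if R: "R t x" "R t' x'" and tt: "\<bar>t - t'\<bar> < \<delta>"
    and \<delta>: "\<forall>x\<in>X. \<forall>y\<in>X. \<bar>s x - s y\<bar> < \<delta> \<longrightarrow> dist x y < \<epsilon>" for x x' t t' \<delta> \<epsilon>
  proof -
    obtain xs ys where xs: "\<And>n. xs n \<in> X" "(\<lambda>n. s (xs n)) \<longlonglongrightarrow> t" "xs \<longlonglongrightarrow> x"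
      and ys: "\<And>n. ys n \<in> X" "(\<lambda>n. s (ys n)) \<longlonglongrightarrow> t'" "ys \<longlonglongrightarrow> x'" using R unfolding R_def by blast
    have "(\<lambda>n. \<bar>s (xs n) - s (ys n)\<bar>) \<longlonglongrightarrow> \<bar>t - t'\<bar>" by (intro tendsto_intros xs ys)
    then have "\<forall>\<^sub>F n in sequentially. \<bar>s (xs n) - s (ys n)\<bar> < \<delta>" using tt by (rule order_tendstoD(2))
    then have "\<forall>\<^sub>F n in sequentially. dist (xs n) (ys n) \<le> \<epsilon>"
      by eventually_elim (use \<delta> xs(1) ys(1) in \<open>auto intro: less_imp_le\<close>)
    then show ?thesis by (intro tendsto_upperbound[OF tendsto_dist[OF xs(3) ys(3)]]) auto
  qed
  have cX: "c t \<in> X" for t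
    using cR x0 by (cases "t \<in> K") (auto simp: R_def c_def)
  have cc: "continuous_on K c"
    unfolding continuous_on_iff
  proof (intro ballI allI impI)
    fix t e assume t: "t \<in> K" and "(0::real) < e"
    then obtain \<delta> where \<delta>: "\<delta> > 0" "\<forall>x\<in>X. \<forall>y\<in>X. \<bar>s x - s y\<bar> < \<delta> \<longrightarrow> dist x y < e / 2"
      using mod[of "e/2"] by auto
    have "dist (c t') (c t) < e" if "t' \<in> K" "dist t' t < \<delta>" for t'
      using near[OF cR[OF that(1)] cR[OF t] _ \<delta>(2)] that \<open>0 < e\<close> by (force simp: dist_real_def)
    then show "\<exists>d>0. \<forall>t'\<in>K. dist t' t < d \<longrightarrow> dist (c t') (c t) < e" using \<delta>(1) by blast
  qed
  have "c (s x) = x" if x: "x \<in> X" for x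
  proof (rule ccontr)
    assume ne: "c (s x) \<noteq> x"
    have sK: "s x \<in> K" using x closure_subset[of "s ` X"] unfolding K_def by auto
    have Rx: "R (s x) x" unfolding R_def using x by (intro conjI exI[of _ "\<lambda>_. x"]) auto
    obtain \<delta> where \<delta>: "\<delta> > 0" "\<forall>x'\<in>X. \<forall>y\<in>X. \<bar>s x' - s y\<bar> < \<delta> \<longrightarrow> dist x' y < dist (c (s x)) x / 2"
      using mod[of "dist (c (s x)) x / 2"] ne by auto
    from near[OF cR[OF sK] Rx _ \<delta>(2)] \<delta>(1) ne show False by simp
  qed
  moreover have "c \<in> measurable borel (borel_on X)"
  proof (rule measurable_restrict_space2)
    have "closed K" by (simp add: K_def)
    have "(\<lambda>t. if t \<in> K then c t else x0) \<in> borel_measurable borel"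
      using \<open>closed K\<close> cc by (intro borel_measurable_continuous_on_if) auto
    moreover have "(\<lambda>t. if t \<in> K then c t else x0) = c" by (auto simp: c_def)
    ultimately show "c \<in> borel_measurable borel" by simp
  qed (use cX in auto)
  ultimately show thesis using that sb s01 cc unfolding K_def by blast
qed

text \<open>The codes turn the measures into laws on the unit interval, where tightness yields a
  convergent subsequence. Since \<open>s\<close> is only measurable, weak convergence is not
  transported by \<open>s\<close> but brought back by \<open>c\<close>, which is continuous on the
  closure of the codes.\<close>

theorem weak_sequential_compactness:
  fixes X :: "'a::metric_space set"
  assumes X: "compact X"
    and Ms: "\<And>n. prob_space (Ms n)" "\<And>n. sets (Ms n) = sets (borel_on X)"
  obtains r M where "strict_mono (r :: nat \<Rightarrow> nat)" "prob_space M" "sets M = sets (borel_on X)"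
    "weakly_converges X (Ms \<circ> r) M"
proof -
  interpret P: prob_space "Ms n" for n by fact
  have sp: "space (Ms n) = X" for n by (rule space_borel_onI[OF Ms(2)])
  then have X0: "X \<noteq> {}" using P.not_empty by blast
  obtain s :: "'a \<Rightarrow> real" and c where s: "s \<in> borel_measurable borel" "\<And>x. 0 \<le> s x \<and> s x \<le> 1"
    and c: "c \<in> measurable borel (borel_on X)" "\<And>x. x \<in> X \<Longrightarrow> c (s x) = x" "continuous_on (closure (s ` X)) c"
    by (rule compact_real_coding[OF X X0]) (rule that)
  have sm: "s \<in> borel_measurable (Ms n)" for n
    using measurable_compose[OF id_measurable_borel_on[OF Ms(2)] s(1)] .
  define N where "N n = distr (Ms n) borel s" for n
  have rd: "real_distribution (N n)" for n
    unfolding N_def by (rule P.real_distribution_distr[OF sm])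
  have "tight N"
    unfolding tight_def
  proof (intro conjI allI impI rd)
    fix \<epsilon> :: real assume "\<epsilon> > 0"
    \<comment> \<open>Tightness is phrased with half-open intervals, so the left end has to lie
      below 0 in order to include the code 0.\<close>
    have "measure (N n) {-1<..1} = 1" for n
    proof -
      have "s -` {-1<..1} \<inter> space (Ms n) = space (Ms n)"
      proof -
        have "-1 < s x \<and> s x \<le> 1" for x using s(2)[of x] by linarith
        then show ?thesis by auto
      qed
      then show ?thesis unfolding N_def by (subst measure_distr[OF sm]) (auto simp: P.prob_space)
    qed
    then show "\<exists>a b. a < b \<and> (\<forall>n. 1 - \<epsilon> < measure (N n) {a<..b})"
      using \<open>\<epsilon> > 0\<close> by (intro exI[of _ "-1"] exI[of _ 1]) auto
  qed
  then obtain r M' where r: "strict_mono (r::nat\<Rightarrow>nat)" and M': "real_distribution M'" and w: "weak_conv_m (N \<circ> id \<circ> r) M'"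
    using tight_imp_convergent_subsubsequence[of N id] strict_mono_id by blast
  interpret M': real_distribution M' by fact
  have rd': "real_distribution ((N \<circ> id \<circ> r) n)" for n using rd by simp
  have lim: "(\<lambda>n. \<integral>x. \<Phi> (s x) \<partial>Ms (r n)) \<longlonglongrightarrow> (\<integral>t. \<Phi> t \<partial>M')"
    if "continuous_on UNIV \<Phi>" "\<And>t. norm (\<Phi> t) \<le> B" for \<Phi> :: "real \<Rightarrow> real" and B
  proof -
    have "(\<lambda>n. integral\<^sup>L ((N \<circ> id \<circ> r) n) \<Phi>) \<longlonglongrightarrow> integral\<^sup>L M' \<Phi>"
      using that by (intro weak_conv_imp_integral_bdd_continuous_conv[OF rd' M' w, where B=B])
        (auto simp: continuous_on_eq_continuous_at)
    moreover have "\<Phi> \<in> borel_measurable borel" using that(1) by (rule borel_measurable_continuous_onI)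
    ultimately show ?thesis by (simp add: N_def integral_distr[OF sm])
  qed
  define K where "K = closure (s ` X)"
  have K: "closed K" "K \<noteq> {}" using X0 by (auto simp: K_def)
  have sK: "s x \<in> K" if "x \<in> X" for x using that closure_subset[of "s ` X"] by (auto simp: K_def)
  \<comment> \<open>The limit cannot charge points off \<open>K\<close>: a bounded continuous
    function that vanishes exactly on \<open>K\<close> has integral 0 along the whole
    sequence.\<close>
  have AEK: "AE t in M'. t \<in> K"
  proof -
    define \<Phi> where "\<Phi> t = min 1 (infdist t K)" for t
    have "continuous_on UNIV \<Phi>" unfolding \<Phi>_def by (intro continuous_intros)
    moreover have "norm (\<Phi> t) \<le> 1" for t by (simp add: \<Phi>_def infdist_nonneg)
    ultimately have "(\<lambda>n. \<integral>x. \<Phi> (s x) \<partial>Ms (r n)) \<longlonglongrightarrow> (\<integral>t. \<Phi> t \<partial>M')" by (rule lim)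
    moreover have "(\<integral>x. \<Phi> (s x) \<partial>Ms n) = 0" for n
    proof -
      have "(\<integral>x. \<Phi> (s x) \<partial>Ms n) = (\<integral>x. 0 \<partial>Ms n)"
        using sp sK by (intro Bochner_Integration.integral_cong) (auto simp: \<Phi>_def)
      then show ?thesis by simp
    qed
    ultimately have z: "(\<integral>t. \<Phi> t \<partial>M') = 0" by (simp add: LIMSEQ_const_iff)
    have i: "integrable M' \<Phi>"
      using \<open>continuous_on UNIV \<Phi>\<close> by (intro M'.integrable_const_bound[where B=1])
        (auto simp: \<Phi>_def infdist_nonneg borel_measurable_continuous_onI)
    have "AE t in M'. \<Phi> t = 0"
      using integral_nonneg_eq_0_iff_AE[OF i] z by (simp add: \<Phi>_def infdist_nonneg)
    then show ?thesis
    proof eventually_elim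
      case (elim t)
      then have "infdist t K = 0" by (auto simp: \<Phi>_def min_def split: if_splits)
      then show ?case using K by (simp add: in_closed_iff_infdist_zero)
    qed
  qed
  have cm: "c \<in> measurable M' (borel_on X)" using c(1) by simp
  define M where "M = distr M' (borel_on X) c"
  have "prob_space M" unfolding M_def by (rule M'.prob_space_distr[OF cm])
  moreover have "sets M = sets (borel_on X)" by (simp add: M_def)
  moreover have "weakly_converges X (Ms \<circ> r) M"
    unfolding weakly_converges_def
  proof (intro allI impI)
    fix \<phi> :: "'a \<Rightarrow> real" assume \<phi>: "continuous_on X \<phi>"
    have cK: "c ` K \<subseteq> X" using measurable_space[OF c(1)] by (auto simp: space_restrict_space)
    have cont: "continuous_on K (\<lambda>t. \<phi> (c t))"
      using continuous_on_compose2[OF \<phi> c(3)] cK by (simp add: K_def)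
    have "bounded (\<phi> ` X)" using X \<phi> by (intro compact_imp_bounded compact_continuous_image)
    then obtain B where B: "\<And>x. x \<in> X \<Longrightarrow> norm (\<phi> x) \<le> B" by (auto simp: bounded_iff)
    have "0 \<le> B" using B X0 norm_ge_zero order_trans by blast
    \<comment> \<open>The composition of \<phi> with \<open>c\<close> is continuous only on
      \<open>K\<close>. Tietze's extension makes it a bounded test function on the line, and off
      \<open>K\<close> neither the laws nor their limit have mass.\<close>
    obtain \<Phi> :: "real \<Rightarrow> real" where \<Phi>: "continuous_on UNIV \<Phi>" "\<And>t. t \<in> K \<Longrightarrow> \<Phi> t = \<phi> (c t)" "\<And>t. norm (\<Phi> t) \<le> B"
    proof (rule Tietze[OF cont, of UNIV B])
      show "closedin (top_of_set UNIV) K" using K by simp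
      show "norm (\<phi> (c t)) \<le> B" if "t \<in> K" for t using B cK that by blast
    qed (use \<open>0 \<le> B\<close> in auto)
    have 1: "(\<integral>x. \<Phi> (s x) \<partial>Ms n) = (\<integral>x. \<phi> x \<partial>Ms n)" for n
      using sp sK \<Phi>(2) c(2) by (intro Bochner_Integration.integral_cong) auto
    have \<phi>m: "\<phi> \<in> borel_measurable (borel_on X)" using \<phi> by (rule borel_measurable_continuous_on_restrict)
    have "(\<integral>x. \<phi> x \<partial>M) = (\<integral>t. \<phi> (c t) \<partial>M')" unfolding M_def by (rule integral_distr[OF cm \<phi>m])
    also have "\<dots> = (\<integral>t. \<Phi> t \<partial>M')"
      using AEK \<Phi>(1) measurable_compose[OF cm \<phi>m]
      by (intro integral_cong_AE) (auto simp: \<Phi>(2) borel_measurable_continuous_onI elim: eventually_mono)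
    finally have 2: "(\<integral>x. \<phi> x \<partial>M) = (\<integral>t. \<Phi> t \<partial>M')" .
    show "(\<lambda>n. \<integral>x. \<phi> x \<partial>(Ms \<circ> r) n) \<longlonglongrightarrow> (\<integral>x. \<phi> x \<partial>M)"
      using lim[OF \<Phi>(1,3)] by (simp add: 1 2 o_def)
  qed
  ultimately show thesis using that r by blast
qed

section \<open>Disintegration\<close>

lemma Radon_Nikodym_real:
  assumes "finite_measure M" "finite_measure N" "sets N = sets M" "absolutely_continuous M N"
  obtains D :: "'a \<Rightarrow> real" where "integrable M D" "\<And>A. A \<in> sets M \<Longrightarrow> (\<integral>x\<in>A. D x \<partial>M) = measure N A"
proof -
  interpret M: finite_measure M by fact
  interpret N: finite_measure N by fact
  obtain D where D: "D \<in> borel_measurable M" "AE x in M. RN_deriv M N x = ennreal (D x)" "\<And>x. 0 \<le> D x"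
    using M.real_RN_deriv[OF assms(2,4,3)] by metis
  have dens: "density M (\<lambda>x. ennreal (D x)) = N"
  proof -
    have "density M (\<lambda>x. ennreal (D x)) = density M (RN_deriv M N)"
      using D by (intro density_cong) (auto elim: eventually_mono)
    also have "\<dots> = N" by (rule M.density_RN_deriv[OF assms(4,3)])
    finally show ?thesis .
  qed
  have e: "(\<integral>\<^sup>+x. ennreal (D x) * indicator A x \<partial>M) = emeasure N A" if "A \<in> sets M" for A
    using that D(1) by (subst dens[symmetric], subst emeasure_density) auto
  have "(\<integral>\<^sup>+x. ennreal (D x) \<partial>M) = emeasure N (space M)"
    using e[of "space M"] by (simp cong: nn_integral_cong)
  moreover have "emeasure N (space M) < \<infinity>"
    by (metis N.emeasure_finite infinity_ennreal_def top.not_eq_extremum)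
  ultimately have i: "integrable M D"
    using D by (intro integrableI_nonneg) auto
  show thesis
  proof
    fix A assume A: "A \<in> sets M"
    have "ennreal (\<integral>x\<in>A. D x \<partial>M) = (\<integral>\<^sup>+x. ennreal (D x) * indicator A x \<partial>M)"
    proof -
      have "integrable M (\<lambda>x. indicator A x *\<^sub>R D x)" using i A by (rule integrable_mult_indicator[rotated])
      then have "(\<integral>\<^sup>+x. ennreal (indicator A x *\<^sub>R D x) \<partial>M) = ennreal (\<integral>x. indicator A x *\<^sub>R D x \<partial>M)"
        using D by (intro nn_integral_eq_integral) (auto simp: indicator_def)
      moreover have "ennreal (indicator A x *\<^sub>R D x) = ennreal (D x) * indicator A x" for x
        by (simp add: indicator_def)
      ultimately show ?thesis by (simp add: set_lebesgue_integral_def)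
    qed
    also have "\<dots> = emeasure N A" by (rule e[OF A])
    finally have "ennreal (\<integral>x\<in>A. D x \<partial>M) = ennreal (measure N A)" by (simp add: N.emeasure_eq_measure)
    moreover have "0 \<le> (\<integral>x\<in>A. D x \<partial>M)"
      unfolding set_lebesgue_integral_def using D by (intro Bochner_Integration.integral_nonneg) (auto simp: indicator_def)
    ultimately show "(\<integral>x\<in>A. D x \<partial>M) = measure N A" by simp
  qed (rule i)
qed

lemma (in finite_measure) AE_leI_set_integral:
  fixes f g :: "'a \<Rightarrow> real"
  assumes "integrable M f" "integrable M g" "\<And>A. A \<in> sets M \<Longrightarrow> (\<integral>x\<in>A. f x \<partial>M) \<le> (\<integral>x\<in>A. g x \<partial>M)"
  shows "AE x in M. f x \<le> g x"
proof -
  have "AE x in M. 0 \<le> g x - f x"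
  proof (rule density_nonneg)
    show "integrable M (\<lambda>x. g x - f x)" using assms by auto
    fix A assume A: "A \<in> sets M"
    have "(\<integral>x\<in>A. g x - f x \<partial>M) = (\<integral>x\<in>A. g x \<partial>M) - (\<integral>x\<in>A. f x \<partial>M)"
      using assms A unfolding set_integrable_def by (intro set_integral_diff) (simp_all only: set_integrable_def integrable_mult_indicator)
    then show "0 \<le> (\<integral>x\<in>A. g x - f x \<partial>M)" using assms(3)[OF A] by simp
  qed
  then show ?thesis by simp
qed

text \<open>Conditional distribution functions: the Radon--Nikodym derivatives at rational points,
  modified on a null set and regularized from the right.\<close>

lemma disintegration_unit_interval:
  fixes \<gamma> :: "('b \<times> real) measure" and N :: "'b measure"
  assumes \<gamma>: "prob_space \<gamma>" "sets \<gamma> = sets (N \<Otimes>\<^sub>M borel)" and N: "N = distr \<gamma> N fst"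
    and bd: "AE z in \<gamma>. 0 \<le> snd z \<and> snd z \<le> 1"
  obtains \<kappa> where "\<kappa> \<in> measurable N (prob_algebra borel)"
    "\<gamma> = N \<bind> (\<lambda>b. \<kappa> b \<bind> (\<lambda>a. return (N \<Otimes>\<^sub>M borel) (b, a)))"
proof -
  interpret \<gamma>: prob_space \<gamma> by fact
  have [measurable_cong]: "sets \<gamma> = sets (N \<Otimes>\<^sub>M borel)" by fact
  have sp: "space \<gamma> = space N \<times> UNIV" using sets_eq_imp_space_eq[OF \<gamma>(2)] by (simp add: space_pair_measure)
  have "prob_space (distr \<gamma> N fst)" by (rule \<gamma>.prob_space_distr) simp
  then have pN: "prob_space N" using N by simp
  interpret N: prob_space N by fact
  define \<nu> where "\<nu> q A = measure \<gamma> (A \<times> {..q})" for q :: real and A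
  have N_meas: "measure N A = measure \<gamma> (A \<times> UNIV)" if "A \<in> sets N" for A
  proof -
    have "measure (distr \<gamma> N fst) A = measure \<gamma> (fst -` A \<inter> space \<gamma>)" using that by (intro measure_distr) auto
    moreover have "fst -` A \<inter> space \<gamma> = A \<times> UNIV" using sets.sets_into_space[OF that] by (auto simp: sp)
    ultimately show ?thesis using N by simp
  qed
  have \<nu>_le: "\<nu> q A \<le> \<nu> q' A" if "A \<in> sets N" "q \<le> q'" for q q' A
    unfolding \<nu>_def using that by (intro \<gamma>.finite_measure_mono) auto
  have \<nu>_N: "\<nu> q A \<le> measure N A" if "A \<in> sets N" for q A
    unfolding \<nu>_def N_meas[OF that] using that by (intro \<gamma>.finite_measure_mono) auto
  have \<nu>_0: "\<nu> q A = 0" if "A \<in> sets N" "q < 0" for q A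
  proof -
    have "AE z in \<gamma>. z \<notin> A \<times> {..q}" using bd by eventually_elim (use that in auto)
    then show ?thesis unfolding \<nu>_def using that by (subst \<gamma>.prob_eq_0) auto
  qed
  have \<nu>_1: "\<nu> q A = measure N A" if "A \<in> sets N" "q \<ge> 1" for q A
    unfolding \<nu>_def N_meas[OF that(1)]
  proof (rule \<gamma>.finite_measure_eq_AE)
    show "AE z in \<gamma>. z \<in> A \<times> {..q} \<longleftrightarrow> z \<in> A \<times> UNIV" using bd by eventually_elim (use that in auto)
  qed (use that in auto)
  have "\<exists>g. integrable N g \<and> (\<forall>A\<in>sets N. (\<integral>b\<in>A. g b \<partial>N) = \<nu> q A)" for q
  proof -
    let ?R = "distr (density \<gamma> (indicator (space N \<times> {..q}))) N fst"
    have mR: "measure ?R A = \<nu> q A \<and> emeasure ?R A = ennreal (\<nu> q A)" if A: "A \<in> sets N" for A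
    proof -
      have s: "space N \<times> {..q} \<inter> (fst -` A \<inter> space \<gamma>) = A \<times> {..q}"
        using sets.sets_into_space[OF A] by (auto simp: sp)
      have "emeasure ?R A = emeasure (density \<gamma> (indicator (space N \<times> {..q}))) (fst -` A \<inter> space \<gamma>)"
        using A by (subst emeasure_distr) auto
      also have "\<dots> = (\<integral>\<^sup>+z. indicator (space N \<times> {..q}) z * indicator (fst -` A \<inter> space \<gamma>) z \<partial>\<gamma>)"
        using A by (subst emeasure_density) auto
      also have "\<dots> = (\<integral>\<^sup>+z. indicator (A \<times> {..q}) z \<partial>\<gamma>)"
        by (simp only: s flip: indicator_inter_arith)
      also have "\<dots> = emeasure \<gamma> (A \<times> {..q})" using A by (intro nn_integral_indicator) auto
      finally have "emeasure ?R A = ennreal (\<nu> q A)" by (simp add: \<nu>_def \<gamma>.emeasure_eq_measure)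
      moreover have "0 \<le> \<nu> q A" by (simp add: \<nu>_def)
      ultimately show ?thesis by (simp add: measure_eq_emeasure_eq_ennreal)
    qed
    have "finite_measure ?R" using mR[of "space N"] by (intro finite_measureI) auto
    moreover have "absolutely_continuous N ?R"
      unfolding absolutely_continuous_def
    proof
      fix A assume "A \<in> null_sets N"
      then have A: "A \<in> sets N" "measure N A = 0" by (auto simp: measure_eq_0_null_sets)
      then have "\<nu> q A = 0" using \<nu>_N[OF A(1), of q] by (simp add: \<nu>_def measure_le_0_iff)
      then show "A \<in> null_sets ?R" using mR[OF A(1)] A by (simp add: null_sets_def)
    qed
    ultimately obtain D where "integrable N D" "\<And>A. A \<in> sets N \<Longrightarrow> (\<integral>x\<in>A. D x \<partial>N) = measure ?R A"
      using Radon_Nikodym_real[of N ?R] N.finite_measure_axioms by auto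
    then show ?thesis using mR by auto
  qed
  then obtain g where g: "\<And>q. integrable N (g q)" "\<And>q A. A \<in> sets N \<Longrightarrow> (\<integral>b\<in>A. g q b \<partial>N) = \<nu> q A" by metis
  have [measurable]: "g q \<in> borel_measurable N" for q using g(1) by auto
  have set_c: "(\<integral>b\<in>A. c \<partial>N) = c * measure N A" if "A \<in> sets N" for A and c :: real
    using that by (simp add: set_lebesgue_integral_def)
  \<comment> \<open>Conditions at countably many rationals fail on a single null set. The boundary
    values record that the second coordinate lies in the unit interval.\<close>
  define Good where "Good b \<longleftrightarrow> (\<forall>q\<in>\<rat>. \<forall>q'\<in>\<rat>. q \<le> q' \<longrightarrow> g q b \<le> g q' b) \<and> (\<forall>q\<in>\<rat>. (q < 0 \<longrightarrow> g q b = 0) \<and> (q \<ge> 1 \<longrightarrow> g q b = 1))" for b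
  have AEGood: "AE b in N. Good b"
    unfolding Good_def
  proof (intro AE_conjI AE_ball_countable'[OF _ countable_rat])
    fix q q' :: real
    show "AE b in N. q \<le> q' \<longrightarrow> g q b \<le> g q' b"
      by (cases "q \<le> q'") (auto intro!: N.AE_leI_set_integral g(1) simp: g(2) \<nu>_le)
    have "AE b in N. g q b = 0" if "q < 0"
    proof -
      have "AE b in N. g q b \<le> 0" using that by (intro N.AE_leI_set_integral g(1)) (auto simp: g(2) \<nu>_0 set_c)
      moreover have "AE b in N. 0 \<le> g q b" using that by (intro N.AE_leI_set_integral g(1)) (auto simp: g(2) \<nu>_0 set_c)
      ultimately show ?thesis by eventually_elim simp
    qed
    then show "AE b in N. q < 0 \<longrightarrow> g q b = 0" by (cases "q < 0") auto
    have "AE b in N. g q b = 1" if "q \<ge> 1"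
    proof -
      have "AE b in N. g q b \<le> 1" using that by (intro N.AE_leI_set_integral g(1)) (auto simp: g(2) \<nu>_1 set_c)
      moreover have "AE b in N. 1 \<le> g q b" using that by (intro N.AE_leI_set_integral g(1)) (auto simp: g(2) \<nu>_1 set_c)
      ultimately show ?thesis by eventually_elim simp
    qed
    then show "AE b in N. 1 \<le> q \<longrightarrow> g q b = 1" by (cases "q \<ge> 1") auto
  qed
  have [measurable]: "Measurable.pred N Good"
  proof -
    have [simp]: "countable (\<rat> :: real set)" by (rule countable_rat)
    show ?thesis unfolding Good_def by measurable
  qed
  \<comment> \<open>On the exceptional set the family becomes the distribution function of the point
    mass at 0, because a kernel must consist of probability measures everywhere.\<close>
  define G where "G q b = (if Good b then g q b else if q \<ge> 0 then 1 else 0)" for q b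
  have [measurable]: "G q \<in> borel_measurable N" for q unfolding G_def by measurable
  have Gmono: "G q b \<le> G q' b" if "q \<in> \<rat>" "q' \<in> \<rat>" "q \<le> q'" for q q' b
    using that by (auto simp: G_def Good_def)
  have G0: "G q b = 0" if "q \<in> \<rat>" "q < 0" for q b using that by (auto simp: G_def Good_def)
  have G1: "G q b = 1" if "q \<in> \<rat>" "q \<ge> 1" for q b using that by (auto simp: G_def Good_def)
  have G_ge0: "0 \<le> G q b" if "q \<in> \<rat>" for q b
  proof (cases "q < 0")
    case False
    then show ?thesis using Gmono[of "-1" q b] that G0[of "-1" b] by simp
  qed (use G0 that in simp)
  have G_le1: "G q b \<le> 1" if "q \<in> \<rat>" for q b
  proof (cases "q \<ge> 1")
    case False
    then show ?thesis using Gmono[of q 1 b] that G1[of 1 b] by simp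
  qed (use G1 that in simp)
  \<comment> \<open>The inequality is strict so that the infimum of the monotone family over
    \<open>I x\<close> is right-continuous, whatever the value at \<open>x\<close> itself.\<close>
  define I where "I x = {q\<in>\<rat>. x < q}" for x :: real
  have I: "I x \<noteq> {}" "countable (I x)" "I x \<subseteq> \<rat>" for x
    using Rats_dense_in_real[of x "x + 1"] by (auto simp: I_def intro: countable_subset[OF _ countable_rat])
  define F where "F b x = (INF q\<in>I x. G q b)" for b x
  have bddF: "bdd_below ((\<lambda>q. G q b) ` I x)" for b x
    using G_ge0 I(3) by (intro bdd_belowI2[of _ 0]) auto
  have F_le: "F b x \<le> G q b" if "q \<in> \<rat>" "x < q" for b x q
    unfolding F_def using that by (intro cINF_lower bddF) (auto simp: I_def)
  have F_ge: "c \<le> F b x" if "\<And>q. q \<in> \<rat> \<Longrightarrow> x < q \<Longrightarrow> c \<le> G q b" for b x c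
    unfolding F_def using that by (intro cINF_greatest I) (auto simp: I_def)
  have Fmono: "F b x \<le> F b y" if "x \<le> y" for b x y
    using that by (intro F_ge F_le) auto
  have F_lt: "\<exists>q\<in>\<rat>. x < q \<and> G q b < c" if "F b x < c" for b x c
    using that F_ge[of x c b] by (meson not_le)
  have Frc: "continuous (at_right a) (F b)" for a b
  proof -
    have "\<exists>\<delta>>0. F b (a + \<delta>) - F b a < \<epsilon>" if \<epsilon>: "\<epsilon> > 0" for \<epsilon>
    proof -
      obtain q where q: "q \<in> \<rat>" "a < q" "G q b < F b a + \<epsilon>" using F_lt[of b a "F b a + \<epsilon>"] \<epsilon> by auto
      have "F b (a + (q - a) / 2) \<le> G q b" using q by (intro F_le) (auto simp: field_simps)
      then show ?thesis using q by (intro exI[of _ "(q - a) / 2"]) auto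
    qed
    then show ?thesis using continuous_at_right_real_increasing[of "F b" a] Fmono by blast
  qed
  have Fneg: "F b x = 0" if x: "x < 0" for b x
  proof (rule antisym)
    obtain q where "q \<in> \<rat>" "x < q" "q < 0" using Rats_dense_in_real[OF x] by blast
    then show "F b x \<le> 0" using F_le[of q x b] G0 by simp
    show "0 \<le> F b x" by (intro F_ge G_ge0)
  qed
  have F1: "F b x = 1" if "x \<ge> 1" for b x
  proof (rule antisym)
    obtain q where "q \<in> \<rat>" "x < q" using Rats_dense_in_real[of x "x + 1"] by auto
    then show "F b x \<le> 1" using F_le[of q x b] G1[of q b] that by simp
    show "1 \<le> F b x" using G1 that by (intro F_ge) auto
  qed
  have bot: "(F b \<longlongrightarrow> 0) at_bot" for b
    by (rule tendsto_eventually) (auto simp: eventually_at_bot_linorder Fneg intro!: exI[of _ "-1"])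
  have top: "(F b \<longlongrightarrow> 1) at_top" for b
    by (rule tendsto_eventually) (auto simp: eventually_at_top_linorder F1 intro!: exI[of _ "1"])
  have Fmeas[measurable]: "(\<lambda>b. F b x) \<in> borel_measurable N" for x
    unfolding F_def by (intro borel_measurable_cINF I bddF) auto
  have F01: "0 \<le> F b x" "F b x \<le> 1" for b x
  proof -
    show "0 \<le> F b x" by (intro F_ge G_ge0)
    show "F b x \<le> 1" using Fmono[of x "max x 1" b] F1[of "max x 1" b] by simp
  qed
  have Fint: "(\<integral>b\<in>A. F b x \<partial>N) = \<nu> x A" if A: "A \<in> sets N" for A x
  proof -
    have "\<exists>q. q \<in> \<rat> \<and> x < q \<and> q < x + 1 / real (Suc n)" for n
      using Rats_dense_in_real[of x "x + 1 / real (Suc n)"] by auto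
    then obtain p where p: "\<And>n. p n \<in> \<rat>" "\<And>n. x < p n" "\<And>n. p n < x + 1 / real (Suc n)" by metis
    \<comment> \<open>Running minima make the rationals decrease, so that the strips
      \<open>A \<times> {..q n}\<close> shrink to \<open>A \<times> {..x}\<close> and continuity
      from above applies.\<close>
    define q where "q n = Min (p ` {..n})" for n
    have q: "q n \<in> \<rat>" "x < q n" "q n \<le> p n" "q (Suc n) \<le> q n" for n
    proof -
      have "q n \<in> p ` {..n}" unfolding q_def by (intro Min_in) auto
      then show "q n \<in> \<rat>" "x < q n" using p by auto
      show "q n \<le> p n" unfolding q_def by (intro Min_le) auto
      show "q (Suc n) \<le> q n" unfolding q_def by (intro Min_antimono) auto
    qed
    have qx: "q \<longlonglongrightarrow> x"
    proof (rule tendsto_sandwich[of "\<lambda>_. x" _ _ "\<lambda>n. x + 1 / real (Suc n)"])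
      show "(\<lambda>n. x + 1 / real (Suc n)) \<longlonglongrightarrow> x"
        using tendsto_add[OF tendsto_const[of x] LIMSEQ_inverse_real_of_nat] by (simp add: inverse_eq_divide)
      show "\<forall>\<^sub>F n in sequentially. q n \<le> x + 1 / real (Suc n)"
        using order_trans[OF q(3) less_imp_le[OF p(3)]] by (intro always_eventually allI)
    qed (use q in \<open>auto intro!: always_eventually less_imp_le\<close>)
    have GF: "(\<lambda>n. G (q n) b) \<longlonglongrightarrow> F b x" for b
    proof (rule order_tendstoI)
      fix c assume "c < F b x"
      then show "\<forall>\<^sub>F n in sequentially. c < G (q n) b"
        using F_le[OF q(1,2)] by (auto intro: always_eventually less_le_trans)
    next
      fix c assume "F b x < c"
      then obtain r where r: "r \<in> \<rat>" "x < r" "G r b < c" using F_lt by blast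
      have "\<forall>\<^sub>F n in sequentially. q n < r" using qx r(2) by (rule order_tendstoD(2))
      then show "\<forall>\<^sub>F n in sequentially. G (q n) b < c"
        by eventually_elim (meson Gmono r q(1) le_less_trans less_imp_le)
    qed
    have "(\<lambda>n. \<integral>b. indicator A b *\<^sub>R G (q n) b \<partial>N) \<longlonglongrightarrow> (\<integral>b. indicator A b *\<^sub>R F b x \<partial>N)"
    proof (rule integral_dominated_convergence[where w="\<lambda>_. 1"])
      show "(\<lambda>b. indicator A b *\<^sub>R F b x) \<in> borel_measurable N" using A by measurable
      show "(\<lambda>b. indicator A b *\<^sub>R G (q n) b) \<in> borel_measurable N" for n using A by measurable
      show "AE b in N. (\<lambda>n. indicator A b *\<^sub>R G (q n) b) \<longlonglongrightarrow> indicator A b *\<^sub>R F b x"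
        by (intro AE_I2 tendsto_intros GF)
      show "AE b in N. norm (indicator A b *\<^sub>R G (q n) b) \<le> 1" for n
        using G_ge0[OF q(1)] G_le1[OF q(1)] by (auto simp: indicator_def)
    qed simp
    moreover have "(\<integral>b. indicator A b *\<^sub>R G (q n) b \<partial>N) = \<nu> (q n) A" for n
    proof -
      have "(\<integral>b. indicator A b *\<^sub>R G (q n) b \<partial>N) = (\<integral>b. indicator A b *\<^sub>R g (q n) b \<partial>N)"
        using A AEGood by (intro integral_cong_AE) (auto elim!: eventually_mono simp: G_def)
      then show ?thesis using g(2)[OF A, of "q n"] by (simp add: set_lebesgue_integral_def)
    qed
    moreover have "(\<lambda>n. \<nu> (q n) A) \<longlonglongrightarrow> \<nu> x A"
    proof -
      have "(\<lambda>n. measure \<gamma> (A \<times> {..q n})) \<longlonglongrightarrow> measure \<gamma> (\<Inter>n. A \<times> {..q n})"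
        using A q(4) by (intro \<gamma>.finite_Lim_measure_decseq decseq_SucI) (auto intro: order_trans)
      moreover have "(\<Inter>n. A \<times> {..q n}) = A \<times> {..x}"
      proof -
        have "y \<le> x" if "\<And>n. y \<le> q n" for y
          using that by (intro tendsto_lowerbound[OF qx]) auto
        then show ?thesis by (auto intro: order_trans[OF _ less_imp_le[OF q(2)]])
      qed
      ultimately show ?thesis by (simp add: \<nu>_def)
    qed
    ultimately show ?thesis by (simp add: LIMSEQ_unique set_lebesgue_integral_def)
  qed
  define \<kappa> where "\<kappa> b = interval_measure (F b)" for b
  have rd: "real_distribution (\<kappa> b)" for b
    unfolding \<kappa>_def by (rule real_distribution_interval_measure[OF Fmono Frc bot top])
  then have p\<kappa>: "prob_space (\<kappa> b)" for b by (simp add: real_distribution_def)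
  have cdf\<kappa>: "emeasure (\<kappa> b) {..x} = ennreal (F b x)" for b x
  proof -
    interpret real_distribution "\<kappa> b" by (rule rd)
    have "cdf (\<kappa> b) = F b" unfolding \<kappa>_def by (rule cdf_interval_measure[OF Fmono Frc bot])
    then show ?thesis by (simp add: emeasure_eq_measure cdf_def fun_eq_iff)
  qed
  have \<kappa>m: "\<kappa> \<in> measurable N (prob_algebra borel)"
  proof (rule measurable_prob_algebra_generated[of borel UNIV "range (\<lambda>a::real. {..a})"])
    show "sets (borel :: real measure) = sigma_sets UNIV (range (\<lambda>a. {..a}))"
      by (subst borel_eq_atMost) simp
    show "Int_stable (range (\<lambda>a::real. {..a}))" by (auto simp: Int_stable_def)
    show "sets (\<kappa> b) = sets borel" for b by (simp add: \<kappa>_def)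
  qed (auto simp: p\<kappa> cdf\<kappa>)
  define ret where "ret b = \<kappa> b \<bind> (\<lambda>a. return (N \<Otimes>\<^sub>M borel) (b, a))" for b
  have \<kappa>s: "\<kappa> \<in> measurable N (subprob_algebra borel)" using \<kappa>m by (rule measurable_prob_algebraD)
  have retm: "ret \<in> measurable N (subprob_algebra (N \<Otimes>\<^sub>M borel))"
    unfolding ret_def using \<kappa>s by (intro measurable_bind[where N=borel]) auto
  have ret_em: "emeasure (ret b) C = emeasure (\<kappa> b) (Pair b -` C)" if b: "b \<in> space N" and C: "C \<in> sets (N \<Otimes>\<^sub>M borel)" for b C
  proof -
    have ks: "sets (\<kappa> b) = sets borel" "space (\<kappa> b) = UNIV" by (auto simp: \<kappa>_def)
    have [measurable]: "(\<lambda>a. (b, a)) \<in> measurable (\<kappa> b) (N \<Otimes>\<^sub>M borel)"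
      using b ks by (simp add: measurable_cong_sets[OF ks(1) refl])
    have "emeasure (ret b) C = (\<integral>\<^sup>+a. emeasure (return (N \<Otimes>\<^sub>M borel) (b, a)) C \<partial>\<kappa> b)"
      unfolding ret_def using ks C
      by (intro emeasure_bind) (auto intro!: measurable_compose[OF _ return_measurable])
    also have "\<dots> = (\<integral>\<^sup>+a. indicator (Pair b -` C) a \<partial>\<kappa> b)"
      using C by (intro nn_integral_cong) (auto simp: indicator_def)
    also have "\<dots> = emeasure (\<kappa> b) (Pair b -` C)"
      using C ks by (intro nn_integral_indicator) (simp add: sets_Pair1)
    finally show ?thesis .
  qed
  have "\<gamma> = N \<bind> ret"
  proof (rule measure_eqI_generator_eq[where \<Omega> = "space N \<times> UNIV" and A = "\<lambda>n. space N \<times> {..real n}"])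
    let ?E = "{A \<times> {..x} |A x. A \<in> sets N} :: ('b \<times> real) set set"
    show "Int_stable ?E"
    proof (rule Int_stableI)
      fix a b assume "a \<in> ?E" "b \<in> ?E"
      then obtain A x B y where "a = A \<times> {..x}" "b = B \<times> {..y}" "A \<in> sets N" "B \<in> sets N" by blast
      then have "a \<inter> b = (A \<inter> B) \<times> {..min x y}" "A \<inter> B \<in> sets N" by auto
      then show "a \<inter> b \<in> ?E" by blast
    qed
    show E: "?E \<subseteq> Pow (space N \<times> UNIV)" using sets.sets_into_space by fastforce
    \<comment> \<open>The cylinder \<open>A \<times> UNIV\<close> is a countable union of strips
      \<open>A \<times> {..real n}\<close>, which makes both projections measurable for the
      \<sigma>-algebra generated by the strips.\<close>
    have sg: "sets (N \<Otimes>\<^sub>M (borel :: real measure)) = sigma_sets (space N \<times> UNIV) ?E"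
    proof (rule antisym)
      show "sigma_sets (space N \<times> UNIV) ?E \<subseteq> sets (N \<Otimes>\<^sub>M borel)"
      proof -
        have "?E \<subseteq> sets (N \<Otimes>\<^sub>M borel)" by auto
        then show ?thesis
          using sets.sigma_sets_subset[of ?E "N \<Otimes>\<^sub>M borel"] by (simp only: space_pair_measure space_borel)
      qed
      define S where "S = sigma (space N \<times> UNIV) ?E"
      have sS: "sets S = sigma_sets (space N \<times> UNIV) ?E" "space S = space N \<times> UNIV"
        unfolding S_def using E by auto
      have f: "fst \<in> measurable S N"
      proof (rule measurableI)
        fix A assume A: "A \<in> sets N"
        have "A \<times> {..real n} \<in> sets S" for n unfolding sS by (rule sigma_sets.Basic) (use A in blast)
        then have "(\<Union>n. A \<times> {..real n}) \<in> sets S" by (intro sets.countable_UN) auto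
        moreover have "(\<Union>n. A \<times> {..real n}) = fst -` A \<inter> space S"
          using sets.sets_into_space[OF A] real_arch_simple unfolding sS by fastforce
        ultimately show "fst -` A \<inter> space S \<in> sets S" by simp
      qed (auto simp: sS)
      have "snd \<in> measurable S (sigma UNIV (range (\<lambda>a::real. {..a})))"
      proof (rule measurable_measure_of)
        fix y assume "y \<in> range (\<lambda>a::real. {..a})"
        then obtain a where "y = {..a}" by blast
        then have "snd -` y \<inter> space S = space N \<times> {..a}" by (auto simp: sS)
        then show "snd -` y \<inter> space S \<in> sets S" unfolding sS by (metis (mono_tags, lifting) mem_Collect_eq sets.top sigma_sets.Basic)
      qed auto
      then have s: "snd \<in> measurable S (borel :: real measure)" by (simp only: borel_eq_atMost)
      have "(\<lambda>z. z) \<in> measurable S (N \<Otimes>\<^sub>M (borel :: real measure))"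
        using measurable_Pair[OF f s] by simp
      then have m: "(\<lambda>z. z) -` C \<inter> space S \<in> sets S" if "C \<in> sets (N \<Otimes>\<^sub>M (borel :: real measure))" for C
        using that by (rule measurable_sets)
      show "sets (N \<Otimes>\<^sub>M borel) \<subseteq> sigma_sets (space N \<times> UNIV) ?E"
      proof
        fix C :: "('b \<times> real) set" assume C: "C \<in> sets (N \<Otimes>\<^sub>M borel)"
        have "C \<subseteq> space S" using sets.sets_into_space[OF C] by (simp only: sS space_pair_measure space_borel)
        then have "(\<lambda>z. z) -` C \<inter> space S = C" by auto
        then show "C \<in> sigma_sets (space N \<times> UNIV) ?E" using m[OF C] by (simp only: sS)
      qed
    qed
    then show "sets \<gamma> = sigma_sets (space N \<times> UNIV) ?E" using \<gamma>(2) by simp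
    have "sets (N \<bind> ret) = sets (N \<Otimes>\<^sub>M borel)"
      using sets_kernel[OF retm] N.not_empty by (intro sets_bind) auto
    then show "sets (N \<bind> ret) = sigma_sets (space N \<times> UNIV) ?E" using sg by simp
    show "range (\<lambda>n. space N \<times> {..real n}) \<subseteq> ?E" by auto
    show "(\<Union>n. space N \<times> {..real n}) = space N \<times> UNIV" using real_arch_simple by fastforce
    show "emeasure \<gamma> (space N \<times> {..real i}) \<noteq> \<infinity>" for i by simp
    fix C assume "C \<in> ?E"
    then obtain A x where C: "C = A \<times> {..x}" and A: "A \<in> sets N" by blast
    have CN: "C \<in> sets (N \<Otimes>\<^sub>M borel)" using A C by auto
    have "emeasure (N \<bind> ret) C = (\<integral>\<^sup>+b. emeasure (ret b) C \<partial>N)"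
      by (rule emeasure_bind[OF N.not_empty retm CN])
    also have "\<dots> = (\<integral>\<^sup>+b. ennreal (indicator A b *\<^sub>R F b x) \<partial>N)"
    proof (rule nn_integral_cong)
      fix b assume b: "b \<in> space N"
      have "Pair b -` C = (if b \<in> A then {..x} else {})" by (auto simp: C)
      then show "emeasure (ret b) C = ennreal (indicator A b *\<^sub>R F b x)"
        using ret_em[OF b CN] cdf\<kappa> by auto
    qed
    also have "\<dots> = ennreal (\<integral>b. indicator A b *\<^sub>R F b x \<partial>N)"
      using A F01 by (intro nn_integral_eq_integral N.integrable_const_bound[where B=1]) (auto simp: indicator_def)
    also have "\<dots> = ennreal (\<nu> x A)" using Fint[OF A, of x] by (simp add: set_lebesgue_integral_def)
    also have "\<dots> = emeasure \<gamma> C" by (simp add: \<nu>_def C \<gamma>.emeasure_eq_measure)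
    finally show "emeasure \<gamma> C = emeasure (N \<bind> ret) C" by simp
  qed
  then show thesis using that \<kappa>m unfolding ret_def by blast
qed


section \<open>Integration against kernels\<close>

lemma kernel_prob_space:
  assumes "k \<in> measurable N (prob_algebra M)" "b \<in> space N"
  shows "prob_space (k b)" "sets (k b) = sets M" "space (k b) = space M"
  using measurable_space[OF assms] by (auto simp: space_prob_algebra dest: sets_eq_imp_space_eq)

lemma integrable_kernel:
  fixes \<phi> :: "'b \<times> 'e \<Rightarrow> real"
  assumes k: "k \<in> measurable N (prob_algebra M)" and \<phi>: "\<phi> \<in> borel_measurable (N \<Otimes>\<^sub>M M)"
    and B: "\<And>z. z \<in> space N \<times> space M \<Longrightarrow> \<bar>\<phi> z\<bar> \<le> B" and b: "b \<in> space N"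
  shows "integrable (k b) (\<lambda>a. \<phi> (b, a))"
proof -
  note kb = kernel_prob_space[OF k b]
  interpret kb: prob_space "k b" by (rule kb(1))
  have "(\<lambda>a. \<phi> (b, a)) \<in> borel_measurable (k b)"
    unfolding measurable_cong_sets[OF kb(2) refl] using b \<phi> by measurable
  then show ?thesis using B b kb(3) by (intro kb.integrable_const_bound[where B=B]) auto
qed

text \<open>Kernels are integrated through nonnegative integrals; adding the bound \<open>B\<close>
  carries bounded real functions over to that setting.\<close>

lemma nn_integral_kernel:
  fixes \<phi> :: "'b \<times> 'e \<Rightarrow> real"
  assumes k: "k \<in> measurable N (prob_algebra M)" and \<phi>: "\<phi> \<in> borel_measurable (N \<Otimes>\<^sub>M M)"
    and B: "\<And>z. z \<in> space N \<times> space M \<Longrightarrow> \<bar>\<phi> z\<bar> \<le> B" and b: "b \<in> space N"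
  shows "(\<integral>\<^sup>+a. ennreal (\<phi> (b, a) + B) \<partial>k b) = ennreal ((\<integral>a. \<phi> (b, a) \<partial>k b) + B)" (is ?eq)
    and "\<bar>\<integral>a. \<phi> (b, a) \<partial>k b\<bar> \<le> B" (is ?le)
proof -
  note kb = kernel_prob_space[OF k b] and i = integrable_kernel[OF k \<phi> B b]
  interpret kb: prob_space "k b" by (rule kb(1))
  have le: "\<phi> (b, a) \<le> B" and ge: "- B \<le> \<phi> (b, a)" and ge0: "0 \<le> \<phi> (b, a) + B" if "a \<in> space M" for a
    using B[of "(b, a)"] that b by (auto simp: abs_le_iff)
  have "(\<integral>\<^sup>+a. ennreal (\<phi> (b, a) + B) \<partial>k b) = ennreal (\<integral>a. \<phi> (b, a) + B \<partial>k b)"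
    using i ge0 kb(3) by (intro nn_integral_eq_integral) auto
  then show ?eq using i by (simp add: kb.prob_space)
  have "(\<integral>a. \<phi> (b, a) \<partial>k b) \<le> B" by (rule kb.integral_le_const[OF i]) (auto simp: kb(3) intro!: AE_I2 le)
  moreover have "- B \<le> (\<integral>a. \<phi> (b, a) \<partial>k b)" by (rule kb.integral_ge_const[OF i]) (auto simp: kb(3) intro!: AE_I2 ge)
  ultimately show ?le by linarith
qed

lemma kernel_integral_measurable:
  fixes \<phi> :: "'b \<times> 'e \<Rightarrow> real"
  assumes k: "k \<in> measurable N (prob_algebra M)" and \<phi>[measurable]: "\<phi> \<in> borel_measurable (N \<Otimes>\<^sub>M M)"
    and B: "\<And>z. z \<in> space N \<times> space M \<Longrightarrow> \<bar>\<phi> z\<bar> \<le> B"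
  shows "(\<lambda>b. \<integral>a. \<phi> (b, a) \<partial>k b) \<in> borel_measurable N"
proof -
  have "(\<lambda>b. enn2real (\<integral>\<^sup>+a. ennreal (\<phi> (b, a) + B) \<partial>k b) - B) \<in> borel_measurable N"
    using nn_integral_measurable_subprob_algebra2[OF _ measurable_prob_algebraD[OF k], of "\<lambda>b a. ennreal (\<phi> (b, a) + B)"] by simp
  moreover have "enn2real (\<integral>\<^sup>+a. ennreal (\<phi> (b, a) + B) \<partial>k b) - B = (\<integral>a. \<phi> (b, a) \<partial>k b)" if "b \<in> space N" for b
    using nn_integral_kernel[OF k \<phi> B that] by (simp add: abs_le_iff)
  ultimately show ?thesis by (simp cong: measurable_cong)
qed

text \<open>The second coordinate is replaced by its real code \<open>s\<close>, the joint law is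
  disintegrated over the line, and the kernel is pushed forward by \<open>c\<close>. Since
  \<open>c (s x) = x\<close> on \<open>E\<close> nothing is lost, and since \<open>c\<close> takes
  all its values in \<open>E\<close> the kernel lives there for every \<open>b\<close>.\<close>

theorem disintegration_compact:
  fixes E :: "'e::metric_space set" and N :: "'b measure"
  assumes E: "compact E"
    and \<gamma>: "prob_space \<gamma>" "sets \<gamma> = sets (N \<Otimes>\<^sub>M borel_on E)" and N: "N = distr \<gamma> N fst"
  obtains k where "k \<in> measurable N (prob_algebra (borel_on E))"
    "\<And>\<phi> B. \<phi> \<in> borel_measurable (N \<Otimes>\<^sub>M borel_on E) \<Longrightarrow> (\<And>z. z \<in> space N \<times> E \<Longrightarrow> \<bar>\<phi> z\<bar> \<le> B) \<Longrightarrow>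
      (\<integral>z. \<phi> z \<partial>\<gamma>) = (\<integral>b. (\<integral>a. (\<phi> (b, a) :: real) \<partial>k b) \<partial>N)"
proof -
  interpret \<gamma>: prob_space \<gamma> by fact
  have [measurable_cong]: "sets \<gamma> = sets (N \<Otimes>\<^sub>M borel_on E)" by fact
  have sp: "space \<gamma> = space N \<times> E"
    using sets_eq_imp_space_eq[OF \<gamma>(2)] by (simp add: space_pair_measure space_restrict_space)
  have "prob_space (distr \<gamma> N fst)" by (rule \<gamma>.prob_space_distr) simp
  then have pN: "prob_space N" using N by simp
  interpret N: prob_space N by fact
  have "E \<noteq> {}" using sp \<gamma>.not_empty by auto
  obtain s :: "'e \<Rightarrow> real" and c where s: "s \<in> borel_measurable borel" "\<And>x. 0 \<le> s x \<and> s x \<le> 1"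
    and c[measurable]: "c \<in> measurable borel (borel_on E)" and cs: "\<And>x. x \<in> E \<Longrightarrow> c (s x) = x"
    by (rule compact_real_coding[OF E \<open>E \<noteq> {}\<close>]) (rule that)
  have [measurable]: "s \<in> borel_measurable (borel_on E)" using s(1) by (rule measurable_restrict_space1)
  define T where "T z = (fst z, s (snd z))" for z :: "'b \<times> 'e"
  have T[measurable]: "T \<in> measurable \<gamma> (N \<Otimes>\<^sub>M borel)" unfolding T_def by measurable
  define \<gamma>' where "\<gamma>' = distr \<gamma> (N \<Otimes>\<^sub>M borel) T"
  have "distr \<gamma>' N fst = distr \<gamma> N (fst \<circ> T)" unfolding \<gamma>'_def by (rule distr_distr) auto
  then have N': "N = distr \<gamma>' N fst" using N by (simp add: T_def o_def)
  obtain \<kappa> where \<kappa>: "\<kappa> \<in> measurable N (prob_algebra borel)"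
    and \<gamma>'_eq: "\<gamma>' = N \<bind> (\<lambda>b. \<kappa> b \<bind> (\<lambda>a. return (N \<Otimes>\<^sub>M borel) (b, a)))"
  proof (rule disintegration_unit_interval[OF _ _ N'])
    show "prob_space \<gamma>'" unfolding \<gamma>'_def by (rule \<gamma>.prob_space_distr[OF T])
    show "sets \<gamma>' = sets (N \<Otimes>\<^sub>M borel)" by (simp add: \<gamma>'_def)
    show "AE z in \<gamma>'. 0 \<le> snd z \<and> snd z \<le> 1"
      unfolding \<gamma>'_def by (subst AE_distr_iff[OF T]) (auto simp: T_def s(2))
  qed (rule that)
  note \<kappa>s[measurable] = measurable_prob_algebraD[OF \<kappa>]
  have \<kappa>sp: "sets (\<kappa> b) = sets borel" "space (\<kappa> b) = UNIV" "prob_space (\<kappa> b)" if "b \<in> space N" for b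
    using kernel_prob_space[OF \<kappa> that] by auto
  define k where "k b = distr (\<kappa> b) (borel_on E) c" for b
  show thesis
  proof
    show "k \<in> measurable N (prob_algebra (borel_on E))"
      unfolding k_def using measurable_compose[OF \<kappa> measurable_distr_prob_space[OF c]] .
    fix \<phi> :: "'b \<times> 'e \<Rightarrow> real" and B
    assume \<phi>[measurable]: "\<phi> \<in> borel_measurable (N \<Otimes>\<^sub>M borel_on E)" and B: "\<And>z. z \<in> space N \<times> E \<Longrightarrow> \<bar>\<phi> z\<bar> \<le> B"
    define \<psi> where "\<psi> z = \<phi> (fst z, c (snd z))" for z
    have \<psi>[measurable]: "\<psi> \<in> borel_measurable (N \<Otimes>\<^sub>M borel)" unfolding \<psi>_def by measurable
    have cE: "c t \<in> E" for t using measurable_space[OF c] by (auto simp: space_restrict_space)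
    have \<psi>B: "\<bar>\<psi> (b, t)\<bar> \<le> B" if "b \<in> space N" for b t using B that cE by (simp add: \<psi>_def)
    define h where "h b = (\<integral>t. \<psi> (b, t) \<partial>\<kappa> b)" for b
    have \<psi>B2: "\<bar>\<psi> z\<bar> \<le> B" if "z \<in> space N \<times> space borel" for z
      using that \<psi>B by auto
    have nnh: "(\<integral>\<^sup>+a. ennreal (\<psi> (b, a) + B) \<partial>\<kappa> b) = ennreal (h b + B)" and hB: "\<bar>h b\<bar> \<le> B" if b: "b \<in> space N" for b
      unfolding h_def using nn_integral_kernel[OF \<kappa> \<psi> _ b, of B] \<psi>B2 by blast+
    have hm[measurable]: "h \<in> borel_measurable N"
      unfolding h_def by (rule kernel_integral_measurable[OF \<kappa> \<psi> \<psi>B2])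
    have ih: "integrable N h" using hB by (intro N.integrable_const_bound[where B=B]) auto
    have e1: "(\<integral>z. \<phi> z \<partial>\<gamma>) = (\<integral>z. \<psi> z \<partial>\<gamma>')"
    proof -
      have "(\<integral>z. \<psi> z \<partial>\<gamma>') = (\<integral>z. \<psi> (T z) \<partial>\<gamma>)" unfolding \<gamma>'_def by (rule integral_distr[OF T \<psi>])
      also have "\<dots> = (\<integral>z. \<phi> z \<partial>\<gamma>)"
        using cs by (intro Bochner_Integration.integral_cong) (auto simp: sp \<psi>_def T_def)
      finally show ?thesis by simp
    qed
    have T\<psi>: "integrable \<gamma> (\<lambda>z. \<psi> (T z))"
      using \<psi>B sp by (intro \<gamma>.integrable_const_bound[where B=B]) (auto simp: T_def)
    have i\<gamma>': "integrable \<gamma>' \<psi>" unfolding \<gamma>'_def using integrable_distr_eq[OF T \<psi>] T\<psi> by simp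
    interpret \<gamma>': prob_space \<gamma>' unfolding \<gamma>'_def by (rule \<gamma>.prob_space_distr[OF T])
    have sp': "space \<gamma>' = space N \<times> UNIV" by (simp add: \<gamma>'_def space_pair_measure)
    have \<psi>B': "0 \<le> \<psi> z + B" if "z \<in> space \<gamma>'" for z
      using \<psi>B[of "fst z" "snd z"] that by (auto simp: sp')
    have hB': "0 \<le> h b + B" if "b \<in> space N" for b using hB[OF that] by linarith
    have "ennreal ((\<integral>z. \<psi> z \<partial>\<gamma>') + B) = ennreal (\<integral>z. \<psi> z + B \<partial>\<gamma>')"
      using i\<gamma>' by (simp add: \<gamma>'.prob_space)
    also have "\<dots> = (\<integral>\<^sup>+z. ennreal (\<psi> z + B) \<partial>\<gamma>')"
      using i\<gamma>' \<psi>B' by (intro nn_integral_eq_integral[symmetric]) auto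
    also have "\<dots> = (\<integral>\<^sup>+b. (\<integral>\<^sup>+z. ennreal (\<psi> z + B) \<partial>(\<kappa> b \<bind> (\<lambda>a. return (N \<Otimes>\<^sub>M borel) (b, a)))) \<partial>N)"
      unfolding \<gamma>'_eq by (rule nn_integral_bind[where B="N \<Otimes>\<^sub>M borel"]) (auto intro!: measurable_bind[where N=borel])
    also have "\<dots> = (\<integral>\<^sup>+b. ennreal (h b + B) \<partial>N)"
    proof (rule nn_integral_cong)
      fix b assume b: "b \<in> space N"
      interpret \<kappa>: prob_space "\<kappa> b" using \<kappa>sp b by simp
      note [measurable_cong] = \<kappa>sp(1)[OF b]
      have "(\<integral>\<^sup>+z. ennreal (\<psi> z + B) \<partial>(\<kappa> b \<bind> (\<lambda>a. return (N \<Otimes>\<^sub>M borel) (b, a))))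
          = (\<integral>\<^sup>+a. (\<integral>\<^sup>+z. ennreal (\<psi> z + B) \<partial>return (N \<Otimes>\<^sub>M borel) (b, a)) \<partial>\<kappa> b)"
        using b by (intro nn_integral_bind[where B="N \<Otimes>\<^sub>M borel"]) (auto intro!: measurable_compose[OF _ return_measurable])
      also have "\<dots> = (\<integral>\<^sup>+a. ennreal (\<psi> (b, a) + B) \<partial>\<kappa> b)"
        using b by (intro nn_integral_cong nn_integral_return) (auto simp: space_pair_measure)
      also have "\<dots> = ennreal (h b + B)" by (rule nnh[OF b])
      finally show "(\<integral>\<^sup>+z. ennreal (\<psi> z + B) \<partial>(\<kappa> b \<bind> (\<lambda>a. return (N \<Otimes>\<^sub>M borel) (b, a)))) = ennreal (h b + B)" .
    qed
    also have "\<dots> = ennreal (\<integral>b. h b + B \<partial>N)"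
      using ih hB' by (intro nn_integral_eq_integral) auto
    also have "(\<integral>b. h b + B \<partial>N) = (\<integral>b. h b \<partial>N) + B" using ih by (simp add: N.prob_space)
    finally have eq: "ennreal ((\<integral>z. \<psi> z \<partial>\<gamma>') + B) = ennreal ((\<integral>b. h b \<partial>N) + B)" .
    \<comment> \<open>Both integrals are at least \<open>- B\<close>, so the equation between
      extended nonnegative numbers descends to the reals.\<close>
    have "- B \<le> \<psi> z" if "z \<in> space \<gamma>'" for z using \<psi>B'[OF that] by linarith
    then have "- B \<le> (\<integral>z. \<psi> z \<partial>\<gamma>')" by (intro \<gamma>'.integral_ge_const[OF i\<gamma>']) auto
    moreover have "- B \<le> h b" if "b \<in> space N" for b using hB'[OF that] by linarith
    then have "- B \<le> (\<integral>b. h b \<partial>N)" by (intro N.integral_ge_const[OF ih]) auto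
    ultimately have e2: "(\<integral>z. \<psi> z \<partial>\<gamma>') = (\<integral>b. h b \<partial>N)" using eq by simp
    have "h b = (\<integral>a. \<phi> (b, a) \<partial>k b)" if b: "b \<in> space N" for b
    proof -
      have cm: "c \<in> measurable (\<kappa> b) (borel_on E)" using c \<kappa>sp(1)[OF b] by (simp add: measurable_cong_sets[OF \<kappa>sp(1)[OF b] refl])
      show ?thesis unfolding h_def k_def using b by (subst integral_distr[OF cm]) (auto simp: \<psi>_def)
    qed
    then show "(\<integral>z. \<phi> z \<partial>\<gamma>) = (\<integral>b. (\<integral>a. \<phi> (b, a) \<partial>k b) \<partial>N)"
      unfolding e1 e2 by (intro Bochner_Integration.integral_cong) auto
  qed
qed

section \<open>Distributional equilibria of nonatomic games\<close>

text \<open>Each inclusion is measurability of the identity; second countability is what puts the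
  Borel sets of the product into the product \<sigma>-algebra.\<close>

lemma sets_borel_on_Times:
  fixes B :: "'b::second_countable_topology set" and E :: "'e::second_countable_topology set"
  shows "sets (borel_on (B \<times> E)) = sets (borel_on B \<Otimes>\<^sub>M borel_on E)"
proof -
  have sub: "sets M \<subseteq> sets N" if "(\<lambda>z. z) \<in> measurable N M" "space M = space N" for M N :: "('b \<times> 'e) measure"
  proof
    fix A assume A: "A \<in> sets M"
    then have "(\<lambda>z. z) -` A \<inter> space N = A" using sets.sets_into_space[OF A] that(2) by auto
    then show "A \<in> sets N" using measurable_sets[OF that(1) A] by simp
  qed
  have [measurable]: "(\<lambda>x. x) \<in> measurable (borel_on B) borel" "(\<lambda>x. x) \<in> measurable (borel_on E) borel"
    by (rule id_measurable_borel_on, simp)+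
  have f: "(\<lambda>z. fst z) \<in> measurable (borel_on B \<Otimes>\<^sub>M borel_on E) borel"
    using measurable_compose[OF measurable_fst \<open>(\<lambda>x. x) \<in> measurable (borel_on B) borel\<close>] .
  have s: "(\<lambda>z. snd z) \<in> measurable (borel_on B \<Otimes>\<^sub>M borel_on E) borel"
    using measurable_compose[OF measurable_snd \<open>(\<lambda>x. x) \<in> measurable (borel_on E) borel\<close>] .
  have "(\<lambda>z. z) \<in> measurable (borel_on B \<Otimes>\<^sub>M borel_on E) (borel_on (B \<times> E))"
  proof (rule measurable_restrict_space2)
    show "(\<lambda>z. z) \<in> measurable (borel_on B \<Otimes>\<^sub>M borel_on E) borel"
      using measurable_Pair[OF f s] by (simp add: borel_prod)
  qed (auto simp: space_pair_measure space_restrict_space)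
  moreover have "(\<lambda>z. z) \<in> measurable (borel_on (B \<times> E)) (borel_on B \<Otimes>\<^sub>M borel_on E)"
  proof -
    have "fst \<in> measurable (borel_on (B \<times> E)) (borel_on B)" "snd \<in> measurable (borel_on (B \<times> E)) (borel_on E)"
      by (auto intro!: measurable_restrict_space3 borel_measurable_continuous_onI continuous_intros)
    from measurable_Pair[OF this] show ?thesis by simp
  qed
  ultimately show ?thesis
    by (intro antisym sub) (auto simp: space_pair_measure space_restrict_space)
qed

text \<open>Continuous tests approximate indicators of closed sets, so \<open>h\<close> has
  nonnegative integral over every compact subset of \<open>{x\<in>B. h x < 0}\<close>, which must
  therefore be null. Inner regularity on a Polish space extends this to the whole set.\<close>

lemma AE_nonneg_continuous_tests:
  fixes h :: "'a::polish_space \<Rightarrow> real"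
  assumes "finite_measure M" and s: "sets M = sets (borel_on B)" and B: "closed B"
    and h: "h \<in> borel_measurable M" "\<And>x. x \<in> B \<Longrightarrow> \<bar>h x\<bar> \<le> C"
    and test: "\<And>\<psi>. continuous_on UNIV \<psi> \<Longrightarrow> (\<And>x. 0 \<le> \<psi> x \<and> \<psi> x \<le> 1) \<Longrightarrow> 0 \<le> (\<integral>x. \<psi> x * h x \<partial>M)"
  shows "AE x in M. 0 \<le> h x"
proof -
  interpret finite_measure M by fact
  have sp: "space M = B" by (rule space_borel_onI[OF s])
  have idm: "(\<lambda>x. x) \<in> measurable M borel" by (rule id_measurable_borel_on[OF s])
  have bs: "A \<in> sets M \<longleftrightarrow> A \<in> sets borel \<and> A \<subseteq> B" for A
    unfolding s using B by (auto simp: sets_restrict_space_iff)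
  have ih: "integrable M h" using h sp by (intro integrable_const_bound[where B=C]) auto
  have closed: "0 \<le> (\<integral>x. indicator K x * h x \<partial>M)" if K: "closed K" for K
  proof -
    obtain \<psi> :: "nat \<Rightarrow> 'a \<Rightarrow> real" where \<psi>: "\<And>k. continuous_on UNIV (\<psi> k)" "\<And>k x. 0 \<le> \<psi> k x \<and> \<psi> k x \<le> 1"
      "\<And>x. (\<lambda>k. \<psi> k x) \<longlonglongrightarrow> indicator K x" using indicator_closed_limit[OF K] by blast
    have \<psi>m: "\<psi> k \<in> borel_measurable M" for k
      using measurable_compose[OF idm borel_measurable_continuous_onI[OF \<psi>(1)]] .
    have Km: "(\<lambda>x. indicator K x :: real) \<in> borel_measurable M"
      using K measurable_compose[OF idm borel_measurable_indicator[of K borel]] by simp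
    have "(\<lambda>k. \<integral>x. \<psi> k x * h x \<partial>M) \<longlonglongrightarrow> (\<integral>x. indicator K x * h x \<partial>M)"
    proof (rule integral_dominated_convergence[where w="\<lambda>x. \<bar>h x\<bar>"])
      show "AE x in M. (\<lambda>k. \<psi> k x * h x) \<longlonglongrightarrow> indicator K x * h x"
        by (intro AE_I2 tendsto_intros \<psi>)
      show "AE x in M. norm (\<psi> k x * h x) \<le> \<bar>h x\<bar>" for k
        using \<psi>(2) by (auto simp: abs_mult intro!: AE_I2 mult_left_le_one_le)
    qed (use \<psi>m Km h ih in auto)
    then show ?thesis by (rule LIMSEQ_le_const) (use test \<psi> in auto)
  qed
  define A where "A = {x\<in>B. h x < 0}"
  have AM: "A \<in> sets M" using h(1) unfolding A_def sp[symmetric] by measurable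
  define M' where "M' = distr M borel (\<lambda>x. x)"
  interpret M': finite_measure M' unfolding M'_def by (rule finite_measure_distr[OF idm])
  have M'_eq: "emeasure M' D = emeasure M D" if "D \<in> sets borel" "D \<subseteq> B" for D
    unfolding M'_def using that sp by (subst emeasure_distr[OF idm]) (auto simp: Int_absorb2)
  have K0: "emeasure M' K = 0" if K: "K \<subseteq> A" "compact K" for K
  proof -
    have Kc: "closed K" using K by (rule_tac compact_imp_closed)
    then have KM: "K \<in> sets M" using K bs by (auto simp: A_def)
    have neg: "indicator K x * h x \<le> 0" for x using K by (auto simp: indicator_def A_def)
    have iK: "integrable M (\<lambda>x. indicator K x * h x)"
      using integrable_mult_indicator[OF KM ih] by simp
    have "(\<integral>x. - (indicator K x * h x) \<partial>M) = 0"
    proof (rule antisym)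
      show "(\<integral>x. - (indicator K x * h x) \<partial>M) \<le> 0" using closed[OF Kc] by simp
      show "0 \<le> (\<integral>x. - (indicator K x * h x) \<partial>M)" using neg by (intro Bochner_Integration.integral_nonneg) (simp add: neg)
    qed
    then have "AE x in M. - (indicator K x * h x) = 0"
      using iK neg by (subst (asm) integral_nonneg_eq_0_iff_AE) auto
    then have "AE x in M. x \<notin> K" by eventually_elim (use K in \<open>auto simp: A_def indicator_def split: if_splits\<close>)
    then have "emeasure M K = 0" using KM by (subst (asm) AE_iff_measurable[OF KM]) (use sets.sets_into_space[OF KM] in auto)
    then show ?thesis using M'_eq[of K] KM bs by auto
  qed
  have "emeasure M' A = (SUP K \<in> {K. K \<subseteq> A \<and> compact K}. emeasure M' K)"
  proof (rule inner_regular)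
    show "sets M' = sets borel" by (simp add: M'_def)
    show "A \<in> sets borel" using AM bs by simp
  qed simp
  also have "\<dots> = 0" using K0 by (auto intro!: antisym SUP_least)
  finally have "emeasure M A = 0" using M'_eq[of A] AM bs by auto
  then have "AE x in M. x \<notin> A" using AM by (intro AE_not_in) (auto simp: null_sets_def)
  then show ?thesis using AE_space by eventually_elim (auto simp: A_def sp)
qed

text \<open>Weights sit on indices and are pushed forward, because the enumeration of strategies may
  repeat; the weights of indices with the same point then add up.\<close>

definition atomic_measure :: "'x::topological_space set \<Rightarrow> 'i set \<Rightarrow> ('i \<Rightarrow> real) \<Rightarrow> ('i \<Rightarrow> 'x) \<Rightarrow> 'x measure" where
  "atomic_measure X I w x = distr (point_measure I (\<lambda>i. ennreal (w i))) (borel_on X) x"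

lemma sets_atomic_measure [simp]: "sets (atomic_measure X I w x) = sets (borel_on X)"
  by (simp add: atomic_measure_def)

lemma
  assumes "finite I" "\<And>i. i \<in> I \<Longrightarrow> 0 \<le> w i" "x \<in> I \<rightarrow> X"
  shows prob_space_atomic_measure: "sum w I = 1 \<Longrightarrow> prob_space (atomic_measure X I w x)"
    and integral_atomic_measure: "\<phi> \<in> borel_measurable (borel_on X) \<Longrightarrow>
      (\<integral>z. \<phi> z \<partial>atomic_measure X I w x) = (\<Sum>i\<in>I. w i * (\<phi> (x i) :: real))"
proof -
  have m: "x \<in> measurable (point_measure I (\<lambda>i. ennreal (w i))) (borel_on X)"
    using assms(3) by (simp add: space_restrict_space)
  show "prob_space (atomic_measure X I w x)" if "sum w I = 1"
  proof -
    have "prob_space (point_measure I (\<lambda>i. ennreal (w i)))"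
      using that assms by (intro prob_space_point_measure) (auto simp: sum_ennreal)
    then show ?thesis unfolding atomic_measure_def by (rule prob_space.prob_space_distr[OF _ m])
  qed
  show "(\<integral>z. \<phi> z \<partial>atomic_measure X I w x) = (\<Sum>i\<in>I. w i * \<phi> (x i))" if "\<phi> \<in> borel_measurable (borel_on X)"
    unfolding atomic_measure_def using assms
    by (subst integral_distr[OF m that]) (simp add: lebesgue_integral_point_measure_finite)
qed

text \<open>Equilibria of finite games, with finitely many types of players and the first \<open>N + 1\<close> pure
  strategies, converge along a subsequence.\<close>

theorem distributional_equilibrium:
  fixes B :: "'b::polish_space set" and E :: "'e::polish_space set"
    and J :: "('b \<times> 'e) measure \<Rightarrow> 'b \<times> 'e \<Rightarrow> real"
  assumes B: "compact B" and E: "compact E" "E \<noteq> {}"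
    and \<eta>: "prob_space \<eta>" "sets \<eta> = sets (borel_on B)"
    and J: "\<And>M Ms z zs. \<lbrakk>prob_space M; sets M = sets (borel_on (B \<times> E));
        \<And>n. prob_space (Ms n); \<And>n. sets (Ms n) = sets (borel_on (B \<times> E)); weakly_converges (B \<times> E) Ms M;
        \<And>n::nat. zs n \<in> B \<times> E; z \<in> B \<times> E; zs \<longlonglongrightarrow> z\<rbrakk> \<Longrightarrow> (\<lambda>n. J (Ms n) (zs n)) \<longlonglongrightarrow> J M z"
  obtains \<gamma> k where "prob_space \<gamma>" "sets \<gamma> = sets (borel_on (B \<times> E))" "distr \<gamma> (borel_on B) fst = \<eta>"
    "k \<in> measurable \<eta> (prob_algebra (borel_on E))"
    "\<And>\<phi>. continuous_on (B \<times> E) \<phi> \<Longrightarrow> (\<integral>z. \<phi> z \<partial>\<gamma>) = (\<integral>b. (\<integral>a. (\<phi> (b, a) :: real) \<partial>k b) \<partial>\<eta>)"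
    "AE b in \<eta>. \<forall>a\<in>E. J \<gamma> (b, a) \<le> (\<integral>a'. J \<gamma> (b, a') \<partial>k b)"
proof -
  define X where "X = B \<times> E"
  have X: "compact X" unfolding X_def by (rule compact_Times[OF B E(1)])
  interpret \<eta>: prob_space \<eta> by fact
  have sp\<eta>: "space \<eta> = B" by (rule space_borel_onI[OF \<eta>(2)])
  then have B0: "B \<noteq> {}" using \<eta>.not_empty by simp
  define PX where "PX = {M. prob_space M \<and> sets M = sets (borel_on X)}"
  have J': "(\<lambda>n. J (Ms n) (zs n)) \<longlonglongrightarrow> J M z"
    if "M \<in> PX" "\<And>n. Ms n \<in> PX" "weakly_converges X Ms M" "\<And>n::nat. zs n \<in> X" "z \<in> X" "zs \<longlonglongrightarrow> z" for M Ms z zs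
    using that unfolding PX_def X_def by (intro J) auto
  have Jc: "continuous_on X (J M)" if "M \<in> PX" for M
    unfolding continuous_on_sequentially o_def using that by (auto intro!: J' simp: weakly_converges_def)
  have PXD: "prob_space M" "finite_measure M" "sets M = sets (borel_on X)" "measure M X \<le> 1" if "M \<in> PX" for M
    using that by (auto simp: PX_def prob_space.finite_measure prob_space.prob_le_1)
  obtain D where D: "countable D" "D \<subseteq> E" "E \<subseteq> closure D"
    using separable[of E] by blast
  have D0: "D \<noteq> {}" using D(3) E(2) by auto
  define e where "e = from_nat_into D"
  have eD: "range e = D" using D D0 by (simp add: e_def range_from_nat_into)
  then have eE: "e l \<in> E" for l using D(2) by blast
  \<comment> \<open>The approximate law need not have marginal \<eta>, but misses it by at most the
    oscillation of the test at scale \<open>1 / real (Suc N)\<close>. The second clause compares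
    with the strategies \<open>e 0\<close> to \<open>e N\<close> and contains no disintegration, so
    that it can pass to weak limits.\<close>
  define good where "good N M \<longleftrightarrow> (\<forall>(\<psi>::'b \<Rightarrow> real) \<epsilon>. continuous_on B \<psi> \<longrightarrow> (\<forall>x\<in>B. \<forall>y\<in>B. dist x y < 1 / real (Suc N) \<longrightarrow> \<bar>\<psi> x - \<psi> y\<bar> \<le> \<epsilon>) \<longrightarrow>
         \<bar>(\<integral>z. \<psi> (fst z) \<partial>M) - (\<integral>b. \<psi> b \<partial>\<eta>)\<bar> \<le> \<epsilon>) \<and>
      (\<forall>l\<le>N. \<forall>\<psi>. continuous_on B \<psi> \<longrightarrow> (\<forall>b\<in>B. 0 \<le> \<psi> b) \<longrightarrow>
         (\<integral>z. \<psi> (fst z) * J M (fst z, e l) \<partial>M) \<le> (\<integral>z. \<psi> (fst z) * J M z \<partial>M))" for N M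
  have step: "\<exists>M\<in>PX. good N M" for N
  proof -
    obtain F and \<Psi> :: "'b \<Rightarrow> 'b \<Rightarrow> real" where F: "finite F" "F \<subseteq> B" and c\<Psi>: "\<And>y. continuous_on B (\<Psi> y)"
      and \<Psi>: "\<And>y x. x \<in> B \<Longrightarrow> 0 \<le> \<Psi> y x" "\<And>x. x \<in> B \<Longrightarrow> (\<Sum>y\<in>F. \<Psi> y x) = 1"
        "\<And>x y. x \<in> B \<Longrightarrow> \<Psi> y x \<noteq> 0 \<Longrightarrow> dist x y < 1 / real (Suc N)"
      using partition_of_unity_compact[OF B, of "1 / real (Suc N)"] by (metis of_nat_0_less_iff zero_less_Suc zero_less_divide_1_iff)
    have i\<Psi>: "integrable \<eta> (\<Psi> y)" for y
      by (rule integrable_continuous_on_compact[OF \<eta>.finite_measure_axioms \<eta>(2) B c\<Psi>])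
    define n where "n = card F"
    obtain b where b: "bij_betw b {..<n} F"
      using ex_bij_betw_nat_finite[OF F(1)] by (auto simp: n_def atLeast0LessThan)
    have bB: "b i \<in> B" if "i < n" for i using b F(2) that by (auto simp: bij_betw_def)
    \<comment> \<open>The type \<open>b i\<close> stands for the players near it and receives the
      \<eta>-integral of its bump.\<close>
    define w where "w i = (\<integral>x. \<Psi> (b i) x \<partial>\<eta>)" for i
    have w0: "0 \<le> w i" for i unfolding w_def using \<Psi>(1) sp\<eta> by (intro Bochner_Integration.integral_nonneg) auto
    have wsum: "(\<Sum>i<n. w i * h (b i)) = (\<integral>x. (\<Sum>y\<in>F. \<Psi> y x *\<^sub>R h y) \<partial>\<eta>)" for h :: "'b \<Rightarrow> real"
    proof -
      have "(\<integral>x. (\<Sum>y\<in>F. \<Psi> y x *\<^sub>R h y) \<partial>\<eta>) = (\<Sum>y\<in>F. (\<integral>x. \<Psi> y x \<partial>\<eta>) * h y)"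
        using i\<Psi> by (subst Bochner_Integration.integral_sum) auto
      also have "\<dots> = (\<Sum>i<n. w i * h (b i))"
        unfolding w_def by (rule sum.reindex_bij_betw[OF b, symmetric])
      finally show ?thesis by simp
    qed
    have w1: "(\<Sum>i<n. w i) = 1"
    proof -
      have "(\<integral>x. (\<Sum>y\<in>F. \<Psi> y x) \<partial>\<eta>) = (\<integral>x. 1 \<partial>\<eta>)"
        using \<Psi>(2) sp\<eta> by (intro Bochner_Integration.integral_cong) auto
      then show ?thesis using wsum[of "\<lambda>_. 1"] by (simp add: \<eta>.prob_space)
    qed
    define S where "S = {p. \<forall>i<n. (\<forall>j<Suc N. 0 \<le> p i j) \<and> (\<Sum>j<Suc N. p i j) = (1::real)}"
    define M where "M p = atomic_measure X ({..<n} \<times> {..<Suc N}) (\<lambda>(i, j). w i * p i j) (\<lambda>(i, j). (b i, e j))" for p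
    have xX: "(\<lambda>(i, j). (b i, e j)) \<in> {..<n} \<times> {..<Suc N} \<rightarrow> X"
      using bB eE by (auto simp: X_def)
    have MPX: "M p \<in> PX" if p: "p \<in> S" for p
    proof -
      have "(\<Sum>(i, j)\<in>{..<n} \<times> {..<Suc N}. w i * p i j) = (\<Sum>i<n. \<Sum>j<Suc N. w i * p i j)"
        by (rule sum.cartesian_product[symmetric])
      also have "\<dots> = (\<Sum>i<n. w i * (\<Sum>j<Suc N. p i j))" by (simp only: sum_distrib_left)
      also have "\<dots> = (\<Sum>i<n. w i)" using p by (intro sum.cong) (auto simp: S_def simp del: sum.lessThan_Suc)
      finally have "(\<Sum>(i, j)\<in>{..<n} \<times> {..<Suc N}. w i * p i j) = 1" using w1 by simp
      then show ?thesis
        using p w0 xX unfolding PX_def M_def S_def by (auto intro!: prob_space_atomic_measure simp del: sum.lessThan_Suc)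
    qed
    have intM: "(\<integral>z. \<phi> z \<partial>M p) = (\<Sum>i<n. w i * (\<Sum>j<Suc N. p i j * \<phi> (b i, e j)))"
      if p: "p \<in> S" and \<phi>: "continuous_on X \<phi>" for p and \<phi> :: "'b \<times> 'e \<Rightarrow> real"
    proof -
      have "(\<integral>z. \<phi> z \<partial>M p) = (\<Sum>z\<in>{..<n} \<times> {..<Suc N}. (case z of (i, j) \<Rightarrow> w i * p i j) * \<phi> (case z of (i, j) \<Rightarrow> (b i, e j)))"
        unfolding M_def using p w0 xX
        by (intro integral_atomic_measure borel_measurable_continuous_on_restrict \<phi>) (auto simp: S_def)
      also have "\<dots> = (\<Sum>(i, j)\<in>{..<n} \<times> {..<Suc N}. w i * (p i j * \<phi> (b i, e j)))"
        by (intro sum.cong) auto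
      also have "\<dots> = (\<Sum>i<n. \<Sum>j<Suc N. w i * (p i j * \<phi> (b i, e j)))"
        by (rule sum.cartesian_product[symmetric])
      also have "\<dots> = (\<Sum>i<n. w i * (\<Sum>j<Suc N. p i j * \<phi> (b i, e j)))" by (simp only: sum_distrib_left)
      finally show ?thesis .
    qed
    obtain p where p: "p \<in> S"
      and nash: "\<And>i l. i < n \<Longrightarrow> l < Suc N \<Longrightarrow> J (M p) (b i, e l) \<le> (\<Sum>j<Suc N. p i j * J (M p) (b i, e j))"
    proof -
      \<comment> \<open>The payoff \<open>J (M p) (b i, e j)\<close> depends on the whole profile
        through \<open>M p\<close>. Sequential continuity in \<open>p\<close> is all that the finite
        game asks for, and convergent weights at fixed points give weakly convergent laws.\<close>
      have "\<exists>p\<in>S. \<forall>i<n. \<forall>l<Suc N. J (M p) (b i, e l) \<le> (\<Sum>j<Suc N. p i j * J (M p) (b i, e j))"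
        unfolding S_def
      proof (rule finite_nash_equilibrium, unfold S_def[symmetric])
        fix p ps i j assume p: "p \<in> S" "\<And>k. ps k \<in> S"
          and lim: "\<And>i j. i < n \<Longrightarrow> j < Suc N \<Longrightarrow> (\<lambda>k. ps k i j) \<longlonglongrightarrow> p i j" and ij: "i < n" "j < Suc N"
        show "(\<lambda>k. J (M (ps k)) (b i, e j)) \<longlonglongrightarrow> J (M p) (b i, e j)"
        proof (rule J')
          show "weakly_converges X (\<lambda>k. M (ps k)) (M p)"
            unfolding weakly_converges_def
          proof (intro allI impI)
            fix \<phi> :: "'b \<times> 'e \<Rightarrow> real" assume "continuous_on X \<phi>"
            then show "(\<lambda>k. \<integral>x. \<phi> x \<partial>M (ps k)) \<longlonglongrightarrow> (\<integral>x. \<phi> x \<partial>M p)"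
              using p by (simp only: intM) (intro tendsto_intros lim, auto)
          qed
        qed (use p ij bB eE MPX in \<open>auto simp: X_def\<close>)
      qed simp
      then show ?thesis using that by blast
    qed
    have cf: "continuous_on X (\<lambda>z. \<psi> (fst z))" if "continuous_on B \<psi>" for \<psi> :: "'b \<Rightarrow> real"
      by (rule continuous_on_compose2[OF that]) (auto simp: X_def intro: continuous_intros)
    have ce: "continuous_on X (\<lambda>z. J (M p) (fst z, e l))" for l
      by (rule continuous_on_compose2[OF Jc[OF MPX[OF p]]]) (use eE in \<open>auto simp: X_def intro!: continuous_intros\<close>)
    have p1: "(\<Sum>j<Suc N. p i j * c) = c" if "i < n" for i c
      using p that by (simp add: S_def flip: sum_distrib_right del: sum.lessThan_Suc)
    show ?thesis
      unfolding good_def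
    proof (intro bexI[of _ "M p"] conjI allI impI)
      show "M p \<in> PX" by (rule MPX[OF p])
      fix \<psi> :: "'b \<Rightarrow> real" and \<epsilon> assume \<psi>: "continuous_on B \<psi>"
        and mod: "\<forall>x\<in>B. \<forall>y\<in>B. dist x y < 1 / real (Suc N) \<longrightarrow> \<bar>\<psi> x - \<psi> y\<bar> \<le> \<epsilon>"
      have i\<psi>: "integrable \<eta> \<psi>"
        by (rule integrable_continuous_on_compact[OF \<eta>.finite_measure_axioms \<eta>(2) B \<psi>])
      have i\<Psi>\<psi>: "integrable \<eta> (\<lambda>x. \<Sum>y\<in>F. \<Psi> y x *\<^sub>R \<psi> y)"
        using i\<Psi> by (intro Bochner_Integration.integrable_sum) auto
      have "(\<integral>z. \<psi> (fst z) \<partial>M p) = (\<Sum>i<n. w i * \<psi> (b i))"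
        using p1 by (simp add: intM[OF p cf[OF \<psi>]] del: sum.lessThan_Suc)
      also have "\<dots> = (\<integral>x. (\<Sum>y\<in>F. \<Psi> y x *\<^sub>R \<psi> y) \<partial>\<eta>)" by (rule wsum)
      finally have "(\<integral>b. \<psi> b \<partial>\<eta>) - (\<integral>z. \<psi> (fst z) \<partial>M p) = (\<integral>x. \<psi> x - (\<Sum>y\<in>F. \<Psi> y x *\<^sub>R \<psi> y) \<partial>\<eta>)"
        using i\<psi> i\<Psi>\<psi> by simp
      also have "norm \<dots> \<le> (\<integral>x. norm (\<psi> x - (\<Sum>y\<in>F. \<Psi> y x *\<^sub>R \<psi> y)) \<partial>\<eta>)" by (rule integral_norm_bound)
      also have "\<dots> \<le> \<epsilon>"
      proof (rule \<eta>.integral_le_const)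
        show "integrable \<eta> (\<lambda>x. norm (\<psi> x - (\<Sum>y\<in>F. \<Psi> y x *\<^sub>R \<psi> y)))"
          using i\<psi> i\<Psi>\<psi> by (intro integrable_norm Bochner_Integration.integrable_diff)
        have "norm (\<psi> x - (\<Sum>y\<in>F. \<Psi> y x *\<^sub>R \<psi> y)) \<le> \<epsilon>" if "x \<in> B" for x
          using that mod by (intro partition_of_unity_approx[OF F _ \<Psi>(1) \<Psi>(2) \<Psi>(3)]) auto
        then show "AE x in \<eta>. norm (\<psi> x - (\<Sum>y\<in>F. \<Psi> y x *\<^sub>R \<psi> y)) \<le> \<epsilon>" using sp\<eta> by auto
      qed
      finally show "\<bar>(\<integral>z. \<psi> (fst z) \<partial>M p) - (\<integral>b. \<psi> b \<partial>\<eta>)\<bar> \<le> \<epsilon>" by (simp add: abs_minus_commute)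
    next
      fix l and \<psi> :: "'b \<Rightarrow> real" assume l: "l \<le> N" and \<psi>: "continuous_on B \<psi>" "\<forall>b\<in>B. 0 \<le> \<psi> b"
      have "(\<integral>z. \<psi> (fst z) * J (M p) (fst z, e l) \<partial>M p) = (\<Sum>i<n. w i * (\<psi> (b i) * J (M p) (b i, e l)))"
        using p1 by (subst intM[OF p continuous_on_mult[OF cf[OF \<psi>(1)] ce]]) (simp del: sum.lessThan_Suc)
      also have "\<dots> \<le> (\<Sum>i<n. w i * (\<psi> (b i) * (\<Sum>j<Suc N. p i j * J (M p) (b i, e j))))"
        using l \<psi>(2) bB w0 by (intro sum_mono mult_left_mono nash) auto
      also have "\<dots> = (\<Sum>i<n. w i * (\<Sum>j<Suc N. p i j * (\<psi> (b i) * J (M p) (b i, e j))))"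
        by (simp add: sum_distrib_left mult_ac del: sum.lessThan_Suc)
      also have "\<dots> = (\<integral>z. \<psi> (fst z) * J (M p) z \<partial>M p)"
        by (subst intM[OF p continuous_on_mult[OF cf[OF \<psi>(1)] Jc[OF MPX[OF p]]]]) simp
      finally show "(\<integral>z. \<psi> (fst z) * J (M p) (fst z, e l) \<partial>M p) \<le> (\<integral>z. \<psi> (fst z) * J (M p) z \<partial>M p)" .
    qed
  qed
  obtain Ms where Ms: "\<And>N. Ms N \<in> PX" and good: "\<And>N. good N (Ms N)"
    using step by metis
  have marg: "\<And>N (\<psi>::'b \<Rightarrow> real) \<epsilon>. continuous_on B \<psi> \<Longrightarrow> (\<And>x y. x \<in> B \<Longrightarrow> y \<in> B \<Longrightarrow> dist x y < 1 / real (Suc N) \<Longrightarrow> \<bar>\<psi> x - \<psi> y\<bar> \<le> \<epsilon>) \<Longrightarrow>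
         \<bar>(\<integral>z. \<psi> (fst z) \<partial>Ms N) - (\<integral>b. \<psi> b \<partial>\<eta>)\<bar> \<le> \<epsilon>"
    using good unfolding good_def by blast
  have eq: "\<And>N l \<psi>. l \<le> N \<Longrightarrow> continuous_on B \<psi> \<Longrightarrow> (\<And>b. b \<in> B \<Longrightarrow> 0 \<le> \<psi> b) \<Longrightarrow>
         (\<integral>z. \<psi> (fst z) * J (Ms N) (fst z, e l) \<partial>Ms N) \<le> (\<integral>z. \<psi> (fst z) * J (Ms N) z \<partial>Ms N)"
    using good unfolding good_def by blast
  obtain r \<gamma> where r: "strict_mono (r::nat\<Rightarrow>nat)" and \<gamma>: "prob_space \<gamma>" "sets \<gamma> = sets (borel_on X)"
    and w: "weakly_converges X (Ms \<circ> r) \<gamma>"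
    using weak_sequential_compactness[OF X, of Ms] PXD[OF Ms] by metis
  have \<gamma>PX: "\<gamma> \<in> PX" using \<gamma> by (simp add: PX_def)
  interpret \<gamma>: prob_space \<gamma> by fact
  have sp\<gamma>: "space \<gamma> = X" by (rule space_borel_onI[OF \<gamma>(2)])
  have cf: "continuous_on X (\<lambda>z. \<psi> (fst z))" if "continuous_on B \<psi>" for \<psi> :: "'b \<Rightarrow> real"
    by (rule continuous_on_compose2[OF that]) (auto simp: X_def intro: continuous_intros)
  have ce: "continuous_on X (\<lambda>z. J M (fst z, e l))" if "M \<in> PX" for l M
    by (rule continuous_on_compose2[OF Jc[OF that]]) (use eE in \<open>auto simp: X_def intro!: continuous_intros\<close>)
  have \<gamma>marg: "(\<integral>z. \<psi> (fst z) \<partial>\<gamma>) = (\<integral>b. \<psi> b \<partial>\<eta>)" if \<psi>: "continuous_on B \<psi>" for \<psi> :: "'b \<Rightarrow> real"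
  proof -
    have "(\<lambda>n. \<integral>z. \<psi> (fst z) \<partial>Ms (r n)) \<longlonglongrightarrow> (\<integral>b. \<psi> b \<partial>\<eta>)"
    proof (rule metric_LIMSEQ_I)
      fix \<epsilon> :: real assume \<epsilon>: "\<epsilon> > 0"
      have "uniformly_continuous_on B \<psi>" using B \<psi> by (rule compact_uniformly_continuous[rotated])
      then obtain \<delta> where \<delta>: "\<delta> > 0" "\<And>x y. x \<in> B \<Longrightarrow> y \<in> B \<Longrightarrow> dist y x < \<delta> \<Longrightarrow> dist (\<psi> y) (\<psi> x) < \<epsilon> / 2"
        using \<epsilon> unfolding uniformly_continuous_on_def by (metis half_gt_zero)
      obtain N where N: "1 / real (Suc N) < \<delta>" using reals_Archimedean[OF \<delta>(1)] by (auto simp: inverse_eq_divide)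
      have "dist (\<integral>z. \<psi> (fst z) \<partial>Ms (r n)) (\<integral>b. \<psi> b \<partial>\<eta>) < \<epsilon>" if "n \<ge> N" for n
      proof -
        have "1 / real (Suc (r n)) \<le> 1 / real (Suc N)"
          using that seq_suble[OF r, of n] by (intro divide_left_mono) auto
        then have "\<bar>(\<integral>z. \<psi> (fst z) \<partial>Ms (r n)) - (\<integral>b. \<psi> b \<partial>\<eta>)\<bar> \<le> \<epsilon> / 2"
          using \<delta>(2) N by (intro marg[OF \<psi>]) (force simp: dist_real_def dist_commute intro: less_imp_le)
        then show ?thesis using \<epsilon> by (simp add: dist_real_def)
      qed
      then show "\<exists>N. \<forall>n\<ge>N. dist (\<integral>z. \<psi> (fst z) \<partial>Ms (r n)) (\<integral>b. \<psi> b \<partial>\<eta>) < \<epsilon>" by blast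
    qed
    moreover have "(\<lambda>n. \<integral>z. \<psi> (fst z) \<partial>Ms (r n)) \<longlonglongrightarrow> (\<integral>z. \<psi> (fst z) \<partial>\<gamma>)"
      using w cf[OF \<psi>] by (simp add: weakly_converges_def)
    ultimately show ?thesis by (rule LIMSEQ_unique[rotated])
  qed
  have fstm: "fst \<in> measurable \<gamma> (borel_on B)"
    unfolding measurable_cong_sets[OF \<gamma>(2) refl] X_def
    by (auto intro!: measurable_restrict_space3 borel_measurable_continuous_onI continuous_intros)
  have \<gamma>\<eta>: "distr \<gamma> (borel_on B) fst = \<eta>"
  proof (rule measure_eqI_continuous)
    show "finite_measure (distr \<gamma> (borel_on B) fst)" by (rule \<gamma>.finite_measure_distr[OF fstm])
    fix \<phi> :: "'b \<Rightarrow> real" assume \<phi>: "continuous_on B \<phi>"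
    show "(\<integral>x. \<phi> x \<partial>distr \<gamma> (borel_on B) fst) = (\<integral>x. \<phi> x \<partial>\<eta>)"
      using \<gamma>marg[OF \<phi>] by (simp add: integral_distr[OF fstm borel_measurable_continuous_on_restrict[OF \<phi>]])
  qed (use \<eta> \<eta>.finite_measure_axioms in auto)
  \<comment> \<open>Both sides pass to the limit although payoff and measure move together, because
    the integrands converge along moving arguments.\<close>
  have \<gamma>eq: "(\<integral>z. \<psi> (fst z) * J \<gamma> (fst z, e l) \<partial>\<gamma>) \<le> (\<integral>z. \<psi> (fst z) * J \<gamma> z \<partial>\<gamma>)"
    if \<psi>: "continuous_on B \<psi>" "\<And>b. b \<in> B \<Longrightarrow> 0 \<le> \<psi> b" for \<psi> l
  proof (rule LIMSEQ_le)
    have w': "weakly_converges X (\<lambda>n. Ms (r n)) \<gamma>" using w by (simp add: o_def)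
    have \<psi>l: "(\<lambda>n. \<psi> (fst (xs n))) \<longlonglongrightarrow> \<psi> (fst x)" if "\<And>n. xs n \<in> X" "x \<in> X" "xs \<longlonglongrightarrow> x" for xs x
      using continuous_on_tendsto_compose[OF cf[OF \<psi>(1)] that(3,2)] that(1) by simp
    show "(\<lambda>n. \<integral>z. \<psi> (fst z) * J (Ms (r n)) z \<partial>Ms (r n)) \<longlonglongrightarrow> (\<integral>z. \<psi> (fst z) * J \<gamma> z \<partial>\<gamma>)"
    proof (rule weakly_converges_integral[where Ms="\<lambda>n. Ms (r n)" and M=\<gamma> and C=1, OF X])
      show "integrable (Ms (r n)) (\<lambda>z. \<psi> (fst z) * J (Ms (r n)) z)" for n
        by (intro integrable_continuous_on_compact[OF PXD(2,3)[OF Ms] X] continuous_on_mult cf Jc Ms \<psi>(1))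
      show "continuous_on X (\<lambda>z. \<psi> (fst z) * J \<gamma> z)"
        by (intro continuous_on_mult cf Jc \<gamma>PX \<psi>(1))
      show "(\<lambda>n. \<psi> (fst (xs n)) * J (Ms (r n)) (xs n)) \<longlonglongrightarrow> \<psi> (fst x) * J \<gamma> x"
        if "\<And>n. xs n \<in> X" "x \<in> X" "xs \<longlonglongrightarrow> x" for xs x
        by (intro tendsto_mult \<psi>l J' w' \<gamma>PX Ms that)
    qed (use PXD[OF Ms] PXD[OF \<gamma>PX] w' in auto)
    have xl: "(\<lambda>n. (fst (xs n), e l)) \<longlonglongrightarrow> (fst x, e l)" if "xs \<longlonglongrightarrow> x" for xs :: "nat \<Rightarrow> 'b \<times> 'e" and x
      by (intro tendsto_intros that)
    have xX: "(fst x, e l) \<in> X" if "x \<in> X" for x using that eE by (auto simp: X_def)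
    show "(\<lambda>n. \<integral>z. \<psi> (fst z) * J (Ms (r n)) (fst z, e l) \<partial>Ms (r n)) \<longlonglongrightarrow> (\<integral>z. \<psi> (fst z) * J \<gamma> (fst z, e l) \<partial>\<gamma>)"
    proof (rule weakly_converges_integral[where Ms="\<lambda>n. Ms (r n)" and M=\<gamma> and C=1, OF X])
      show "integrable (Ms (r n)) (\<lambda>z. \<psi> (fst z) * J (Ms (r n)) (fst z, e l))" for n
        by (intro integrable_continuous_on_compact[OF PXD(2,3)[OF Ms] X] continuous_on_mult cf ce Ms \<psi>(1))
      show "continuous_on X (\<lambda>z. \<psi> (fst z) * J \<gamma> (fst z, e l))"
        by (intro continuous_on_mult cf ce \<gamma>PX \<psi>(1))
      show "(\<lambda>n. \<psi> (fst (xs n)) * J (Ms (r n)) (fst (xs n), e l)) \<longlonglongrightarrow> \<psi> (fst x) * J \<gamma> (fst x, e l)"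
        if "\<And>n. xs n \<in> X" "x \<in> X" "xs \<longlonglongrightarrow> x" for xs x
        by (intro tendsto_mult \<psi>l J' w' \<gamma>PX Ms xl xX that)
    qed (use PXD[OF Ms] PXD[OF \<gamma>PX] w' in auto)
    \<comment> \<open>The strategy \<open>e l\<close> takes part in the comparison only from stage
      \<open>l\<close> on, and \<open>r n\<close> is at least \<open>n\<close>.\<close>
    show "\<exists>N. \<forall>n\<ge>N. (\<integral>z. \<psi> (fst z) * J (Ms (r n)) (fst z, e l) \<partial>Ms (r n)) \<le> (\<integral>z. \<psi> (fst z) * J (Ms (r n)) z \<partial>Ms (r n))"
      using seq_suble[OF r] by (intro exI[of _ l] allI impI eq \<psi>) (auto intro: order_trans)
  qed
  have sets\<eta>E: "sets \<gamma> = sets (\<eta> \<Otimes>\<^sub>M borel_on E)"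
    using \<gamma>(2) \<eta>(2) by (simp add: X_def sets_borel_on_Times cong: sets_pair_measure_cong)
  have \<eta>d: "\<eta> = distr \<gamma> \<eta> fst" using \<gamma>\<eta> distr_cong[of \<gamma> \<gamma> "borel_on B" \<eta> fst fst] \<eta>(2) by simp
  obtain k where k: "k \<in> measurable \<eta> (prob_algebra (borel_on E))"
    and dis: "\<And>\<phi> C. \<phi> \<in> borel_measurable (\<eta> \<Otimes>\<^sub>M borel_on E) \<Longrightarrow> (\<And>z. z \<in> space \<eta> \<times> E \<Longrightarrow> \<bar>\<phi> z\<bar> \<le> C) \<Longrightarrow>
      (\<integral>z. \<phi> z \<partial>\<gamma>) = (\<integral>b. (\<integral>a. (\<phi> (b, a) :: real) \<partial>k b) \<partial>\<eta>)"
    by (rule disintegration_compact[OF E(1) \<gamma>(1) sets\<eta>E \<eta>d]) (rule that, assumption, blast)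
  have disc: "(\<integral>z. \<phi> z \<partial>\<gamma>) = (\<integral>b. (\<integral>a. \<phi> (b, a) \<partial>k b) \<partial>\<eta>)" if \<phi>: "continuous_on X \<phi>" for \<phi> :: "'b \<times> 'e \<Rightarrow> real"
  proof -
    have "bounded (\<phi> ` X)" using X \<phi> by (intro compact_imp_bounded compact_continuous_image)
    then obtain C where "\<And>z. z \<in> X \<Longrightarrow> \<bar>\<phi> z\<bar> \<le> C" by (auto simp: bounded_iff)
    moreover have "\<phi> \<in> borel_measurable (\<eta> \<Otimes>\<^sub>M borel_on E)"
      using borel_measurable_borel_on[OF \<gamma>(2) \<phi>] measurable_cong_sets[OF sets\<eta>E refl] by blast
    ultimately show ?thesis by (intro dis[of \<phi> C]) (auto simp: sp\<eta> X_def)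
  qed
  have Jb: "continuous_on E (\<lambda>a. J \<gamma> (b, a))" if "b \<in> B" for b
    by (rule continuous_on_compose2[OF Jc[OF \<gamma>PX]]) (use that in \<open>auto simp: X_def intro!: continuous_intros\<close>)
  have "bounded (J \<gamma> ` X)" using X Jc[OF \<gamma>PX] by (intro compact_imp_bounded compact_continuous_image)
  then obtain C where C: "\<And>z. z \<in> X \<Longrightarrow> \<bar>J \<gamma> z\<bar> \<le> C" by (auto simp: bounded_iff)
  define V where "V b = (\<integral>a. J \<gamma> (b, a) \<partial>k b)" for b
  have Jm: "J \<gamma> \<in> borel_measurable (\<eta> \<Otimes>\<^sub>M borel_on E)"
    using borel_measurable_borel_on[OF \<gamma>(2) Jc[OF \<gamma>PX]] measurable_cong_sets[OF sets\<eta>E refl] by blast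
  have C2: "\<bar>J \<gamma> z\<bar> \<le> C" if "z \<in> space \<eta> \<times> space (borel_on E)" for z
    using that C by (simp add: sp\<eta> space_restrict_space X_def)
  have VC: "\<bar>V b\<bar> \<le> C" if "b \<in> B" for b
    unfolding V_def using nn_integral_kernel(2)[OF k Jm C2] that sp\<eta> by simp
  have Vm: "V \<in> borel_measurable \<eta>"
    unfolding V_def[abs_def] by (rule kernel_integral_measurable[OF k Jm C2])
  \<comment> \<open>The test depends on the player alone: the deviation side is an \<eta>-integral
    by the marginal, and the equilibrium side becomes an \<eta>-integral of \<open>V\<close> by
    disintegration.\<close>
  have AEl: "AE b in \<eta>. J \<gamma> (b, e l) \<le> V b" for l
  proof -
    have Jl: "continuous_on B (\<lambda>b. J \<gamma> (b, e l))"
      by (rule continuous_on_compose2[OF Jc[OF \<gamma>PX]]) (use eE in \<open>auto simp: X_def intro!: continuous_intros\<close>)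
    have Jlm: "(\<lambda>b. J \<gamma> (b, e l)) \<in> borel_measurable \<eta>" by (rule borel_measurable_borel_on[OF \<eta>(2) Jl])
    have "AE b in \<eta>. 0 \<le> V b - J \<gamma> (b, e l)"
    proof (rule AE_nonneg_continuous_tests[OF \<eta>.finite_measure_axioms \<eta>(2) compact_imp_closed[OF B]])
      show "(\<lambda>b. V b - J \<gamma> (b, e l)) \<in> borel_measurable \<eta>" using Vm Jlm by simp
      show "\<bar>V b - J \<gamma> (b, e l)\<bar> \<le> C + C" if "b \<in> B" for b
        using VC[OF that] C[of "(b, e l)"] that eE by (simp add: X_def)
      fix \<psi> :: "'b \<Rightarrow> real" assume "continuous_on UNIV \<psi>" and \<psi>01: "\<And>x. 0 \<le> \<psi> x \<and> \<psi> x \<le> 1"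
      then have \<psi>: "continuous_on B \<psi>" using continuous_on_subset by blast
      have "\<bar>\<psi> b * V b\<bar> \<le> C" if "b \<in> B" for b
        using mult_mono[of "\<bar>\<psi> b\<bar>" 1 "\<bar>V b\<bar>" C] \<psi>01[of b] VC[OF that] by (simp add: abs_mult)
      then have i1: "integrable \<eta> (\<lambda>b. \<psi> b * V b)"
        using borel_measurable_borel_on[OF \<eta>(2) \<psi>] Vm sp\<eta>
        by (intro \<eta>.integrable_const_bound[where B=C]) auto
      have i2: "integrable \<eta> (\<lambda>b. \<psi> b * J \<gamma> (b, e l))"
        by (rule integrable_continuous_on_compact[OF \<eta>.finite_measure_axioms \<eta>(2) B continuous_on_mult[OF \<psi> Jl]])
      have "(\<integral>b. \<psi> b * J \<gamma> (b, e l) \<partial>\<eta>) = (\<integral>z. \<psi> (fst z) * J \<gamma> (fst z, e l) \<partial>\<gamma>)"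
        using \<gamma>marg[OF continuous_on_mult[OF \<psi> Jl]] by simp
      also have "\<dots> \<le> (\<integral>z. \<psi> (fst z) * J \<gamma> z \<partial>\<gamma>)" using \<psi>01 by (intro \<gamma>eq \<psi>) auto
      also have "\<dots> = (\<integral>b. \<psi> b * V b \<partial>\<eta>)"
        by (subst disc[OF continuous_on_mult[OF cf[OF \<psi>] Jc[OF \<gamma>PX]]]) (simp add: V_def)
      finally show "0 \<le> (\<integral>b. \<psi> b * (V b - J \<gamma> (b, e l)) \<partial>\<eta>)"
        using i1 i2 by (simp add: right_diff_distrib)
    qed
    then show ?thesis by simp
  qed
  \<comment> \<open>One null set serves the whole countable family \<open>e\<close>; continuity of
    the payoff in the control and density of \<open>D\<close> then reach every point of
    \<open>E\<close>.\<close>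
  have "AE b in \<eta>. \<forall>l. J \<gamma> (b, e l) \<le> V b" using AEl by (simp add: AE_all_countable)
  then have "AE b in \<eta>. \<forall>a\<in>E. J \<gamma> (b, a) \<le> V b"
    using AE_space
  proof eventually_elim
    case (elim b)
    show ?case
    proof
      fix a assume a: "a \<in> E"
      have "\<exists>as. (\<forall>n. as n \<in> D) \<and> as \<longlonglongrightarrow> a"
        using a D(3) unfolding closure_sequential[symmetric] by blast
      then obtain as where as: "\<And>n. as n \<in> D" "as \<longlonglongrightarrow> a" by blast
      have "(\<lambda>n. J \<gamma> (b, as n)) \<longlonglongrightarrow> J \<gamma> (b, a)"
      proof (rule continuous_on_tendsto_compose[OF Jb as(2) a])
        show "b \<in> B" using elim(2) sp\<eta> by simp
        show "\<forall>\<^sub>F n in sequentially. as n \<in> E" by (intro always_eventually allI subsetD[OF D(2)] as(1))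
      qed
      moreover have "J \<gamma> (b, as n) \<le> V b" for n
        using elim(1) as(1)[of n] eD by auto
      ultimately show "J \<gamma> (b, a) \<le> V b" by (intro LIMSEQ_le_const2) auto
    qed
  qed
  then show thesis
    using that[of \<gamma> k] \<gamma> \<gamma>\<eta> k disc unfolding X_def V_def by blast
qed

section \<open>Control measures\<close>

lemma sets_borel_of_top_of_set: "sets (borel_of (top_of_set S)) = sets (borel_on S)"
proof -
  have "sets (borel_of (top_of_set S)) = sigma_sets S {U. openin (top_of_set S) U}"
    unfolding borel_of_def by (subst sets_measure_of) (auto dest: openin_imp_subset)
  also have "{U. openin (top_of_set S) U} = {(\<lambda>x. x) -` A \<inter> S |A. A \<in> {T. open T}}"
    by (auto simp: openin_open)
  also have "sigma_sets S \<dots> = {(\<lambda>x. x) -` A \<inter> S |A. A \<in> sigma_sets UNIV {T. open T}}"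
    by (rule sigma_sets_vimage_commute[symmetric]) simp
  also have "\<dots> = sets (borel_on S)"
    by (auto simp: sets_restrict_space borel_def)
  finally show ?thesis .
qed

lemma sets_borel_of_euclidean: "sets (borel_of euclidean) = sets borel"
  using sets_borel_of_top_of_set[of UNIV] by (simp add: sets_restrict_space)

lemma space_borel_of [simp]: "space (borel_of X) = topspace X"
  unfolding borel_of_def by (rule space_measure_of) (auto dest: openin_subset)

lemma openin_sets_borel_of: "openin X U \<Longrightarrow> U \<in> sets (borel_of X)"
  unfolding borel_of_def by (subst sets_measure_of) (auto dest: openin_subset)

lemma continuous_map_measurable_borel_of:
  assumes "continuous_map X Y f"
  shows "f \<in> measurable (borel_of X) (borel_of Y)"
proof -
  have "f \<in> measurable (borel_of X) (sigma (topspace Y) {U. openin Y U})"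
  proof (rule measurable_measure_of)
    show "{U. openin Y U} \<subseteq> Pow (topspace Y)" by (auto dest: openin_subset)
    show "f \<in> space (borel_of X) \<rightarrow> topspace Y" using assms by (auto simp: continuous_map_def)
    fix U assume "U \<in> {U. openin Y U}"
    then have "openin X {x \<in> topspace X. f x \<in> U}" using assms by (simp add: continuous_map_def)
    then show "f -` U \<inter> space (borel_of X) \<in> sets (borel_of X)"
      by (auto dest!: openin_sets_borel_of simp: vimage_def Int_def conj_commute)
  qed
  then show ?thesis by (simp add: borel_of_def)
qed

section \<open>Control measures and their weak compactness\<close>

abbreviation (input) control_space :: "real \<Rightarrow> (real \<times> 'p::metric_space) set" where
  "control_space T \<equiv> {0..T} \<times> UNIV"

lemma prod_topology_control_space:
  "prod_topology (top_of_set {0..T}) (euclidean :: 'p::metric_space topology) = top_of_set (control_space T)"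
  using prod_topology_subtopology_eu[of "{0..T}" "UNIV :: 'p set"] by simp

lemma control_measures_iff:
  "\<alpha> \<in> control_measures T \<longleftrightarrow> sets \<alpha> = sets (borel_on (control_space T)) \<and>
    (\<forall>A\<in>sets (borel_on {0..T}). emeasure \<alpha> (A \<times> UNIV) = emeasure lborel A)"
proof -
  have "emeasure (restrict_space lborel {0..T}) A = emeasure lborel A" if "A \<in> sets (borel_on {0..T})" for A
    using that by (intro emeasure_restrict_space) (auto simp: sets_restrict_space)
  then show ?thesis
    unfolding control_measures_def marginal_measures_def prod_topology_control_space sets_borel_of_top_of_set
    by auto
qed

lemma control_measuresD:
  fixes \<alpha> :: "(real \<times> 'p::metric_space) measure"
  assumes "\<alpha> \<in> control_measures T" "0 \<le> T"
  shows "sets \<alpha> = sets (borel_on (control_space T))" "space \<alpha> = control_space T" "finite_measure \<alpha>"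
    "measure \<alpha> (control_space T) = T"
    "\<And>A. A \<in> sets (borel_on {0..T}) \<Longrightarrow> emeasure \<alpha> (A \<times> UNIV) = emeasure lborel A"
proof -
  show *: "sets \<alpha> = sets (borel_on (control_space T))"
    and **: "\<And>A. A \<in> sets (borel_on {0..T}) \<Longrightarrow> emeasure \<alpha> (A \<times> UNIV) = emeasure lborel A"
    using assms by (auto simp: control_measures_iff)
  show sp: "space \<alpha> = control_space T" by (rule space_borel_onI[OF *])
  have e: "emeasure \<alpha> (control_space T) = ennreal T"
    using **[of "{0..T}"] assms by (simp add: sets_restrict_space_iff)
  then show "finite_measure \<alpha>" by (intro finite_measureI) (simp add: sp)
  show "measure \<alpha> (control_space T) = T" using e assms by (simp add: measure_def)
qed

lemma fst_measurable_control:
  "sets \<alpha> = sets (borel_on (control_space T)) \<Longrightarrow> fst \<in> measurable \<alpha> (borel_on {0..T})"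
  by (subst measurable_cong_sets[where M'="borel_on (control_space T)" and N'="borel_on {0..T}"])
    (auto intro!: measurable_restrict_space3 borel_measurable_continuous_onI continuous_intros)

text \<open>As an equation between measures, the marginal condition can be tested on continuous
  functions of time; this is how it is inherited by weak limits.\<close>

lemma control_measures_marginal:
  fixes \<alpha> :: "(real \<times> 'p::metric_space) measure"
  assumes "sets \<alpha> = sets (borel_on (control_space T))"
  shows "\<alpha> \<in> control_measures T \<longleftrightarrow> distr \<alpha> (borel_on {0..T}) fst = restrict_space lborel {0..T}"
proof -
  note fm = fst_measurable_control[OF assms]
  have sp: "space \<alpha> = control_space T" by (rule space_borel_onI[OF assms])
  have d: "emeasure (distr \<alpha> (borel_on {0..T}) fst) A = emeasure \<alpha> (A \<times> UNIV)" if "A \<in> sets (borel_on {0..T})" for A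
  proof -
    have "fst -` A \<inter> space \<alpha> = A \<times> UNIV" using sets.sets_into_space[OF that] by (auto simp: sp space_restrict_space)
    then show ?thesis using emeasure_distr[OF fm that] by simp
  qed
  have r: "emeasure (restrict_space lborel {0..T}) A = emeasure lborel A" if "A \<in> sets (borel_on {0..T})" for A
    using that by (intro emeasure_restrict_space) (auto simp: sets_restrict_space)
  have s: "sets (restrict_space lborel {0..T}) = sets (borel_on {0..T})"
    by (simp add: sets_restrict_space)
  show ?thesis
  proof
    assume "\<alpha> \<in> control_measures T"
    then show "distr \<alpha> (borel_on {0..T}) fst = restrict_space lborel {0..T}"
      using d r s by (intro measure_eqI) (auto simp: control_measures_iff)
  next
    assume eq: "distr \<alpha> (borel_on {0..T}) fst = restrict_space lborel {0..T}"
    have "emeasure \<alpha> (A \<times> UNIV) = emeasure lborel A" if "A \<in> sets (borel_on {0..T})" for A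
      using d[OF that] r[OF that] eq by simp
    then show "\<alpha> \<in> control_measures T" using assms by (simp add: control_measures_iff)
  qed
qed

lemma integral_control_measure_fst:
  fixes h :: "real \<Rightarrow> real"
  assumes "\<alpha> \<in> control_measures T" "0 \<le> T" "h \<in> borel_measurable (borel_on {0..T})"
  shows "(\<integral>z. h (fst z) \<partial>\<alpha>) = (\<integral>t\<in>{0..T}. h t \<partial>lborel)"
proof -
  note s = control_measuresD(1)[OF assms(1,2)]
  have "(\<integral>z. h (fst z) \<partial>\<alpha>) = (\<integral>t. h t \<partial>distr \<alpha> (borel_on {0..T}) fst)"
    by (rule integral_distr[OF fst_measurable_control[OF s] assms(3), symmetric])
  also have "distr \<alpha> (borel_on {0..T}) fst = restrict_space lborel {0..T}"
    using assms(1) control_measures_marginal[OF s] by simp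
  also have "(\<integral>t. h t \<partial>restrict_space lborel {0..T}) = (\<integral>t\<in>{0..T}. h t \<partial>lborel)"
    by (subst integral_restrict_space) (auto simp: set_lebesgue_integral_def)
  finally show ?thesis .
qed

text \<open>Division by \<open>T\<close> turns control measures into probability measures. The limit
  has Lebesgue marginal because a continuous function of time alone has the same integral all along
  the sequence.\<close>

lemma control_measures_weak_compact:
  fixes \<alpha>s :: "nat \<Rightarrow> (real \<times> 'p::metric_space) measure"
  assumes T: "T > 0" and P: "compact (UNIV :: 'p set)" and \<alpha>s: "\<And>n. \<alpha>s n \<in> control_measures T"
  obtains r \<alpha> where "strict_mono (r::nat\<Rightarrow>nat)" "\<alpha> \<in> control_measures T" "weakly_converges (control_space T) (\<alpha>s \<circ> r) \<alpha>"
proof -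
  define Y :: "(real \<times> 'p) set" where "Y = control_space T"
  have Y: "compact Y" unfolding Y_def by (intro compact_Times P) simp
  have T0: "0 \<le> T" using T by simp
  note aD = control_measuresD[OF \<alpha>s T0, folded Y_def]
  have scale: "integral\<^sup>L (density M (\<lambda>_. ennreal c)) \<phi> = c * integral\<^sup>L M \<phi>"
    if "sets M = sets (borel_on Y)" "0 \<le> c" "continuous_on Y \<phi>" for M c and \<phi> :: "real \<times> 'p \<Rightarrow> real"
    using borel_measurable_borel_on[OF that(1,3)] that(2) by (subst integral_density) auto
  define Ms where "Ms n = density (\<alpha>s n) (\<lambda>_. ennreal (1 / T))" for n
  have "prob_space (Ms n)" for n
  proof (rule prob_spaceI)
    have "emeasure (\<alpha>s n) Y = ennreal T"
      using finite_measure.emeasure_eq_measure[OF aD(3), of n Y] aD(4)[of n] by simp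
    moreover have "emeasure (Ms n) (space (\<alpha>s n)) = ennreal (1 / T) * emeasure (\<alpha>s n) (space (\<alpha>s n))"
      unfolding Ms_def by (rule emeasure_density_const) simp
    ultimately show "emeasure (Ms n) (space (Ms n)) = 1"
      using T by (simp add: Ms_def aD(2) ennreal_mult[symmetric])
  qed
  moreover have "sets (Ms n) = sets (borel_on Y)" for n by (simp add: Ms_def aD(1))
  ultimately obtain r M where r: "strict_mono (r::nat\<Rightarrow>nat)" and M: "prob_space M" "sets M = sets (borel_on Y)"
    and w: "weakly_converges Y (Ms \<circ> r) M"
    using weak_sequential_compactness[OF Y, of Ms] by metis
  interpret M: prob_space M by fact
  have spM: "space M = Y" by (rule space_borel_onI[OF M(2)])
  define \<alpha> where "\<alpha> = density M (\<lambda>_. ennreal T)"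
  have s\<alpha>: "sets \<alpha> = sets (borel_on Y)" by (simp add: \<alpha>_def M(2))
  have f\<alpha>: "finite_measure \<alpha>"
    by (intro finite_measureI) (simp add: \<alpha>_def emeasure_density_const M.emeasure_space_1 ennreal_mult_eq_top_iff)
  have w': "weakly_converges Y (\<alpha>s \<circ> r) \<alpha>"
    unfolding weakly_converges_def
  proof (intro allI impI)
    fix \<phi> :: "real \<times> 'p \<Rightarrow> real" assume \<phi>: "continuous_on Y \<phi>"
    have "(\<lambda>n. T * integral\<^sup>L (Ms (r n)) \<phi>) \<longlonglongrightarrow> T * integral\<^sup>L M \<phi>"
      using w \<phi> by (intro tendsto_intros) (simp add: weakly_converges_def)
    moreover have "T * integral\<^sup>L (Ms n) \<phi> = integral\<^sup>L (\<alpha>s n) \<phi>" for n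
      unfolding Ms_def using scale[OF aD(1) _ \<phi>, of "1 / T" n] T by simp
    moreover have "T * integral\<^sup>L M \<phi> = integral\<^sup>L \<alpha> \<phi>"
      unfolding \<alpha>_def using scale[OF M(2) T0 \<phi>] by simp
    ultimately show "(\<lambda>n. integral\<^sup>L ((\<alpha>s \<circ> r) n) \<phi>) \<longlonglongrightarrow> integral\<^sup>L \<alpha> \<phi>" by simp
  qed
  have "distr \<alpha> (borel_on {0..T}) fst = restrict_space lborel {0..T}"
  proof (rule measure_eqI_continuous)
    have fm: "fst \<in> measurable \<alpha> (borel_on {0..T})" by (rule fst_measurable_control[OF s\<alpha>[unfolded Y_def]])
    show "finite_measure (distr \<alpha> (borel_on {0..T}) fst)" by (rule finite_measure.finite_measure_distr[OF f\<alpha> fm])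
    show "finite_measure (restrict_space lborel {0..T})"
      by (intro finite_measureI) (simp add: emeasure_restrict_space space_restrict_space T0)
    show "sets (restrict_space lborel {0..T}) = sets (borel_on {0..T})" by (simp add: sets_restrict_space)
    fix \<phi> :: "real \<Rightarrow> real" assume \<phi>: "continuous_on {0..T} \<phi>"
    have \<phi>m: "\<phi> \<in> borel_measurable (borel_on {0..T})" by (rule borel_measurable_continuous_on_restrict[OF \<phi>])
    have "continuous_on Y (\<lambda>z. \<phi> (fst z))"
      by (rule continuous_on_compose2[OF \<phi>]) (auto simp: Y_def intro: continuous_intros)
    then have "(\<lambda>n. \<integral>z. \<phi> (fst z) \<partial>\<alpha>s (r n)) \<longlonglongrightarrow> (\<integral>z. \<phi> (fst z) \<partial>\<alpha>)"
      using w' by (simp add: weakly_converges_def)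
    then have "(\<integral>z. \<phi> (fst z) \<partial>\<alpha>) = (\<integral>t\<in>{0..T}. \<phi> t \<partial>lborel)"
      by (simp add: integral_control_measure_fst[OF \<alpha>s T0 \<phi>m] LIMSEQ_const_iff)
    then show "(\<integral>x. \<phi> x \<partial>distr \<alpha> (borel_on {0..T}) fst) = (\<integral>x. \<phi> x \<partial>restrict_space lborel {0..T})"
      by (simp add: integral_distr[OF fm \<phi>m] integral_restrict_space set_lebesgue_integral_def)
  qed simp
  then have "\<alpha> \<in> control_measures T" using control_measures_marginal[of \<alpha> T] s\<alpha> by (simp add: Y_def)
  then show thesis using that[OF r] w' by (simp add: Y_def)
qed

lemma control_measures_nonempty:
  assumes "T > 0"
  shows "control_measures T \<noteq> ({} :: (real \<times> 'p::metric_space) measure set)"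
proof -
  fix p :: 'p
  define f where "f t = (t, p)" for t :: real
  have f: "f \<in> measurable (restrict_space lborel {0..T}) (borel_on (control_space T))"
    unfolding f_def by (intro measurable_restrict_space3) (auto intro!: borel_measurable_continuous_onI continuous_intros)
  define \<alpha> where "\<alpha> = distr (restrict_space lborel {0..T}) (borel_on (control_space T)) f"
  have s: "sets \<alpha> = sets (borel_on (control_space T))" by (simp add: \<alpha>_def)
  have "distr \<alpha> (borel_on {0..T}) fst = distr (restrict_space lborel {0..T}) (borel_on {0..T}) (fst \<circ> f)"
    unfolding \<alpha>_def by (rule distr_distr[OF fst_measurable_control[OF refl] f])
  also have "\<dots> = distr (restrict_space lborel {0..T}) (restrict_space lborel {0..T}) (\<lambda>x. x)"
    by (rule distr_cong) (auto simp: f_def sets_restrict_space)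
  also have "\<dots> = restrict_space lborel {0..T}" by (rule distr_id)
  finally have "\<alpha> \<in> control_measures T" using control_measures_marginal[OF s] by simp
  then show ?thesis by blast
qed

text \<open>The code of a control measure is the sequence of its integrals against test functions.\<close>

theorem control_measures_coding:
  assumes T: "T > 0" and P: "compact (UNIV :: 'p::metric_space set)"
  obtains E and d :: "(nat \<Rightarrow> real) \<Rightarrow> (real \<times> 'p::metric_space) measure" and c where
    "compact E" "E \<noteq> {}" "\<And>a. a \<in> E \<Longrightarrow> d a \<in> control_measures T"
    "\<And>\<alpha>. \<alpha> \<in> control_measures T \<Longrightarrow> c \<alpha> \<in> E" "\<And>\<alpha>. \<alpha> \<in> control_measures T \<Longrightarrow> d (c \<alpha>) = \<alpha>"
    "\<And>a. a \<in> E \<Longrightarrow> c (d a) = a"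
    "\<And>(as :: nat \<Rightarrow> nat \<Rightarrow> real) a. (\<And>n. as n \<in> E) \<Longrightarrow> a \<in> E \<Longrightarrow> as \<longlonglongrightarrow> a \<Longrightarrow> weakly_converges (control_space T) (\<lambda>n. d (as n)) (d a)"
    "continuous_map (top_of_set E) (control_topology T) d"
    "continuous_map (control_topology T) euclidean c"
proof -
  define Y :: "(real \<times> 'p) set" where "Y = control_space T"
  define U :: "(real \<times> 'p) measure set" where "U = control_measures T"
  have Y: "compact Y" unfolding Y_def by (intro compact_Times P) simp
  have T0: "0 \<le> T" using T by simp
  have Y0: "Y \<noteq> {}" using T by (auto simp: Y_def)
  have aD: "sets \<alpha> = sets (borel_on Y)" "finite_measure \<alpha>" "measure \<alpha> Y = T" if "\<alpha> \<in> U" for \<alpha>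
    using control_measuresD[OF _ T0, of \<alpha>] that by (auto simp: U_def Y_def)
  obtain \<psi> :: "nat \<Rightarrow> real \<times> 'p \<Rightarrow> real" where c\<psi>: "\<And>n. continuous_on Y (\<psi> n)"
    and det: "\<And>Ms M C. \<lbrakk>finite_measure M; sets M = sets (borel_on Y); measure M Y \<le> C;
      \<And>k. finite_measure (Ms k); \<And>k. sets (Ms k) = sets (borel_on Y); \<And>k. measure (Ms k) Y \<le> C;
      \<And>n. (\<lambda>k. \<integral>x. \<psi> n x \<partial>Ms k) \<longlonglongrightarrow> (\<integral>x. \<psi> n x \<partial>M)\<rbrakk> \<Longrightarrow> weakly_converges Y Ms M"
  proof (rule countable_test_functions[OF Y Y0])
    fix \<psi> :: "nat \<Rightarrow> real \<times> 'p \<Rightarrow> real"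
    assume 1: "\<And>n. continuous_on Y (\<psi> n)"
      and 2: "\<And>Ms M C. \<lbrakk>finite_measure M; sets M = sets (borel_on Y); measure M Y \<le> C;
        \<And>k. finite_measure (Ms k); \<And>k. sets (Ms k) = sets (borel_on Y); \<And>k. measure (Ms k) Y \<le> C;
        \<And>n. (\<lambda>k. \<integral>x. \<psi> n x \<partial>Ms k) \<longlonglongrightarrow> (\<integral>x. \<psi> n x \<partial>M)\<rbrakk> \<Longrightarrow> weakly_converges Y Ms M"
    show thesis by (rule that[OF 1 2])
  qed
  define c where "c \<alpha> n = (\<integral>z. \<psi> n z \<partial>\<alpha>)" for \<alpha> n
  have det': "weakly_converges Y \<alpha>s \<alpha>" if "\<And>n. \<alpha>s n \<in> U" "\<alpha> \<in> U" "(\<lambda>n. c (\<alpha>s n)) \<longlonglongrightarrow> c \<alpha>" for \<alpha>s \<alpha>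
    using that by (intro det[where C=T]) (auto simp: aD tendsto_fun_iff c_def)
  \<comment> \<open>Equal codes make the constant sequence \<alpha> converge weakly to \<beta>, so
    that continuous functions cannot tell the two measures apart.\<close>
  have inj: "inj_on c U"
  proof (rule inj_onI)
    fix \<alpha> \<beta> assume ab: "\<alpha> \<in> U" "\<beta> \<in> U" and eq: "c \<alpha> = c \<beta>"
    have "weakly_converges Y (\<lambda>_. \<alpha>) \<beta>" using ab eq by (intro det') auto
    then show "\<alpha> = \<beta>"
      using ab by (intro measure_eqI_continuous[of \<alpha> Y]) (auto simp: aD weakly_converges_def LIMSEQ_const_iff)
  qed
  define E where "E = c ` U"
  define d where "d = inv_into U c"
  have dU: "d a \<in> U" and cd: "c (d a) = a" if "a \<in> E" for a
    using that by (auto simp: E_def d_def inv_into_into f_inv_into_f)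
  have dc: "d (c \<alpha>) = \<alpha>" if "\<alpha> \<in> U" for \<alpha> using that inj by (simp add: d_def)
  have "compact E"
    unfolding compact_eq_seq_compact_metric seq_compact_def
  proof (intro allI impI)
    fix as :: "nat \<Rightarrow> nat \<Rightarrow> real" assume as: "\<forall>n. as n \<in> E"
    obtain r \<alpha> where r: "strict_mono (r::nat\<Rightarrow>nat)" and \<alpha>: "\<alpha> \<in> U" and w: "weakly_converges Y ((\<lambda>n. d (as n)) \<circ> r) \<alpha>"
      using control_measures_weak_compact[OF T P, of "\<lambda>n. d (as n)"] dU as unfolding U_def Y_def by blast
    have "(as \<circ> r) \<longlonglongrightarrow> c \<alpha>"
      unfolding tendsto_fun_iff
    proof
      fix n
      have "(\<lambda>k. c (d (as (r k))) n) \<longlonglongrightarrow> c \<alpha> n"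
        using w c\<psi>[of n] by (simp add: weakly_converges_def c_def)
      then show "(\<lambda>k. (as \<circ> r) k n) \<longlonglongrightarrow> c \<alpha> n" using cd as by simp
    qed
    then show "\<exists>l\<in>E. \<exists>r. strict_mono r \<and> (as \<circ> r) \<longlonglongrightarrow> l" using r \<alpha> by (auto simp: E_def)
  qed
  have wd: "weakly_converges Y (\<lambda>n. d (as n)) (d a)" if "\<And>n. as n \<in> E" "a \<in> E" "as \<longlonglongrightarrow> a" for as :: "nat \<Rightarrow> nat \<Rightarrow> real" and a
    using that dU cd by (intro det') auto
  have top: "prod_topology (top_of_set {0..T}) (euclidean :: 'p topology) = top_of_set Y"
    unfolding Y_def by (rule prod_topology_control_space)
  \<comment> \<open>It suffices to treat the generating sets of the weak topology, and on the metric
    space \<open>E\<close> continuity of an integral can be checked along sequences.\<close>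
  have "continuous_map (top_of_set E) (control_topology T) d"
    unfolding control_topology_def weak_topology_def top U_def[symmetric]
  proof (rule continuous_on_generated_topo)
    fix W assume "W \<in> {{\<kappa> \<in> U. (\<integral>z. \<phi> z \<partial>\<kappa>) \<in> V} |\<phi> V. continuous_map (top_of_set Y) euclideanreal \<phi> \<and> bounded (\<phi> ` topspace (top_of_set Y)) \<and> open V}"
    then have "\<exists>\<phi> V. W = {\<kappa> \<in> U. (\<integral>z. \<phi> z \<partial>\<kappa>) \<in> V} \<and> continuous_map (top_of_set Y) euclideanreal \<phi> \<and> bounded (\<phi> ` topspace (top_of_set Y)) \<and> open V"
      by (rule CollectD)
    then obtain \<phi> V where W: "W = {\<kappa> \<in> U. (\<integral>z. \<phi> z \<partial>\<kappa>) \<in> V}"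
      and "continuous_map (top_of_set Y) euclideanreal \<phi>" and V: "open V" by blast
    then have \<phi>: "continuous_on Y \<phi>" by simp
    have "continuous_on E (\<lambda>a. \<integral>z. \<phi> z \<partial>d a)"
      unfolding continuous_on_sequentially
    proof (intro allI ballI impI, elim conjE)
      fix as a assume "a \<in> E" "\<forall>n. as n \<in> E" "as \<longlonglongrightarrow> a"
      then have "weakly_converges Y (\<lambda>n. d (as n)) (d a)" by (intro wd) auto
      then show "((\<lambda>a. \<integral>z. \<phi> z \<partial>d a) \<circ> as) \<longlonglongrightarrow> (\<integral>z. \<phi> z \<partial>d a)"
        using \<phi> by (simp add: weakly_converges_def o_def)
    qed
    then have "openin (top_of_set E) (E \<inter> (\<lambda>a. \<integral>z. \<phi> z \<partial>d a) -` V)"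
      using V by (rule continuous_openin_preimage_gen)
    moreover have "E \<inter> (\<lambda>a. \<integral>z. \<phi> z \<partial>d a) -` V = d -` W \<inter> topspace (top_of_set E)" using dU by (auto simp: W)
    ultimately show "openin (top_of_set E) (d -` W \<inter> topspace (top_of_set E))" by simp
  next
    have "U \<in> {{\<kappa> \<in> U. (\<integral>z. \<phi> z \<partial>\<kappa>) \<in> V} |\<phi> V. continuous_map (top_of_set Y) euclideanreal \<phi> \<and> bounded (\<phi> ` topspace (top_of_set Y)) \<and> open V}"
      by (rule CollectI, rule exI[of _ "\<lambda>_. 0"], rule exI[of _ UNIV]) (auto simp: bounded_iff intro!: exI[of _ 0])
    moreover have "d ` topspace (top_of_set E) \<subseteq> U" using dU by auto
    ultimately show "d ` topspace (top_of_set E) \<subseteq> \<Union> {{\<kappa> \<in> U. (\<integral>z. \<phi> z \<partial>\<kappa>) \<in> V} |\<phi> V. continuous_map (top_of_set Y) euclideanreal \<phi> \<and> bounded (\<phi> ` topspace (top_of_set Y)) \<and> open V}"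
      by (meson Union_upper order_trans)
  qed
  moreover have "continuous_map (control_topology T) euclidean c"
  proof -
    \<comment> \<open>Each coordinate integrates a single continuous test, bounded by compactness;
      the preimages of open sets are thus generators of the weak topology.\<close>
    have "continuous_map (control_topology T) euclideanreal (\<lambda>\<alpha>. c \<alpha> n)" for n
      unfolding continuous_map_def
    proof (intro conjI allI impI)
      fix V :: "real set" assume "openin euclidean V"
      moreover have "bounded (\<psi> n ` Y)" using Y c\<psi> by (intro compact_imp_bounded compact_continuous_image)
      ultimately have "{\<kappa> \<in> U. (\<integral>z. \<psi> n z \<partial>\<kappa>) \<in> V} \<in> {{\<kappa> \<in> U. (\<integral>z. \<phi> z \<partial>\<kappa>) \<in> V} |\<phi> V. continuous_map (top_of_set Y) euclideanreal \<phi> \<and> bounded (\<phi> ` topspace (top_of_set Y)) \<and> open V}"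
        using c\<psi>[of n] by auto
      then have "openin (control_topology T) {\<kappa> \<in> U. (\<integral>z. \<psi> n z \<partial>\<kappa>) \<in> V}"
        unfolding control_topology_def weak_topology_def top U_def[symmetric] by (rule topology_generated_by_Basis)
      then show "openin (control_topology T) {\<alpha> \<in> topspace (control_topology T). c \<alpha> n \<in> V}"
        by (simp add: c_def U_def)
    qed simp
    then have "continuous_map (control_topology T) (product_topology (\<lambda>_. euclideanreal) UNIV) c"
      by (simp add: continuous_map_componentwise_UNIV)
    then show ?thesis by (simp add: euclidean_product_topology)
  qed
  moreover have "E \<noteq> {}" using control_measures_nonempty[OF T] by (auto simp: E_def U_def)
  moreover have "c \<alpha> \<in> E" if "\<alpha> \<in> control_measures T" for \<alpha> using that by (simp add: E_def U_def)
  ultimately show thesis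
    using that[of E d c] \<open>compact E\<close> dU cd dc wd unfolding U_def Y_def by blast
qed

section \<open>Trajectories\<close>

text \<open>Shared by two successive approximations, that of a trajectory and that of the flow of a
  process; the index is a time in the former and a time paired with a point of the player space in
  the latter.\<close>

lemma geometric_uniform_limit:
  fixes X :: "nat \<Rightarrow> 'i \<Rightarrow> 'a::banach"
  assumes K: "0 \<le> K" and X: "\<And>k i. i \<in> S \<Longrightarrow> norm (X (Suc k) i - X k i) \<le> K * (1/2)^k"
  obtains l where "uniform_limit S X l sequentially"
proof -
  have "summable (\<lambda>k. K * (1/2)^k)" by (intro summable_mult summable_geometric) simp
  then have "uniform_limit S (\<lambda>n i. \<Sum>k<n. X (Suc k) i - X k i) (\<lambda>i. \<Sum>k. X (Suc k) i - X k i) sequentially"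
    using X by (intro Weierstrass_m_test) auto
  moreover have "(\<Sum>k<n. X (Suc k) i - X k i) = X n i - X 0 i" for n i
    using sum_lessThan_telescope[of "\<lambda>k. X k i" n] by simp
  ultimately have "uniform_limit S (\<lambda>n i. X n i - X 0 i) (\<lambda>i. \<Sum>k. X (Suc k) i - X k i) sequentially"
    by simp
  moreover have "uniform_limit S (\<lambda>n. X 0) (X 0) sequentially" by (rule uniform_limitI) auto
  ultimately
  have "uniform_limit S (\<lambda>n i. (X n i - X 0 i) + X 0 i) (\<lambda>i. (\<Sum>k. X (Suc k) i - X k i) + X 0 i) sequentially"
    by (rule uniform_limit_add)
  then have "uniform_limit S X (\<lambda>i. (\<Sum>k. X (Suc k) i - X k i) + X 0 i) sequentially"
    by simp
  then show thesis by (rule that)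
qed

lemma cylinder_measurable:
  fixes \<alpha> :: "(real \<times> 'p::metric_space) measure"
  assumes "sets \<alpha> = sets (borel_on (control_space T))" "closed A" "A \<subseteq> {0..T}"
  shows "A \<times> UNIV \<in> sets \<alpha>"
proof -
  have "closed (A \<times> (UNIV :: 'p set))" "closed (control_space T :: (real \<times> 'p) set)"
    using assms(2) by (auto intro: closed_Times)
  then show ?thesis
    unfolding assms(1) using assms(3) by (subst sets_restrict_space_iff) (auto intro: borel_closed)
qed

lemma set_integrable_control:
  fixes h :: "real \<times> 'p::metric_space \<Rightarrow> 'a::{banach, second_countable_topology}"
  assumes "\<alpha> \<in> control_measures T" "compact (UNIV :: 'p set)" "t \<in> {0..T}" "continuous_on (control_space T) h"
  shows "set_integrable \<alpha> ({0..t} \<times> UNIV) h"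
proof -
  have T: "0 \<le> T" using assms by simp
  note aD = control_measuresD[OF assms(1) T]
  have "compact (control_space T :: (real \<times> 'p) set)" using assms(2) by (intro compact_Times) auto
  then have "integrable \<alpha> h" by (rule integrable_continuous_on_compact[OF aD(3,1) _ assms(4)])
  then show ?thesis
    unfolding set_integrable_def using assms aD by (intro integrable_mult_indicator cylinder_measurable[of _ T]) auto
qed

text \<open>The time marginal is Lebesgue measure whatever the control, so the bound comes from the
  integral of \<open>K * exp (c * \<tau>)\<close> over \<open>{0..t}\<close>. The factor
  \<open>1 / c\<close> gained here is what makes the integral operator contract for large
  \<open>c\<close>.\<close>

lemma norm_control_integral_le:
  fixes h :: "real \<times> 'p::metric_space \<Rightarrow> 'a::{banach, second_countable_topology}"
  assumes \<alpha>: "\<alpha> \<in> control_measures T" and t: "t \<in> {0..T}" and c: "0 < c" and K: "0 \<le> K"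
    and h: "\<And>\<tau> u. \<tau> \<in> {0..t} \<Longrightarrow> norm (h (\<tau>, u)) \<le> K * exp (c * \<tau>)"
  shows "norm (LINT z:({0..t} \<times> UNIV)|\<alpha>. h z) \<le> K / c * exp (c * t)"
proof (cases "set_integrable \<alpha> ({0..t} \<times> UNIV) h")
  \<comment> \<open>Without integrability the integral is 0 by convention, and the bound is
    nonnegative.\<close>
  case False
  then show ?thesis using c K by (simp add: set_integrable_def set_lebesgue_integral_def not_integrable_integral_eq)
next
  case True
  have T: "0 \<le> T" using t by simp
  note aD = control_measuresD[OF \<alpha> T]
  interpret \<alpha>: finite_measure \<alpha> by (rule aD(3))
  define k where "k \<tau> = indicator {0..t} \<tau> * (K * exp (c * \<tau>))" for \<tau> :: real
  have km: "k \<in> borel_measurable borel" unfolding k_def by measurable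
  then have km': "k \<in> borel_measurable (borel_on {0..T})" by (rule measurable_restrict_space1)
  have kb: "norm (k \<tau>) \<le> K * exp (c * t)" for \<tau>
    using c K by (auto simp: k_def indicator_def mult_left_mono)
  have ik: "integrable \<alpha> (\<lambda>z. k (fst z))"
    using measurable_compose[OF fst_measurable_control[OF aD(1)] km'] kb
    by (intro \<alpha>.integrable_const_bound[where B="K * exp (c * t)"]) auto
  have "norm (LINT z:({0..t} \<times> UNIV)|\<alpha>. h z) \<le> (\<integral>z. norm (indicator ({0..t} \<times> UNIV) z *\<^sub>R h z) \<partial>\<alpha>)"
    unfolding set_lebesgue_integral_def by (rule integral_norm_bound)
  also have "\<dots> \<le> (\<integral>z. k (fst z) \<partial>\<alpha>)"
  proof (rule integral_mono)
    show "integrable \<alpha> (\<lambda>z. norm (indicator ({0..t} \<times> UNIV) z *\<^sub>R h z))"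
      using True by (intro integrable_norm) (simp add: set_integrable_def)
    show "norm (indicator ({0..t} \<times> UNIV) z *\<^sub>R h z) \<le> k (fst z)" for z
      using h[of "fst z" "snd z"] by (auto simp: k_def indicator_def mem_Times_iff)
  qed (rule ik)
  also have "\<dots> = (\<integral>\<tau>\<in>{0..T}. k \<tau> \<partial>lborel)" by (rule integral_control_measure_fst[OF \<alpha> T km'])
  also have "\<dots> = (\<integral>\<tau>. (K * exp (c * \<tau>)) * indicator {0..t} \<tau> \<partial>lborel)"
    unfolding set_lebesgue_integral_def using t
    by (intro Bochner_Integration.integral_cong) (auto simp: k_def indicator_def)
  also have "\<dots> = K / c * exp (c * t) - K / c * exp (c * 0)"
    using t c by (intro integral_FTC_Icc_real)
      (auto intro!: derivative_eq_intros continuous_intros simp: has_real_derivative_iff_has_vector_derivative[symmetric])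
  also have "\<dots> \<le> K / c * exp (c * t)" using c K by simp
  finally show ?thesis .
qed

text \<open>The cut-off at time \<open>t\<close> is not continuous, but since the time marginal is Lebesgue measure it may be
  replaced by a piecewise linear one.\<close>

lemma control_integral_uniform_convergence:
  fixes h :: "real \<times> 'p::metric_space \<Rightarrow> 'a::{banach, second_countable_topology}"
  assumes P: "compact (UNIV :: 'p set)" and T: "0 < T"
    and \<alpha>: "\<alpha> \<in> control_measures T" "\<And>n. \<alpha>s n \<in> control_measures T" "weakly_converges (control_space T) \<alpha>s \<alpha>"
    and h: "continuous_on (control_space T) h" and e: "e > 0"
  shows "\<forall>\<^sub>F n in sequentially. \<forall>t\<in>{0..T}.
    norm ((LINT z:({0..t} \<times> UNIV)|\<alpha>s n. h z) - (LINT z:({0..t} \<times> UNIV)|\<alpha>. h z)) < e"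
proof -
  let ?Y = "control_space T :: (real \<times> 'p) set"
  have Y: "compact ?Y" using P by (intro compact_Times) auto
  have T0: "0 \<le> T" using T by simp
  note aD = control_measuresD[OF \<alpha>(1) T0] and asD = control_measuresD[OF \<alpha>(2) T0]
  have "bounded (h ` ?Y)" using Y h by (intro compact_imp_bounded compact_continuous_image)
  then obtain B0 where B0: "\<And>z. z \<in> ?Y \<Longrightarrow> norm (h z) \<le> B0" by (auto simp: bounded_iff)
  define B where "B = max 1 B0"
  have B: "B > 0" "\<And>z. z \<in> ?Y \<Longrightarrow> norm (h z) \<le> B"
    using B0 by (auto simp: B_def intro: order_trans[OF _ max.cobounded2])
  \<comment> \<open>Exchanging the cut-off for a ramp costs at most
    \<open>B * \<delta> = e / 4\<close> for each of the two measures; the comparison of the ramp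
    integrals takes the remaining \<open>e / 2\<close>.\<close>
  define \<delta> where "\<delta> = e / (4 * B)"
  have \<delta>: "\<delta> > 0" "B * \<delta> = e / 4" using e B by (auto simp: \<delta>_def)
  \<comment> \<open>The ramp falls from 1 at \<open>t\<close> to 0 at \<open>t + \<delta>\<close>.
    Its slope does not depend on \<open>t\<close>, so the products with \<open>h\<close> are
    equicontinuous and their integrals converge uniformly in \<open>t\<close>.\<close>
  define \<rho> where "\<rho> t \<tau> = max 0 (min 1 (1 - (\<tau> - t) / \<delta>))" for t \<tau> :: real
  have \<rho>01: "0 \<le> \<rho> t \<tau>" "\<rho> t \<tau> \<le> 1" for t \<tau> by (auto simp: \<rho>_def)
  have \<rho>1: "\<rho> t \<tau> = 1" if "\<tau> \<le> t" for t \<tau> using that \<delta> by (simp add: \<rho>_def divide_le_0_iff)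
  have \<rho>0: "\<rho> t \<tau> = 0" if "t + \<delta> \<le> \<tau>" for t \<tau>
  proof -
    have "1 \<le> (\<tau> - t) / \<delta>" using that \<delta> by (simp add: field_simps)
    then show ?thesis by (simp add: \<rho>_def)
  qed
  have \<rho>lip: "\<bar>\<rho> t \<tau> - \<rho> t \<tau>'\<bar> \<le> \<bar>\<tau> - \<tau>'\<bar> / \<delta>" for t \<tau> \<tau>'
  proof -
    have "\<bar>\<rho> t \<tau> - \<rho> t \<tau>'\<bar> \<le> \<bar>(1 - (\<tau> - t) / \<delta>) - (1 - (\<tau>' - t) / \<delta>)\<bar>"
      unfolding \<rho>_def by linarith
    also have "(1 - (\<tau> - t) / \<delta>) - (1 - (\<tau>' - t) / \<delta>) = (\<tau>' - \<tau>) / \<delta>"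
      by (simp add: diff_divide_distrib)
    finally show ?thesis using \<delta> by (simp add: abs_minus_commute)
  qed
  have \<rho>c: "continuous_on ?Y (\<lambda>z. \<rho> t (fst z) *\<^sub>R h z)" for t
    unfolding \<rho>_def using \<delta> by (intro continuous_intros h) auto
  define H where "H = (\<lambda>t z. \<rho> t (fst z) *\<^sub>R h z) ` {0..T}"
  have ev: "\<forall>\<^sub>F n in sequentially. \<forall>k\<in>H. norm ((\<integral>z. k z \<partial>\<alpha>s n) - (\<integral>z. k z \<partial>\<alpha>)) < e / 2"
  proof (rule weakly_converges_uniform[OF Y aD(3,1) _ asD(3,1) _ \<alpha>(3), where C=T])
    show "measure \<alpha> ?Y \<le> T" "measure (\<alpha>s n) ?Y \<le> T" for n using aD(4) asD(4) by auto
    show "norm (k z) \<le> B" if k: "k \<in> H" and "z \<in> ?Y" for k z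
    proof -
      obtain t where "k = (\<lambda>z. \<rho> t (fst z) *\<^sub>R h z)" using k by (auto simp: H_def)
      then have "norm (k z) = \<rho> t (fst z) * norm (h z)" using \<rho>01 by simp
      also have "\<dots> \<le> 1 * B" using \<rho>01 B that by (intro mult_mono) auto
      finally show ?thesis by simp
    qed
    fix \<epsilon> :: real assume \<epsilon>: "\<epsilon> > 0"
    have "uniformly_continuous_on ?Y h" using Y h by (rule compact_uniformly_continuous[rotated])
    then obtain d where d: "d > 0" "\<And>x y. x \<in> ?Y \<Longrightarrow> y \<in> ?Y \<Longrightarrow> dist y x < d \<Longrightarrow> dist (h y) (h x) < \<epsilon> / 2"
      unfolding uniformly_continuous_on_def using \<epsilon> by (metis half_gt_zero)
    define d' where "d' = min d (\<epsilon> / 2 * \<delta> / B)"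
    have d': "d' > 0" using d \<epsilon> \<delta> B by (simp add: d'_def)
    have "norm (\<rho> t (fst x) *\<^sub>R h x - \<rho> t (fst y) *\<^sub>R h y) \<le> \<epsilon>" if x: "x \<in> ?Y" and y: "y \<in> ?Y" and xy: "dist x y < d'" for t x y
    proof -
      have "\<rho> t (fst x) *\<^sub>R h x - \<rho> t (fst y) *\<^sub>R h y
          = \<rho> t (fst x) *\<^sub>R (h x - h y) + (\<rho> t (fst x) - \<rho> t (fst y)) *\<^sub>R h y"
        by (simp add: algebra_simps)
      also have "norm \<dots> \<le> norm (\<rho> t (fst x) *\<^sub>R (h x - h y)) + norm ((\<rho> t (fst x) - \<rho> t (fst y)) *\<^sub>R h y)"
        by (rule norm_triangle_ineq)
      also have "norm (\<rho> t (fst x) *\<^sub>R (h x - h y)) \<le> 1 * (\<epsilon> / 2)"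
        unfolding norm_scaleR using \<rho>01 d(2)[OF y x] xy \<epsilon> by (intro mult_mono) (auto simp: d'_def dist_norm)
      also have "norm ((\<rho> t (fst x) - \<rho> t (fst y)) *\<^sub>R h y) \<le> (\<epsilon> / 2 / B) * B"
        unfolding norm_scaleR
      proof (rule mult_mono)
        have "\<bar>fst x - fst y\<bar> \<le> dist x y" using dist_fst_le[of x y] by (simp add: dist_real_def)
        then have "\<bar>fst x - fst y\<bar> / \<delta> \<le> (\<epsilon> / 2 * \<delta> / B) / \<delta>"
          using xy \<delta> by (intro divide_right_mono) (auto simp: d'_def)
        also have "\<dots> = \<epsilon> / 2 / B" using \<delta> by simp
        finally show "\<bar>\<rho> t (fst x) - \<rho> t (fst y)\<bar> \<le> \<epsilon> / 2 / B" using \<rho>lip order_trans by blast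
      qed (use B y \<epsilon> in auto)
      finally show ?thesis using B by simp
    qed
    then show "\<exists>\<delta>>0. \<forall>k\<in>H. \<forall>x\<in>?Y. \<forall>y\<in>?Y. dist x y < \<delta> \<longrightarrow> norm (k x - k y) \<le> \<epsilon>"
      using d' unfolding H_def by blast
  qed (use e in auto)
  have cut: "norm ((LINT z:({0..t} \<times> UNIV)|\<beta>. h z) - (\<integral>z. \<rho> t (fst z) *\<^sub>R h z \<partial>\<beta>)) \<le> e / 4"
    if \<beta>: "\<beta> \<in> control_measures T" and t: "t \<in> {0..T}" for \<beta> t
  proof -
    note bD = control_measuresD[OF \<beta> T0]
    interpret \<beta>: finite_measure \<beta> by (rule bD(3))
    have i1: "integrable \<beta> (\<lambda>z. indicator ({0..t} \<times> UNIV) z *\<^sub>R h z)"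
      using set_integrable_control[OF \<beta> P t h] by (simp add: set_integrable_def)
    have i2: "integrable \<beta> (\<lambda>z. \<rho> t (fst z) *\<^sub>R h z)" by (rule integrable_continuous_on_compact[OF bD(3,1) Y \<rho>c])
    have km: "(\<lambda>\<tau>. B * indicator {t..t + \<delta>} \<tau>) \<in> borel_measurable (borel_on {0..T})"
      by (rule measurable_restrict_space1) measurable
    have i3: "integrable \<beta> (\<lambda>z. B * indicator {t..t + \<delta>} (fst z))"
      using measurable_compose[OF fst_measurable_control[OF bD(1)] km] B(1)
      by (intro \<beta>.integrable_const_bound[where B=B]) (auto simp: indicator_def)
    have "norm ((LINT z:({0..t} \<times> UNIV)|\<beta>. h z) - (\<integral>z. \<rho> t (fst z) *\<^sub>R h z \<partial>\<beta>))
        = norm (\<integral>z. indicator ({0..t} \<times> UNIV) z *\<^sub>R h z - \<rho> t (fst z) *\<^sub>R h z \<partial>\<beta>)"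
      unfolding set_lebesgue_integral_def using i1 i2 by simp
    also have "\<dots> \<le> (\<integral>z. norm (indicator ({0..t} \<times> UNIV) z *\<^sub>R h z - \<rho> t (fst z) *\<^sub>R h z) \<partial>\<beta>)" by (rule integral_norm_bound)
    also have "\<dots> \<le> (\<integral>z. B * indicator {t..t + \<delta>} (fst z) \<partial>\<beta>)"
    proof (rule integral_mono[OF _ i3])
      show "integrable \<beta> (\<lambda>z. norm (indicator ({0..t} \<times> UNIV) z *\<^sub>R h z - \<rho> t (fst z) *\<^sub>R h z))"
        using i1 i2 by (intro integrable_norm Bochner_Integration.integrable_diff)
      fix z assume "z \<in> space \<beta>"
      then have z: "z \<in> ?Y" using bD(2) by simp
      show "norm (indicator ({0..t} \<times> UNIV) z *\<^sub>R h z - \<rho> t (fst z) *\<^sub>R h z) \<le> B * indicator {t..t + \<delta>} (fst z)"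
      proof (cases "fst z \<le> t")
        case True
        then have "indicator ({0..t} \<times> UNIV) z = (1::real)" using z by (auto simp: indicator_def mem_Times_iff)
        then show ?thesis using \<rho>1[OF True] B(1) by (auto simp: indicator_def)
      next
        case False
        then have i: "indicator ({0..t} \<times> UNIV) z = (0::real)" by (auto simp: indicator_def mem_Times_iff)
        show ?thesis
        proof (cases "t + \<delta> \<le> fst z")
          case True
          then show ?thesis using \<rho>0[OF True] i B(1) by (auto simp: indicator_def)
        next
          case False
          have "\<rho> t (fst z) * norm (h z) \<le> 1 * B" using \<rho>01 B z by (intro mult_mono) auto
          then show ?thesis using False \<open>\<not> fst z \<le> t\<close> i \<rho>01 by (simp add: indicator_def)
        qed
      qed
    qed
    also have "\<dots> = (\<integral>\<tau>\<in>{0..T}. B * indicator {t..t + \<delta>} \<tau> \<partial>lborel)"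
      by (rule integral_control_measure_fst[OF \<beta> T0 km])
    also have "\<dots> \<le> (\<integral>\<tau>. B * indicator {t..t + \<delta>} \<tau> \<partial>lborel)"
      unfolding set_lebesgue_integral_def
    proof (rule integral_mono)
      show i: "integrable lborel (\<lambda>\<tau>. B * indicator {t..t + \<delta>} \<tau> :: real)"
        by (intro integrable_mult_right integrable_real_indicator) (auto simp: \<delta>(1) less_imp_le)
      show "integrable lborel (\<lambda>\<tau>. indicator {0..T} \<tau> *\<^sub>R (B * indicator {t..t + \<delta>} \<tau>))"
        by (rule integrable_mult_indicator[OF _ i]) simp
      show "indicator {0..T} \<tau> *\<^sub>R (B * indicator {t..t + \<delta>} \<tau>) \<le> B * indicator {t..t + \<delta>} \<tau>" for \<tau>
        using B(1) by (auto simp: indicator_def)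
    qed
    also have "\<dots> = B * \<delta>" using \<delta> by simp
    finally show ?thesis using \<delta> by simp
  qed
  from ev show ?thesis
  proof eventually_elim
    case (elim n)
    show ?case
    proof
      fix t assume t: "t \<in> {0..T}"
      let ?k = "\<lambda>z. \<rho> t (fst z) *\<^sub>R h z"
      have "norm ((\<integral>z. ?k z \<partial>\<alpha>s n) - (\<integral>z. ?k z \<partial>\<alpha>)) < e / 2" using elim t by (auto simp: H_def)
      moreover note cut[OF \<alpha>(1) t] cut[OF \<alpha>(2)[of n] t]
      ultimately show "norm ((LINT z:({0..t} \<times> UNIV)|\<alpha>s n. h z) - (LINT z:({0..t} \<times> UNIV)|\<alpha>. h z)) < e"
        by norm
    qed
  qed
qed

section \<open>The flow in a given external field\<close>

locale mean_field_dynamics =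
  fixes T L M :: real and f :: "real \<Rightarrow> 'a \<Rightarrow> 'a prob1 \<Rightarrow> 'p::metric_space \<Rightarrow> 'a::euclidean_space"
  assumes T: "0 < T" and P: "compact (UNIV :: 'p set)"
    and f_cont: "continuous_on ({0..T} \<times> UNIV) (\<lambda>(t, x, m, u). f t x m u)"
    and f_x: "\<And>t x' x'' m u. t \<in> {0..T} \<Longrightarrow> norm (f t x' m u - f t x'' m u) \<le> L * norm (x' - x'')"
    and f_m: "\<And>t x m' m'' u. t \<in> {0..T} \<Longrightarrow> norm (f t x m' u - f t x m'' u) \<le> M * dist m' m''"
    and L0: "0 \<le> L" and M0: "0 \<le> M"
begin

text \<open>In the weighted norm \<open>sup\<^sub>t exp (- c * t) * norm (x t)\<close> the integral operator contracts.\<close>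

definition "c = 2 * L + 4 * M + 1"

text \<open>These inequalities dictate the value of \<open>c\<close>. The bound 1/2 is the
  contraction in the trajectory; the bound 1/4, doubled by \<open>weighted_comparison\<close>,
  leaves a factor 1/2 for the dependence on the field, as needed for a second contraction. The
  summand 1 keeps \<open>c\<close> positive.\<close>

lemma weight: "0 < c" "L / c \<le> 1 / 2" "M / c \<le> 1 / 4"
  using L0 M0 by (auto simp: c_def field_simps)

abbreviation "Y \<equiv> control_space T :: (real \<times> 'p) set"
abbreviation "U \<equiv> control_measures T :: (real \<times> 'p) measure set"

definition "F \<mu> x z = f (fst z) (x (fst z)) (\<mu> (fst z)) (snd z)"

lemma compact_Y: "compact Y"
  using P by (intro compact_Times) auto

lemma F_continuous:
  assumes "\<mu> \<in> external_fields T" "continuous_on {0..T} x"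
  shows "continuous_on Y (F \<mu> x)"
proof -
  have "continuous_on Y (\<lambda>z. \<mu> (fst z))" "continuous_on Y (\<lambda>z. x (fst z))"
    using assms by (auto simp: external_fields_def intro!: continuous_on_compose2[OF _ continuous_on_fst[OF continuous_on_id]])
  then have "continuous_on Y (\<lambda>z. (fst z, x (fst z), \<mu> (fst z), snd z))"
    by (intro continuous_on_Pair continuous_on_fst continuous_on_snd continuous_on_id)
  moreover have "(\<lambda>z. (fst z, x (fst z), \<mu> (fst z), snd z)) ` Y \<subseteq> {0..T} \<times> UNIV" by auto
  ultimately have "continuous_on Y (\<lambda>z. case (fst z, x (fst z), \<mu> (fst z), snd z) of (t, x, m, u) \<Rightarrow> f t x m u)"
    by (rule continuous_on_compose2[OF f_cont])
  then show ?thesis by (simp add: F_def[abs_def])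
qed

lemma F_integrable:
  "\<alpha> \<in> U \<Longrightarrow> \<mu> \<in> external_fields T \<Longrightarrow> continuous_on {0..T} x \<Longrightarrow> t \<in> {0..T} \<Longrightarrow>
    set_integrable \<alpha> ({0..t} \<times> UNIV) (F \<mu> x)"
  by (rule set_integrable_control[OF _ P _ F_continuous])

lemma is_trajectory_iff:
  "is_trajectory T f \<xi> \<alpha> \<mu> x \<longleftrightarrow> x \<in> extensional {0..T} \<and> continuous_on {0..T} x \<and>
    (\<forall>t\<in>{0..T}. x t = \<xi> + (LINT z:({0..t} \<times> UNIV)|\<alpha>. F \<mu> x z))"
  unfolding is_trajectory_def F_def by (simp add: case_prod_unfold)

text \<open>A form of Gronwall's inequality, applied to the least admissible \<open>R\<close>.\<close>

lemma weighted_comparison: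
  fixes D :: "real \<Rightarrow> real"
  assumes D: "continuous_on {0..T} D" "\<And>t. t \<in> {0..T} \<Longrightarrow> 0 \<le> D t"
    and step: "\<And>R t. 0 \<le> R \<Longrightarrow> (\<And>\<tau>. \<tau> \<in> {0..T} \<Longrightarrow> D \<tau> \<le> R * exp (c * \<tau>)) \<Longrightarrow> t \<in> {0..T} \<Longrightarrow>
      D t \<le> (A + R / 2) * exp (c * t)"
    and t: "t \<in> {0..T}"
  shows "D t \<le> 2 * A * exp (c * t)"
proof -
  have "continuous_on {0..T} (\<lambda>\<tau>. D \<tau> / exp (c * \<tau>))" by (intro continuous_intros D) auto
  then obtain t0 where t0: "t0 \<in> {0..T}" "\<And>\<tau>. \<tau> \<in> {0..T} \<Longrightarrow> D \<tau> / exp (c * \<tau>) \<le> D t0 / exp (c * t0)"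
    using continuous_attains_sup[of "{0..T}" "\<lambda>\<tau>. D \<tau> / exp (c * \<tau>)"] T by auto
  define R where "R = D t0 / exp (c * t0)"
  have R0: "0 \<le> R" using D(2)[OF t0(1)] by (simp add: R_def)
  have DR: "D \<tau> \<le> R * exp (c * \<tau>)" if "\<tau> \<in> {0..T}" for \<tau>
    using t0(2)[OF that] by (simp add: R_def pos_divide_le_eq)
  have "R * exp (c * t0) \<le> (A + R / 2) * exp (c * t0)"
    using step[OF R0 DR t0(1)] by (simp add: R_def)
  then have "R \<le> A + R / 2" by simp
  then have "R \<le> 2 * A" by simp
  then have "R * exp (c * t) \<le> 2 * A * exp (c * t)" by (intro mult_right_mono) auto
  then show ?thesis using DR[OF t] by linarith
qed

text \<open>One estimate for simultaneous changes of initial state, control and field, from which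
  uniqueness, continuity and contraction are read off. The controls are compared only along the
  integrand of the second trajectory, so for converging controls \<epsilon> concerns a single
  continuous function.\<close>

lemma trajectory_diff:
  assumes x: "is_trajectory T f \<xi> \<alpha> \<mu> x" and x': "is_trajectory T f \<xi>' \<alpha>' \<mu>' x'"
    and \<alpha>: "\<alpha> \<in> U" "\<alpha>' \<in> U" and \<mu>: "\<mu> \<in> external_fields T" "\<mu>' \<in> external_fields T"
    and K: "0 \<le> K" "\<And>\<tau>. \<tau> \<in> {0..T} \<Longrightarrow> dist (\<mu> \<tau>) (\<mu>' \<tau>) \<le> K * exp (c * \<tau>)"
    and \<epsilon>: "\<And>t. t \<in> {0..T} \<Longrightarrow>
      norm ((LINT z:({0..t} \<times> UNIV)|\<alpha>. F \<mu>' x' z) - (LINT z:({0..t} \<times> UNIV)|\<alpha>'. F \<mu>' x' z)) \<le> \<epsilon>"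
    and t: "t \<in> {0..T}"
  shows "norm (x t - x' t) \<le> (2 * (norm (\<xi> - \<xi>') + \<epsilon>) + K / 2) * exp (c * t)"
proof -
  have cx: "continuous_on {0..T} x" "continuous_on {0..T} x'" using x x' by (auto simp: is_trajectory_iff)
  have \<epsilon>0: "0 \<le> \<epsilon>" using \<epsilon>[OF t] norm_ge_zero order_trans by blast
  have "norm (x t - x' t) \<le> 2 * (norm (\<xi> - \<xi>') + \<epsilon> + K / 4) * exp (c * t)"
  proof (rule weighted_comparison[of "\<lambda>t. norm (x t - x' t)", OF _ _ _ t])
    show "continuous_on {0..T} (\<lambda>t. norm (x t - x' t))" by (intro continuous_intros cx)
    fix R s assume R: "0 \<le> R" "\<And>\<tau>. \<tau> \<in> {0..T} \<Longrightarrow> norm (x \<tau> - x' \<tau>) \<le> R * exp (c * \<tau>)" and s: "s \<in> {0..T}"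
    let ?I = "\<lambda>\<beta> \<nu> y. LINT z:({0..s} \<times> UNIV)|\<beta>. F \<nu> y z"
    have "?I \<alpha> \<mu> x - ?I \<alpha> \<mu>' x' = (LINT z:({0..s} \<times> UNIV)|\<alpha>. F \<mu> x z - F \<mu>' x' z)"
      by (rule set_integral_diff(2)[symmetric]) (intro F_integrable \<alpha> \<mu> cx s)+
    also have "norm \<dots> \<le> (L * R + M * K) / c * exp (c * s)"
    proof (rule norm_control_integral_le[OF \<alpha>(1) s weight(1)])
      show "0 \<le> L * R + M * K" using L0 M0 R K by simp
      fix \<tau> u assume "\<tau> \<in> {0..s}"
      then have \<tau>: "\<tau> \<in> {0..T}" using s by auto
      have "F \<mu> x (\<tau>, u) - F \<mu>' x' (\<tau>, u) = (f \<tau> (x \<tau>) (\<mu> \<tau>) u - f \<tau> (x' \<tau>) (\<mu> \<tau>) u) + (f \<tau> (x' \<tau>) (\<mu> \<tau>) u - f \<tau> (x' \<tau>) (\<mu>' \<tau>) u)"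
        by (simp add: F_def)
      also have "norm \<dots> \<le> L * norm (x \<tau> - x' \<tau>) + M * dist (\<mu> \<tau>) (\<mu>' \<tau>)"
        by (rule norm_triangle_le[OF add_mono[OF f_x[OF \<tau>] f_m[OF \<tau>]]])
      also have "\<dots> \<le> L * (R * exp (c * \<tau>)) + M * (K * exp (c * \<tau>))"
        by (intro add_mono mult_left_mono R K \<tau> L0 M0)
      finally show "norm (F \<mu> x (\<tau>, u) - F \<mu>' x' (\<tau>, u)) \<le> (L * R + M * K) * exp (c * \<tau>)"
        by (simp add: algebra_simps)
    qed
    finally have 1: "norm (?I \<alpha> \<mu> x - ?I \<alpha> \<mu>' x') \<le> (L * R + M * K) / c * exp (c * s)" .
    have "(L * R + M * K) / c = L / c * R + M / c * K" by (simp add: add_divide_distrib)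
    also have "\<dots> \<le> 1 / 2 * R + 1 / 4 * K" by (intro add_mono mult_right_mono weight R K)
    finally have 2: "(L * R + M * K) / c * exp (c * s) \<le> (R / 2 + K / 4) * exp (c * s)"
      by (intro mult_right_mono) auto
    have "x s - x' s = (\<xi> - \<xi>') + (?I \<alpha> \<mu> x - ?I \<alpha> \<mu>' x') + (?I \<alpha> \<mu>' x' - ?I \<alpha>' \<mu>' x')"
      using x x' s by (simp add: is_trajectory_iff)
    then have "norm (x s - x' s) \<le> norm (\<xi> - \<xi>') + norm (?I \<alpha> \<mu> x - ?I \<alpha> \<mu>' x') + norm (?I \<alpha> \<mu>' x' - ?I \<alpha>' \<mu>' x')"
      by (metis norm_triangle_ineq norm_triangle_mono order_refl)
    also have "\<dots> \<le> norm (\<xi> - \<xi>') + (R / 2 + K / 4) * exp (c * s) + \<epsilon>"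
      using 1 2 \<epsilon>[OF s] by linarith
    also have "\<dots> \<le> (norm (\<xi> - \<xi>') + \<epsilon>) * exp (c * s) + (R / 2 + K / 4) * exp (c * s)"
    proof -
      have "1 \<le> exp (c * s)" using weight s by simp
      then have "(norm (\<xi> - \<xi>') + \<epsilon>) * 1 \<le> (norm (\<xi> - \<xi>') + \<epsilon>) * exp (c * s)"
        using \<epsilon>0 by (intro mult_left_mono) auto
      then show ?thesis by simp
    qed
    also have "\<dots> = (norm (\<xi> - \<xi>') + \<epsilon> + K / 4 + R / 2) * exp (c * s)" by (simp add: algebra_simps)
    finally show "norm (x s - x' s) \<le> (norm (\<xi> - \<xi>') + \<epsilon> + K / 4 + R / 2) * exp (c * s)" .
  qed simp
  then show ?thesis by (simp add: algebra_simps)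
qed

text \<open>Picard iteration, started at the constant \<xi>. Each step halves the distance in the
  weighted norm (\<open>contr\<close>), and the factor \<open>exp (c * T)\<close> converts this into
  uniform convergence.\<close>

lemma trajectory_exists:
  assumes \<alpha>: "\<alpha> \<in> U" and \<mu>: "\<mu> \<in> external_fields T"
  shows "\<exists>x. is_trajectory T f \<xi> \<alpha> \<mu> x"
proof -
  define \<Phi> where "\<Phi> x t = \<xi> + (LINT z:({0..t} \<times> UNIV)|\<alpha>. F \<mu> x z)" for x t
  have \<Phi>weight: "continuous_on {0..T} (\<Phi> x)" if x: "continuous_on {0..T} x" for x
  proof -
    have "bounded (F \<mu> x ` Y)" by (intro compact_imp_bounded compact_continuous_image F_continuous \<mu> x compact_Y)
    then obtain B where B: "\<And>z. z \<in> Y \<Longrightarrow> norm (F \<mu> x z) \<le> B" by (auto simp: bounded_iff)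
    have T0: "0 \<le> T" using T by simp
    note aD = control_measuresD[OF \<alpha> T0]
    interpret \<alpha>: finite_measure \<alpha> by (rule aD(3))
    have lim: "(\<lambda>n. LINT z:({0..ts n} \<times> UNIV)|\<alpha>. F \<mu> x z) \<longlonglongrightarrow> (LINT z:({0..t} \<times> UNIV)|\<alpha>. F \<mu> x z)"
      if ts: "\<And>n. ts n \<in> {0..T}" "ts \<longlonglongrightarrow> t" and t: "t \<in> {0..T}" for ts t
      unfolding set_lebesgue_integral_def
    proof (rule integral_dominated_convergence[where w="\<lambda>_. B"])
      show "(\<lambda>z. indicator ({0..t} \<times> UNIV) z *\<^sub>R F \<mu> x z) \<in> borel_measurable \<alpha>"
        using F_integrable[OF \<alpha> \<mu> x t] by (auto simp: set_integrable_def)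
      show "(\<lambda>z. indicator ({0..ts n} \<times> UNIV) z *\<^sub>R F \<mu> x z) \<in> borel_measurable \<alpha>" for n
        using F_integrable[OF \<alpha> \<mu> x ts(1)[of n]] by (auto simp: set_integrable_def)
      \<comment> \<open>The indicators converge except possibly on the slice at time
        \<open>t\<close>, which is null because the time marginal has no atoms.\<close>
      have "AE z in \<alpha>. fst z \<noteq> t"
      proof (rule AE_I)
        show "{z \<in> space \<alpha>. \<not> fst z \<noteq> t} \<subseteq> {t} \<times> UNIV" by auto
        have "{t} \<in> sets (borel_on {0..T})" using t by (auto simp: sets_restrict_space_iff)
        then show "emeasure \<alpha> ({t} \<times> UNIV) = 0" using aD(5)[of "{t}"] by simp
        show "{t} \<times> UNIV \<in> sets \<alpha>" using t by (intro cylinder_measurable[OF aD(1)]) auto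
      qed
      then show "AE z in \<alpha>. (\<lambda>n. indicator ({0..ts n} \<times> UNIV) z *\<^sub>R F \<mu> x z) \<longlonglongrightarrow> indicator ({0..t} \<times> UNIV) z *\<^sub>R F \<mu> x z"
        using AE_space
      proof eventually_elim
        case (elim z)
        have z: "fst z \<in> {0..T}" using elim(2) aD(2) by (auto simp: mem_Times_iff)
        have "\<forall>\<^sub>F n in sequentially. indicator ({0..ts n} \<times> UNIV) z = (indicator ({0..t} \<times> UNIV) z :: real)"
        proof (cases "fst z < t")
          case True
          then have "\<forall>\<^sub>F n in sequentially. fst z < ts n" using ts(2) by (rule order_tendstoD(1)[rotated])
          then show ?thesis by eventually_elim (use True z in \<open>auto simp: indicator_def mem_Times_iff\<close>)
        next
          case False
          then have "t < fst z" using elim(1) by simp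
          then have "\<forall>\<^sub>F n in sequentially. ts n < fst z" using ts(2) by (rule order_tendstoD(2)[rotated])
          then show ?thesis by eventually_elim (use \<open>t < fst z\<close> in \<open>auto simp: indicator_def mem_Times_iff\<close>)
        qed
        then show ?case by (intro tendsto_scaleR tendsto_const tendsto_eventually)
      qed
      show "AE z in \<alpha>. norm (indicator ({0..ts n} \<times> UNIV) z *\<^sub>R F \<mu> x z) \<le> B" for n
      proof (rule AE_I2)
        fix z assume "z \<in> space \<alpha>"
        then have "norm (F \<mu> x z) \<le> B" using B aD(2) by auto
        then show "norm (indicator ({0..ts n} \<times> UNIV) z *\<^sub>R F \<mu> x z) \<le> B"
          using norm_ge_zero[of "F \<mu> x z"] by (auto simp: indicator_def simp del: norm_ge_zero)
      qed
    qed simp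
    show ?thesis
      unfolding continuous_on_sequentially \<Phi>_def o_def
      by (intro allI ballI impI tendsto_add tendsto_const lim) auto
  qed
  have contr: "norm (\<Phi> x t - \<Phi> y t) \<le> R / 2 * exp (c * t)"
    if x: "continuous_on {0..T} x" "continuous_on {0..T} y" and R: "0 \<le> R" "\<And>\<tau>. \<tau> \<in> {0..T} \<Longrightarrow> norm (x \<tau> - y \<tau>) \<le> R * exp (c * \<tau>)"
      and t: "t \<in> {0..T}" for x y R t
  proof -
    have "\<Phi> x t - \<Phi> y t = (LINT z:({0..t} \<times> UNIV)|\<alpha>. F \<mu> x z - F \<mu> y z)"
      unfolding \<Phi>_def using set_integral_diff(2)[OF F_integrable[OF \<alpha> \<mu> x(1) t] F_integrable[OF \<alpha> \<mu> x(2) t]] by simp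
    also have "norm \<dots> \<le> (L * R) / c * exp (c * t)"
    proof (rule norm_control_integral_le[OF \<alpha> t weight(1)])
      show "0 \<le> L * R" using L0 R by simp
      fix \<tau> u assume "\<tau> \<in> {0..t}"
      then have \<tau>: "\<tau> \<in> {0..T}" using t by auto
      have "norm (F \<mu> x (\<tau>, u) - F \<mu> y (\<tau>, u)) \<le> L * norm (x \<tau> - y \<tau>)" using f_x[OF \<tau>] by (simp add: F_def)
      also have "\<dots> \<le> L * (R * exp (c * \<tau>))" by (intro mult_left_mono R \<tau> L0)
      finally show "norm (F \<mu> x (\<tau>, u) - F \<mu> y (\<tau>, u)) \<le> L * R * exp (c * \<tau>)" by simp
    qed
    also have "\<dots> \<le> R / 2 * exp (c * t)" using mult_right_mono[OF weight(2) R(1)] by (intro mult_right_mono) auto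
    finally show ?thesis .
  qed
  define X where "X = rec_nat (\<lambda>_. \<xi>) (\<lambda>_. \<Phi>)"
  have X: "X 0 = (\<lambda>_. \<xi>)" "X (Suc k) = \<Phi> (X k)" for k by (auto simp: X_def)
  have Xc: "continuous_on {0..T} (X k)" for k by (induction k) (auto simp: X intro: \<Phi>weight)
  have "bounded ((\<lambda>t. X 1 t - X 0 t) ` {0..T})"
    by (intro compact_imp_bounded compact_continuous_image continuous_on_diff Xc) simp
  then obtain K where "0 < K" "\<forall>v\<in>(\<lambda>t. X 1 t - X 0 t) ` {0..T}. norm v \<le> K"
    unfolding bounded_pos by blast
  then have K: "0 \<le> K" "\<And>t. t \<in> {0..T} \<Longrightarrow> norm (X 1 t - X 0 t) \<le> K" by auto
  have step: "norm (X (Suc k) t - X k t) \<le> K * (1/2)^k * exp (c * t)" if "t \<in> {0..T}" for k t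
    using that
  proof (induction k arbitrary: t)
    case 0
    have "K * 1 \<le> K * exp (c * t)" using 0 weight K by (intro mult_left_mono) auto
    then show ?case using K(2)[OF 0] by simp
  next
    case (Suc k)
    have "norm (X (Suc (Suc k)) t - X (Suc k) t) \<le> (K * (1/2)^k) / 2 * exp (c * t)"
      unfolding X(2)[of "Suc k"] unfolding X(2)[of k]
      using Suc K by (intro contr Xc \<Phi>weight) (auto simp: X(2)[symmetric])
    then show ?case by simp
  qed
  have KT: "0 \<le> K * exp (c * T)" using K by simp
  obtain l where l: "uniform_limit {0..T} X l sequentially"
  proof (rule geometric_uniform_limit[OF KT])
    fix k t assume t: "t \<in> {0..T}"
    have "K * (1/2)^k * exp (c * t) \<le> K * (1/2)^k * exp (c * T)" using t K weight by (intro mult_left_mono) auto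
    then show "norm (X (Suc k) t - X k t) \<le> K * exp (c * T) * (1/2)^k" using step[OF t, of k] by (simp add: mult_ac)
  qed (rule that)
  have lc: "continuous_on {0..T} l"
    by (rule uniform_limit_theorem[OF _ l]) (auto simp: Xc)
  have fix_l: "l t = \<Phi> l t" if t: "t \<in> {0..T}" for t
  proof (rule LIMSEQ_unique)
    show "(\<lambda>k. X (Suc k) t) \<longlonglongrightarrow> l t" using LIMSEQ_Suc[OF tendsto_uniform_limitI[OF l t]] .
    show "(\<lambda>k. X (Suc k) t) \<longlonglongrightarrow> \<Phi> l t"
    proof (rule metric_LIMSEQ_I)
      fix e :: real assume e: "e > 0"
      define R where "R = e / exp (c * T)"
      have R: "R > 0" using e by (simp add: R_def)
      obtain N where N: "\<And>k \<tau>. k \<ge> N \<Longrightarrow> \<tau> \<in> {0..T} \<Longrightarrow> dist (X k \<tau>) (l \<tau>) < R"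
        using uniform_limitD[OF l R] unfolding eventually_sequentially by metis
      have "dist (X (Suc k) t) (\<Phi> l t) < e" if "k \<ge> N" for k
      proof -
        have "norm (\<Phi> (X k) t - \<Phi> l t) \<le> R / 2 * exp (c * t)"
        proof (rule contr[OF Xc lc _ _ t])
          fix \<tau> assume \<tau>: "\<tau> \<in> {0..T}"
          have "R * 1 \<le> R * exp (c * \<tau>)" using \<tau> weight R by (intro mult_left_mono) auto
          then show "norm (X k \<tau> - l \<tau>) \<le> R * exp (c * \<tau>)" using N[OF that \<tau>] by (simp add: dist_norm)
        qed (use R in simp)
        also have "\<dots> \<le> R / 2 * exp (c * T)" using t weight R by (intro mult_left_mono) auto
        also have "\<dots> < e" using e by (simp add: R_def)
        finally show ?thesis by (simp add: X dist_norm)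
      qed
      then show "\<exists>N. \<forall>k\<ge>N. dist (X (Suc k) t) (\<Phi> l t) < e" by blast
    qed
  qed
  \<comment> \<open>Restriction selects the representative that \<open>is_trajectory\<close>
    requires; the integrals over \<open>{0..t}\<close> do not see the difference.\<close>
  define x where "x = restrict l {0..T}"
  have "F \<mu> x z = F \<mu> l z" if "fst z \<in> {0..T}" for z using that by (simp add: F_def x_def)
  then have "(LINT z:({0..t} \<times> UNIV)|\<alpha>. F \<mu> x z) = (LINT z:({0..t} \<times> UNIV)|\<alpha>. F \<mu> l z)" if "t \<in> {0..T}" for t
    unfolding set_lebesgue_integral_def using that
    by (intro Bochner_Integration.integral_cong) (auto simp: indicator_def mem_Times_iff)
  moreover have "continuous_on {0..T} x"
    using continuous_on_cong[OF refl, of "{0..T}" x l] lc by (simp add: x_def)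
  moreover have "x t = l t" if "t \<in> {0..T}" for t using that by (simp add: x_def)
  moreover have "x \<in> extensional {0..T}" by (simp add: x_def)
  ultimately have "is_trajectory T f \<xi> \<alpha> \<mu> x"
    unfolding is_trajectory_iff using fix_l by (simp add: \<Phi>_def)
  then show ?thesis by blast
qed

text \<open>Indexed by the initial state instead of a player, because the game is solved for coded
  players and decoded afterwards.\<close>

definition "traj \<xi> \<alpha> \<mu> = (THE x. is_trajectory T f \<xi> \<alpha> \<mu> x)"

lemma trajectory_eq_traj: "trajectory T f x0 \<omega> \<alpha> \<mu> = traj (x0 \<omega>) \<alpha> \<mu>"
  by (simp add: trajectory_def traj_def)

lemma is_trajectory_traj:
  assumes "\<alpha> \<in> U" "\<mu> \<in> external_fields T"
  shows "is_trajectory T f \<xi> \<alpha> \<mu> (traj \<xi> \<alpha> \<mu>)"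
proof -
  obtain x where x: "is_trajectory T f \<xi> \<alpha> \<mu> x" using trajectory_exists[OF assms] by blast
  have "y = x" if y: "is_trajectory T f \<xi> \<alpha> \<mu> y" for y
  proof (rule extensionalityI)
    fix t assume "t \<in> {0..T}"
    then have "norm (y t - x t) \<le> (2 * (norm (\<xi> - \<xi>) + 0) + 0 / 2) * exp (c * t)"
      by (intro trajectory_diff[OF y x]) (use assms in auto)
    then show "y t = x t" by simp
  qed (use x y in \<open>auto simp: is_trajectory_def\<close>)
  with x show ?thesis unfolding traj_def by (rule theI)
qed

lemma traj_continuous: "\<alpha> \<in> U \<Longrightarrow> \<mu> \<in> external_fields T \<Longrightarrow> continuous_on {0..T} (traj \<xi> \<alpha> \<mu>)"
  using is_trajectory_traj by (auto simp: is_trajectory_def)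

lemma traj_diff_field:
  assumes "\<alpha> \<in> U" "\<mu> \<in> external_fields T" "\<mu>' \<in> external_fields T"
    and "0 \<le> K" "\<And>\<tau>. \<tau> \<in> {0..T} \<Longrightarrow> dist (\<mu> \<tau>) (\<mu>' \<tau>) \<le> K * exp (c * \<tau>)" and "t \<in> {0..T}"
  shows "norm (traj \<xi> \<alpha> \<mu> t - traj \<xi> \<alpha> \<mu>' t) \<le> K / 2 * exp (c * t)"
proof -
  have "norm (traj \<xi> \<alpha> \<mu> t - traj \<xi> \<alpha> \<mu>' t) \<le> (2 * (norm (\<xi> - \<xi>) + 0) + K / 2) * exp (c * t)"
  proof (rule trajectory_diff[OF is_trajectory_traj[OF assms(1,2)] is_trajectory_traj[OF assms(1,3)] assms(1,1,2,3,4,5) _ assms(6)])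
    show "norm ((LINT z:({0..t} \<times> UNIV)|\<alpha>. F \<mu>' (traj \<xi> \<alpha> \<mu>') z) - (LINT z:({0..t} \<times> UNIV)|\<alpha>. F \<mu>' (traj \<xi> \<alpha> \<mu>') z)) \<le> 0" for t
      by (simp only: diff_self norm_zero order_refl)
  qed
  then show ?thesis by simp
qed

end

section \<open>Processes\<close>

lemma uniform_limit_tendsto_compose:
  fixes f :: "nat \<Rightarrow> 'a::metric_space \<Rightarrow> 'b::metric_space"
  assumes u: "uniform_limit S f l sequentially" and l: "continuous_on S l"
    and x: "\<And>n. xs n \<in> S" "x \<in> S" "xs \<longlonglongrightarrow> x"
  shows "(\<lambda>n. f n (xs n)) \<longlonglongrightarrow> l x"
proof (rule metric_LIMSEQ_I)
  fix e :: real assume "e > 0"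
  then obtain N1 where N1: "\<And>n y. n \<ge> N1 \<Longrightarrow> y \<in> S \<Longrightarrow> dist (f n y) (l y) < e / 2"
    using uniform_limitD[OF u, of "e/2"] unfolding eventually_sequentially by (metis half_gt_zero)
  have "(\<lambda>n. l (xs n)) \<longlonglongrightarrow> l x" using continuous_on_tendsto_compose[OF l x(3,2)] x(1) by simp
  then obtain N2 where N2: "\<And>n. n \<ge> N2 \<Longrightarrow> dist (l (xs n)) (l x) < e / 2"
    using metric_LIMSEQ_D[of "\<lambda>n. l (xs n)" "l x" "e/2"] \<open>e > 0\<close> by auto
  have "dist (f n (xs n)) (l x) < e" if "n \<ge> max N1 N2" for n
    using N1[of n "xs n"] N2[of n] x(1)[of n] that dist_triangle[of "f n (xs n)" "l x" "l (xs n)"] by simp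
  then show "\<exists>N. \<forall>n\<ge>N. dist (f n (xs n)) (l x) < e" by blast
qed

text \<open>The abstraction is meaningful when the image law has a first moment; a bounded
  measurable \<open>h\<close> guarantees this.\<close>

definition push_prob1 :: "'z measure \<Rightarrow> ('z \<Rightarrow> 'a::euclidean_space) \<Rightarrow> 'a prob1" where
  "push_prob1 \<gamma> h = Abs_prob1 (distr \<gamma> borel h)"

lemma measure_of_push_prob1:
  assumes "prob_space \<gamma>" "h \<in> borel_measurable \<gamma>" "\<And>z. z \<in> space \<gamma> \<Longrightarrow> norm (h z) \<le> B"
  shows "measure_of_prob1 (push_prob1 \<gamma> h) = distr \<gamma> borel h"
proof -
  interpret \<gamma>: prob_space \<gamma> by fact
  have "integrable \<gamma> (\<lambda>z. norm (h z))" using assms by (intro \<gamma>.integrable_const_bound[where B=B]) auto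
  then have "integrable (distr \<gamma> borel h) norm" using assms(2) by (subst integrable_distr_eq) auto
  moreover have "prob_space (distr \<gamma> borel h)" using assms(2) by (rule \<gamma>.prob_space_distr)
  ultimately show ?thesis
    unfolding push_prob1_def by (intro Abs_prob1_inverse) (simp add: space_prob_algebra)
qed

lemma measure_of_push_prob1_continuous:
  assumes "prob_space \<gamma>" "sets \<gamma> = sets (borel_on X)" "compact X" "continuous_on X h"
  shows "measure_of_prob1 (push_prob1 \<gamma> h) = distr \<gamma> borel h"
proof -
  have "bounded (h ` X)" using assms by (intro compact_imp_bounded compact_continuous_image)
  then obtain B where "\<And>z. z \<in> X \<Longrightarrow> norm (h z) \<le> B" by (auto simp: bounded_iff)
  then show ?thesis
    using assms space_borel_onI[OF assms(2)]
    by (intro measure_of_push_prob1[where B=B] borel_measurable_borel_on) auto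
qed

lemma integral_push_prob1:
  fixes \<phi> :: "'a::euclidean_space \<Rightarrow> real"
  assumes "prob_space \<gamma>" "sets \<gamma> = sets (borel_on X)" "compact X" "continuous_on X h" "1-lipschitz_on UNIV \<phi>"
  shows "(\<integral>x. \<phi> x \<partial>measure_of_prob1 (push_prob1 \<gamma> h)) = (\<integral>z. \<phi> (h z) \<partial>\<gamma>)"
  unfolding measure_of_push_prob1_continuous[OF assms(1-4)]
  using lipschitz_on_continuous_on[OF assms(5)]
  by (intro integral_distr borel_measurable_borel_on[OF assms(2,4)] borel_measurable_continuous_onI)

lemma lipschitz_compose_continuous:
  fixes \<phi> :: "'a::euclidean_space \<Rightarrow> real"
  shows "continuous_on X h \<Longrightarrow> 1-lipschitz_on UNIV \<phi> \<Longrightarrow> continuous_on X (\<lambda>z. \<phi> (h z))"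
  by (rule continuous_on_compose2[OF lipschitz_on_continuous_on]) auto

text \<open>Both laws are images of one \<gamma>, which serves as a coupling: a 1-Lipschitz test
  changes by at most \<open>e\<close> at every point.\<close>

lemma dist_push_prob1_le:
  fixes h h' :: "'z::metric_space \<Rightarrow> 'a::euclidean_space"
  assumes \<gamma>: "prob_space \<gamma>" "sets \<gamma> = sets (borel_on X)" "compact X"
    and h: "continuous_on X h" "continuous_on X h'" "\<And>z. z \<in> X \<Longrightarrow> norm (h z - h' z) \<le> e"
  shows "dist (push_prob1 \<gamma> h) (push_prob1 \<gamma> h') \<le> e"
proof (rule dist_prob1_least)
  fix \<phi> :: "'a \<Rightarrow> real" assume \<phi>: "1-lipschitz_on UNIV \<phi>"
  interpret \<gamma>: prob_space \<gamma> by fact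
  have sp: "space \<gamma> = X" by (rule space_borel_onI[OF \<gamma>(2)])
  have i: "integrable \<gamma> (\<lambda>z. \<phi> (h z))" "integrable \<gamma> (\<lambda>z. \<phi> (h' z))"
    using integrable_continuous_on_compact[OF \<gamma>.finite_measure_axioms \<gamma>(2,3)] lipschitz_compose_continuous[OF h(1) \<phi>]
      lipschitz_compose_continuous[OF h(2) \<phi>] by blast+
  have "(\<integral>x. \<phi> x \<partial>measure_of_prob1 (push_prob1 \<gamma> h)) - (\<integral>x. \<phi> x \<partial>measure_of_prob1 (push_prob1 \<gamma> h'))
      = (\<integral>z. \<phi> (h z) - \<phi> (h' z) \<partial>\<gamma>)"
    using i by (simp add: integral_push_prob1[OF \<gamma> h(1) \<phi>] integral_push_prob1[OF \<gamma> h(2) \<phi>])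
  also have "\<dots> \<le> e"
  proof (rule \<gamma>.integral_le_const)
    show "integrable \<gamma> (\<lambda>z. \<phi> (h z) - \<phi> (h' z))" using i by simp
    have "\<phi> (h z) - \<phi> (h' z) \<le> e" if "z \<in> X" for z
      using lipschitz_onD[OF \<phi>, of "h z" "h' z"] h(3)[OF that] by (simp add: dist_norm abs_le_iff)
    then show "AE z in \<gamma>. \<phi> (h z) - \<phi> (h' z) \<le> e" by (auto simp: sp)
  qed
  finally show "(\<integral>x. \<phi> x \<partial>measure_of_prob1 (push_prob1 \<gamma> h)) - (\<integral>x. \<phi> x \<partial>measure_of_prob1 (push_prob1 \<gamma> h')) \<le> e" .
qed

text \<open>A point of \<open>X\<close> stands for a player together with a control, of which only
  the initial state \<xi> and the control measure \<open>A\<close> matter. Keeping \<open>X\<close>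
  abstract leaves room for codes in place of players and controls.\<close>

locale mean_field_players = mean_field_dynamics T L M f
  for T L M :: real and f :: "real \<Rightarrow> 'a::euclidean_space \<Rightarrow> 'a prob1 \<Rightarrow> 'p::metric_space \<Rightarrow> 'a" +
  fixes X :: "'z::metric_space set" and \<xi> :: "'z \<Rightarrow> 'a" and A :: "'z \<Rightarrow> (real \<times> 'p) measure"
  assumes X: "compact X" and \<xi>_cont: "continuous_on X \<xi>" and A_U: "\<And>z. z \<in> X \<Longrightarrow> A z \<in> control_measures T"
    and A_conv: "\<And>zs z. (\<And>n. zs n \<in> X) \<Longrightarrow> z \<in> X \<Longrightarrow> zs \<longlonglongrightarrow> z \<Longrightarrow>
      weakly_converges (control_space T) (\<lambda>n. A (zs n)) (A z)"
begin

definition "y \<mu> t z = traj (\<xi> z) (A z) \<mu> t"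

lemma y_uniform_limit:
  assumes \<mu>: "\<And>n. \<mu>s n \<in> external_fields T" "\<mu> \<in> external_fields T" "uniform_limit {0..T} \<mu>s \<mu> sequentially"
    and z: "\<And>n. zs n \<in> X" "z \<in> X" "zs \<longlonglongrightarrow> z"
  shows "uniform_limit {0..T} (\<lambda>n t. y (\<mu>s n) t (zs n)) (\<lambda>t. y \<mu> t z) sequentially"
proof (rule uniform_limitI)
  fix e :: real assume e: "e > 0"
  \<comment> \<open>The estimate of \<open>trajectory_diff\<close> adds up to
    \<open>2 * (d + d) + d / 2\<close>, which is \<open>9 / 2 * d\<close>; multiplied by
    \<open>exp (c * T)\<close> this is nine sixteenths of \<open>e\<close>.\<close>
  define d where "d = e / (8 * exp (c * T))"
  have d: "d > 0" "d * exp (c * T) = e / 8" using e by (auto simp: d_def)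
  have "(\<lambda>n. \<xi> (zs n)) \<longlonglongrightarrow> \<xi> z"
    using continuous_on_tendsto_compose[OF \<xi>_cont z(3,2)] z(1) by simp
  then have "\<forall>\<^sub>F n in sequentially. dist (\<xi> (zs n)) (\<xi> z) < d" using d(1) by (rule tendstoD)
  moreover have "\<forall>\<^sub>F n in sequentially. \<forall>t\<in>{0..T}. dist (\<mu>s n t) (\<mu> t) < d"
    using uniform_limitD[OF \<mu>(3) d(1)] .
  moreover have "\<forall>\<^sub>F n in sequentially. \<forall>t\<in>{0..T}.
      norm ((LINT w:({0..t} \<times> UNIV)|A (zs n). F \<mu> (traj (\<xi> z) (A z) \<mu>) w) - (LINT w:({0..t} \<times> UNIV)|A z. F \<mu> (traj (\<xi> z) (A z) \<mu>) w)) < d"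
    by (rule control_integral_uniform_convergence[OF P T A_U[OF z(2)] A_U[OF z(1)] A_conv[OF z]
          F_continuous[OF \<mu>(2) traj_continuous[OF A_U[OF z(2)] \<mu>(2)]] d(1)])
  ultimately show "\<forall>\<^sub>F n in sequentially. \<forall>t\<in>{0..T}. dist (y (\<mu>s n) t (zs n)) (y \<mu> t z) < e"
  proof eventually_elim
    case (elim n)
    show ?case
    proof
      fix t assume t: "t \<in> {0..T}"
      have "norm (traj (\<xi> (zs n)) (A (zs n)) (\<mu>s n) t - traj (\<xi> z) (A z) \<mu> t)
          \<le> (2 * (norm (\<xi> (zs n) - \<xi> z) + d) + d / 2) * exp (c * t)"
      proof (rule trajectory_diff[OF is_trajectory_traj[OF A_U[OF z(1)] \<mu>(1)] is_trajectory_traj[OF A_U[OF z(2)] \<mu>(2)] A_U[OF z(1)] A_U[OF z(2)] \<mu>(1,2)])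
        show "dist (\<mu>s n \<tau>) (\<mu> \<tau>) \<le> d * exp (c * \<tau>)" if \<tau>: "\<tau> \<in> {0..T}" for \<tau>
        proof -
          have "d * 1 \<le> d * exp (c * \<tau>)" using \<tau> weight d by (intro mult_left_mono) auto
          then show ?thesis using elim(2) \<tau> by fastforce
        qed
      qed (use elim(3) d t in \<open>auto intro: less_imp_le\<close>)
      also have "\<dots> \<le> (2 * (d + d) + d / 2) * exp (c * T)"
        using elim(1) t weight d by (intro mult_mono) (auto simp: dist_norm)
      also have "\<dots> = (9 / 2) * (d * exp (c * T))" by (simp add: algebra_simps)
      also have "\<dots> < e" using d e by simp
      finally show "dist (y (\<mu>s n) t (zs n)) (y \<mu> t z) < e" by (simp add: y_def dist_norm)
    qed
  qed
qed

lemma y_continuous: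
  assumes \<mu>: "\<mu> \<in> external_fields T"
  shows "continuous_on ({0..T} \<times> X) (\<lambda>w. y \<mu> (fst w) (snd w))"
  unfolding continuous_on_sequentially o_def
proof (intro allI ballI impI, elim conjE)
  fix ws w assume w: "w \<in> {0..T} \<times> X" and ws: "\<forall>n. ws n \<in> {0..T} \<times> X" and lim: "ws \<longlonglongrightarrow> w"
  have m: "fst (ws n) \<in> {0..T}" "snd (ws n) \<in> X" "fst w \<in> {0..T}" "snd w \<in> X" for n
    using w ws by (auto simp: mem_Times_iff)
  have u: "uniform_limit {0..T} (\<lambda>n t. y \<mu> t (snd (ws n))) (\<lambda>t. y \<mu> t (snd w)) sequentially"
    by (rule y_uniform_limit[OF \<mu> \<mu> _ m(2,4) tendsto_snd[OF lim]]) (auto intro: uniform_limitI)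
  have "continuous_on {0..T} (\<lambda>t. y \<mu> t (snd w))"
    using traj_continuous[OF A_U[OF m(4)] \<mu>] by (simp add: y_def)
  from uniform_limit_tendsto_compose[OF u this m(1,3) tendsto_fst[OF lim]]
  show "(\<lambda>n. y \<mu> (fst (ws n)) (snd (ws n))) \<longlonglongrightarrow> y \<mu> (fst w) (snd w)" .
qed

lemma y_continuous_player:
  assumes "\<mu> \<in> external_fields T" "t \<in> {0..T}"
  shows "continuous_on X (y \<mu> t)"
proof -
  have "continuous_on X (\<lambda>z. (t, z))" by (intro continuous_intros)
  moreover have "(\<lambda>z. (t, z)) ` X \<subseteq> {0..T} \<times> X" using assms(2) by auto
  ultimately have "continuous_on X (\<lambda>z. y \<mu> (fst (t, z)) (snd (t, z)))"
    by (rule continuous_on_compose2[OF y_continuous[OF assms(1)]])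
  then show ?thesis by simp
qed

lemma y_equicontinuous:
  assumes \<mu>: "\<mu> \<in> external_fields T" and e: "e > 0"
  obtains \<delta> where "\<delta> > 0" "\<And>t t' z z'. t \<in> {0..T} \<Longrightarrow> t' \<in> {0..T} \<Longrightarrow> z \<in> X \<Longrightarrow> z' \<in> X \<Longrightarrow>
    dist (t, z) (t', z') < \<delta> \<Longrightarrow> norm (y \<mu> t z - y \<mu> t' z') < e"
proof -
  have "uniformly_continuous_on ({0..T} \<times> X) (\<lambda>w. y \<mu> (fst w) (snd w))"
    by (intro compact_uniformly_continuous y_continuous \<mu> compact_Times X) simp
  then obtain \<delta> where "\<delta> > 0" and \<delta>: "\<And>w w'. w \<in> {0..T} \<times> X \<Longrightarrow> w' \<in> {0..T} \<times> X \<Longrightarrow> dist w' w < \<delta> \<Longrightarrow>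
      dist (y \<mu> (fst w') (snd w')) (y \<mu> (fst w) (snd w)) < e"
    using e unfolding uniformly_continuous_on_def by metis
  show thesis
  proof
    show "\<delta> > 0" by fact
    show "norm (y \<mu> t z - y \<mu> t' z') < e"
      if "t \<in> {0..T}" "t' \<in> {0..T}" "z \<in> X" "z' \<in> X" "dist (t, z) (t', z') < \<delta>" for t t' z z'
      using \<delta>[of "(t', z')" "(t, z)"] that by (simp add: dist_norm)
  qed
qed

definition "laws = {\<gamma>. prob_space \<gamma> \<and> sets \<gamma> = sets (borel_on X)}"

lemma lawsD: "\<gamma> \<in> laws \<Longrightarrow> prob_space \<gamma>" "\<gamma> \<in> laws \<Longrightarrow> sets \<gamma> = sets (borel_on X)"
  by (auto simp: laws_def)

text \<open>The field that the population law \<gamma> produces when everyone moves in the field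
  \<mu>; processes correspond to its fixed points.\<close>

definition "\<Psi> \<gamma> \<mu> t = push_prob1 \<gamma> (y \<mu> t)"

lemma \<Psi>_field:
  assumes \<gamma>: "\<gamma> \<in> laws" and \<mu>: "\<mu> \<in> external_fields T"
  shows "\<Psi> \<gamma> \<mu> \<in> external_fields T"
  unfolding external_fields_def mem_Collect_eq continuous_on_iff
proof (intro ballI allI impI)
  fix t e assume t: "t \<in> {0..T}" and e: "(0::real) < e"
  obtain \<delta> where \<delta>: "\<delta> > 0" "\<And>t t' z z'. t \<in> {0..T} \<Longrightarrow> t' \<in> {0..T} \<Longrightarrow> z \<in> X \<Longrightarrow> z' \<in> X \<Longrightarrow>
    dist (t, z) (t', z') < \<delta> \<Longrightarrow> norm (y \<mu> t z - y \<mu> t' z') < e / 2"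
    by (rule y_equicontinuous[OF \<mu>, of "e/2"]) (use e in auto)
  have "dist (\<Psi> \<gamma> \<mu> t') (\<Psi> \<gamma> \<mu> t) < e" if t': "t' \<in> {0..T}" "dist t' t < \<delta>" for t'
  proof -
    have "dist (\<Psi> \<gamma> \<mu> t') (\<Psi> \<gamma> \<mu> t) \<le> e / 2"
      unfolding \<Psi>_def
      by (rule dist_push_prob1_le[OF lawsD[OF \<gamma>] X y_continuous_player[OF \<mu> t'(1)] y_continuous_player[OF \<mu> t]])
        (use \<delta>(2)[OF t'(1) t] t'(2) in \<open>auto simp: dist_Pair_Pair intro: less_imp_le\<close>)
    then show ?thesis using e by simp
  qed
  then show "\<exists>d>0. \<forall>t'\<in>{0..T}. dist t' t < d \<longrightarrow> dist (\<Psi> \<gamma> \<mu> t') (\<Psi> \<gamma> \<mu> t) < e" using \<delta>(1) by blast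
qed

lemma y_diff:
  assumes "z \<in> X" "\<mu> \<in> external_fields T" "\<mu>' \<in> external_fields T"
    and "0 \<le> K" "\<And>\<tau>. \<tau> \<in> {0..T} \<Longrightarrow> dist (\<mu> \<tau>) (\<mu>' \<tau>) \<le> K * exp (c * \<tau>)" and "t \<in> {0..T}"
  shows "norm (y \<mu> t z - y \<mu>' t z) \<le> K / 2 * exp (c * t)"
  unfolding y_def by (rule traj_diff_field[OF A_U[OF assms(1)] assms(2-6)])

lemma \<Psi>_contraction:
  assumes \<gamma>: "\<gamma> \<in> laws" and \<mu>: "\<mu> \<in> external_fields T" "\<mu>' \<in> external_fields T"
    and K: "0 \<le> K" "\<And>\<tau>. \<tau> \<in> {0..T} \<Longrightarrow> dist (\<mu> \<tau>) (\<mu>' \<tau>) \<le> K * exp (c * \<tau>)" and t: "t \<in> {0..T}"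
  shows "dist (\<Psi> \<gamma> \<mu> t) (\<Psi> \<gamma> \<mu>' t) \<le> K / 2 * exp (c * t)"
  unfolding \<Psi>_def
  by (rule dist_push_prob1_le[OF lawsD[OF \<gamma>] X y_continuous_player[OF \<mu>(1) t] y_continuous_player[OF \<mu>(2) t]])
    (rule y_diff[OF _ \<mu> K t])

section \<open>The field generated by a law\<close>

definition "generates \<gamma> \<mu> \<longleftrightarrow> \<mu> \<in> external_fields T \<and> (\<forall>t\<in>{0..T}. \<mu> t = \<Psi> \<gamma> \<mu> t)"

text \<open>Successive approximations, contracting by 1/2 in the weighted distance and started from
  the point mass at 0. The limit is taken of the flows, in the complete space of states, and the
  limit field is then obtained as the push-forward of the limit flow.\<close>

lemma generates_exists:
  assumes \<gamma>: "\<gamma> \<in> laws"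
  shows "\<exists>\<mu>. generates \<gamma> \<mu>"
proof -
  define m where "m = rec_nat (\<lambda>_. push_prob1 \<gamma> (\<lambda>_. 0)) (\<lambda>_. \<Psi> \<gamma>)"
  have m: "m 0 = (\<lambda>_. push_prob1 \<gamma> (\<lambda>_. 0))" "m (Suc k) = \<Psi> \<gamma> (m k)" for k by (auto simp: m_def)
  have mE: "m k \<in> external_fields T" for k
    by (induction k) (auto simp: m intro: \<Psi>_field[OF \<gamma>], simp add: external_fields_def)
  have "continuous_on {0..T} (\<lambda>t. dist (m 1 t) (m 0 t))"
    using mE[of 1] mE[of 0] by (auto simp: external_fields_def intro!: continuous_on_dist)
  then have "bounded ((\<lambda>t. dist (m 1 t) (m 0 t)) ` {0..T})"
    by (intro compact_imp_bounded compact_continuous_image) auto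
  then obtain K where "0 < K" "\<forall>v\<in>(\<lambda>t. dist (m 1 t) (m 0 t)) ` {0..T}. norm v \<le> K"
    unfolding bounded_pos by blast
  then have K: "0 \<le> K" "\<And>t. t \<in> {0..T} \<Longrightarrow> dist (m 1 t) (m 0 t) \<le> K" by auto
  have step: "dist (m (Suc k) t) (m k t) \<le> K * (1/2)^k * exp (c * t)" if "t \<in> {0..T}" for k t
    using that
  proof (induction k arbitrary: t)
    case 0
    have "K * 1 \<le> K * exp (c * t)" using 0 weight K by (intro mult_left_mono) auto
    then show ?case using K(2)[OF 0] by simp
  next
    case (Suc k)
    have "dist (\<Psi> \<gamma> (m (Suc k)) t) (\<Psi> \<gamma> (m k) t) \<le> (K * (1/2)^k) / 2 * exp (c * t)"
      using Suc K by (intro \<Psi>_contraction \<gamma> mE) auto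
    then show ?case by (simp add: m(2))
  qed
  define Y where "Y k w = y (m k) (fst w) (snd w)" for k w
  obtain l where l: "uniform_limit ({0..T} \<times> X) Y l sequentially"
  proof (rule geometric_uniform_limit[of "K / 2 * exp (c * T)" "{0..T} \<times> X" Y])
    show "0 \<le> K / 2 * exp (c * T)" using K by simp
    fix k w assume w: "w \<in> {0..T} \<times> X"
    then have t: "fst w \<in> {0..T}" "snd w \<in> X" by (auto simp: mem_Times_iff)
    have "norm (Y (Suc k) w - Y k w) \<le> (K * (1/2)^k) / 2 * exp (c * fst w)"
      unfolding Y_def using K step by (intro y_diff t mE) auto
    also have "\<dots> \<le> (K * (1/2)^k) / 2 * exp (c * T)" using t K weight by (intro mult_left_mono) auto
    finally show "norm (Y (Suc k) w - Y k w) \<le> K / 2 * exp (c * T) * (1/2)^k" by (simp add: mult_ac)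
  qed (rule that)
  have Yc: "continuous_on ({0..T} \<times> X) (Y k)" for k unfolding Y_def[abs_def] by (rule y_continuous[OF mE])
  have lc: "continuous_on ({0..T} \<times> X) l" by (rule uniform_limit_theorem[OF _ l]) (auto simp: Yc)
  have lct: "continuous_on X (\<lambda>z. l (t, z))" if "t \<in> {0..T}" for t
    by (rule continuous_on_compose2[OF lc]) (use that in \<open>auto intro!: continuous_intros\<close>)
  define \<mu> where "\<mu> t = push_prob1 \<gamma> (\<lambda>z. l (t, z))" for t
  have ul: "uniform_limit {0..T} (\<lambda>k. m (Suc k)) \<mu> sequentially"
  proof (rule uniform_limitI)
    fix e :: real assume e: "e > 0"
    then have "\<forall>\<^sub>F k in sequentially. \<forall>w\<in>{0..T} \<times> X. dist (Y k w) (l w) < e / 2"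
      using uniform_limitD[OF l, of "e/2"] by simp
    then show "\<forall>\<^sub>F k in sequentially. \<forall>t\<in>{0..T}. dist (m (Suc k) t) (\<mu> t) < e"
    proof eventually_elim
      case (elim k)
      show ?case
      proof
        fix t assume t: "t \<in> {0..T}"
        have "dist (m (Suc k) t) (\<mu> t) \<le> e / 2"
          unfolding m(2) \<Psi>_def \<mu>_def
        proof (rule dist_push_prob1_le[OF lawsD[OF \<gamma>] X y_continuous_player[OF mE t] lct[OF t]])
          fix z assume "z \<in> X"
          then show "norm (y (m k) t z - l (t, z)) \<le> e / 2" using elim t by (force simp: Y_def dist_norm)
        qed
        then show "dist (m (Suc k) t) (\<mu> t) < e" using e by simp
      qed
    qed
  qed
  have \<mu>E: "\<mu> \<in> external_fields T"
    unfolding external_fields_def mem_Collect_eq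
    by (rule uniform_limit_theorem[OF _ ul]) (use mE in \<open>auto simp: external_fields_def\<close>)
  \<comment> \<open>Two limits of one sequence: the flows converge to \<open>l\<close> by
    construction, and, as the fields converge to \<mu>, to the flow of \<mu> by stability.\<close>
  have ly: "l (t, z) = y \<mu> t z" if "t \<in> {0..T}" "z \<in> X" for t z
  proof (rule LIMSEQ_unique)
    show "(\<lambda>k. y (m (Suc k)) t z) \<longlonglongrightarrow> l (t, z)"
      using LIMSEQ_Suc[OF tendsto_uniform_limitI[OF l, of "(t, z)"]] that by (simp add: Y_def)
    show "(\<lambda>k. y (m (Suc k)) t z) \<longlonglongrightarrow> y \<mu> t z"
      using tendsto_uniform_limitI[OF y_uniform_limit[OF mE \<mu>E ul _ _ tendsto_const[of z]] that(1)] that(2) by simp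
  qed
  have "\<mu> t = \<Psi> \<gamma> \<mu> t" if t: "t \<in> {0..T}" for t
  proof -
    have "distr \<gamma> borel (\<lambda>z. l (t, z)) = distr \<gamma> borel (y \<mu> t)"
      using ly[OF t] space_borel_onI[OF lawsD(2)[OF \<gamma>]] by (intro distr_cong) auto
    then show ?thesis by (simp add: \<mu>_def \<Psi>_def push_prob1_def)
  qed
  then show ?thesis using \<mu>E unfolding generates_def by blast
qed

text \<open>In the triangle inequality the term with equal laws is absorbed by the contraction. The
  other term is small uniformly in time, because the flow of \<mu> composed with arbitrary
  1-Lipschitz functions is an equicontinuous family, to which weak convergence applies
  uniformly.\<close>

lemma generates_stable:
  assumes \<gamma>: "\<gamma> \<in> laws" "\<And>n. \<gamma>s n \<in> laws" "weakly_converges X \<gamma>s \<gamma>"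
    and \<mu>: "generates \<gamma> \<mu>" "\<And>n. generates (\<gamma>s n) (\<mu>s n)"
  shows "uniform_limit {0..T} \<mu>s \<mu> sequentially"
proof (rule uniform_limitI)
  fix e :: real assume e: "e > 0"
  define \<delta> where "\<delta> = e / (4 * exp (c * T))"
  have \<delta>: "\<delta> > 0" "2 * \<delta> * exp (c * T) < e" using e by (auto simp: \<delta>_def)
  have \<mu>E: "\<mu> \<in> external_fields T" "\<mu>s n \<in> external_fields T" for n using \<mu> by (auto simp: generates_def)
  have m1: "measure \<nu> X \<le> 1" "finite_measure \<nu>" if "\<nu> \<in> laws" for \<nu>
    using lawsD(1)[OF that] by (auto simp: prob_space.prob_le_1 prob_space.finite_measure)
  \<comment> \<open>1-Lipschitz functions are bounded on a bounded set only up to constants.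
    Subtracting \<open>\<phi> 0\<close> gives the common bound \<open>B\<close>, and between
    probability measures the constant cancels.\<close>
  define H where "H = {(\<lambda>z. \<phi> (y \<mu> t z) - \<phi> 0) |\<phi> t. 1-lipschitz_on UNIV (\<phi> :: 'a \<Rightarrow> real) \<and> t \<in> {0..T}}"
  have "bounded ((\<lambda>w. y \<mu> (fst w) (snd w)) ` ({0..T} \<times> X))"
    by (intro compact_imp_bounded compact_continuous_image y_continuous \<mu>E compact_Times X) simp
  then obtain B where "\<forall>v\<in>(\<lambda>w. y \<mu> (fst w) (snd w)) ` ({0..T} \<times> X). norm v \<le> B" unfolding bounded_iff by blast
  then have B: "norm (y \<mu> (fst w) (snd w)) \<le> B" if "w \<in> {0..T} \<times> X" for w using that by blast
  have "\<forall>\<^sub>F n in sequentially. \<forall>h\<in>H. norm ((\<integral>z. h z \<partial>\<gamma>s n) - (\<integral>z. h z \<partial>\<gamma>)) < \<delta>"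
  proof (rule weakly_converges_uniform[OF X m1(2)[OF \<gamma>(1)] lawsD(2)[OF \<gamma>(1)] m1(1)[OF \<gamma>(1)]
        m1(2)[OF \<gamma>(2)] lawsD(2)[OF \<gamma>(2)] m1(1)[OF \<gamma>(2)] \<gamma>(3) _ _ \<delta>(1)])
    fix \<epsilon> :: real assume "\<epsilon> > 0"
    then obtain d where d: "d > 0" "\<And>t t' z z'. t \<in> {0..T} \<Longrightarrow> t' \<in> {0..T} \<Longrightarrow> z \<in> X \<Longrightarrow> z' \<in> X \<Longrightarrow>
      dist (t, z) (t', z') < d \<Longrightarrow> norm (y \<mu> t z - y \<mu> t' z') < \<epsilon>"
      by (rule y_equicontinuous[OF \<mu>E(1)]) (rule that)
    have "norm (h x - h z) \<le> \<epsilon>" if h: "h \<in> H" and xz: "x \<in> X" "z \<in> X" "dist x z < d" for h x z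
    proof -
      obtain \<phi> t where \<phi>: "1-lipschitz_on UNIV (\<phi> :: 'a \<Rightarrow> real)" and t: "t \<in> {0..T}" and h: "h = (\<lambda>z. \<phi> (y \<mu> t z) - \<phi> 0)"
        using h unfolding H_def by blast
      have "norm (y \<mu> t x - y \<mu> t z) < \<epsilon>" using d(2)[OF t t xz(1,2)] xz(3) by (simp add: dist_Pair_Pair)
      then show ?thesis
        using lipschitz_onD[OF \<phi>, of "y \<mu> t x" "y \<mu> t z"] by (simp add: h dist_norm)
    qed
    then show "\<exists>\<delta>>0. \<forall>h\<in>H. \<forall>x\<in>X. \<forall>z\<in>X. dist x z < \<delta> \<longrightarrow> norm (h x - h z) \<le> \<epsilon>" using d(1) by blast
  next
    fix h z assume h: "h \<in> H" and z: "z \<in> X"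
    obtain \<phi> t where \<phi>: "1-lipschitz_on UNIV (\<phi> :: 'a \<Rightarrow> real)" and t: "t \<in> {0..T}" and h: "h = (\<lambda>z. \<phi> (y \<mu> t z) - \<phi> 0)"
      using h unfolding H_def by blast
    show "norm (h z) \<le> B"
      using lipschitz_onD[OF \<phi>, of "y \<mu> t z" 0] B[of "(t, z)"] t z by (simp add: h dist_norm)
  qed
  then show "\<forall>\<^sub>F n in sequentially. \<forall>t\<in>{0..T}. dist (\<mu>s n t) (\<mu> t) < e"
  proof eventually_elim
    case (elim n)
    have push: "dist (push_prob1 (\<gamma>s n) (y \<mu> t)) (push_prob1 \<gamma> (y \<mu> t)) \<le> \<delta>" if t: "t \<in> {0..T}" for t
    proof (rule dist_prob1_least)
      fix \<phi> :: "'a \<Rightarrow> real" assume \<phi>: "1-lipschitz_on UNIV \<phi>"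
      have yc: "continuous_on X (y \<mu> t)" by (rule y_continuous_player[OF \<mu>E(1) t])
      have i: "(\<integral>z. \<phi> (y \<mu> t z) - \<phi> 0 \<partial>\<nu>) = (\<integral>z. \<phi> (y \<mu> t z) \<partial>\<nu>) - \<phi> 0" if \<nu>: "\<nu> \<in> laws" for \<nu>
      proof -
        interpret \<nu>: prob_space \<nu> by (rule lawsD(1)[OF \<nu>])
        have "integrable \<nu> (\<lambda>z. \<phi> (y \<mu> t z))"
          by (rule integrable_continuous_on_compact[OF m1(2)[OF \<nu>] lawsD(2)[OF \<nu>] X lipschitz_compose_continuous[OF yc \<phi>]])
        then show ?thesis by (simp add: \<nu>.prob_space)
      qed
      have "(\<lambda>z. \<phi> (y \<mu> t z) - \<phi> 0) \<in> H" using \<phi> t by (auto simp: H_def)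
      then have "norm ((\<integral>z. \<phi> (y \<mu> t z) - \<phi> 0 \<partial>\<gamma>s n) - (\<integral>z. \<phi> (y \<mu> t z) - \<phi> 0 \<partial>\<gamma>)) < \<delta>" using elim by blast
      then show "(\<integral>x. \<phi> x \<partial>measure_of_prob1 (push_prob1 (\<gamma>s n) (y \<mu> t))) - (\<integral>x. \<phi> x \<partial>measure_of_prob1 (push_prob1 \<gamma> (y \<mu> t))) \<le> \<delta>"
        unfolding i[OF \<gamma>(1)] i[OF \<gamma>(2)] integral_push_prob1[OF lawsD[OF \<gamma>(1)] X yc \<phi>] integral_push_prob1[OF lawsD[OF \<gamma>(2)] X yc \<phi>]
        by simp
    qed
    show ?case
    proof
      fix t assume t: "t \<in> {0..T}"
      have "dist (\<mu>s n t) (\<mu> t) \<le> 2 * \<delta> * exp (c * t)"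
      proof (rule weighted_comparison[of "\<lambda>t. dist (\<mu>s n t) (\<mu> t)", OF _ _ _ t])
        show "continuous_on {0..T} (\<lambda>t. dist (\<mu>s n t) (\<mu> t))"
          using \<mu>E(1) \<mu>E(2)[of n] by (intro continuous_on_dist) (auto simp: external_fields_def)
        fix R s assume R: "0 \<le> R" "\<And>\<tau>. \<tau> \<in> {0..T} \<Longrightarrow> dist (\<mu>s n \<tau>) (\<mu> \<tau>) \<le> R * exp (c * \<tau>)" and s: "s \<in> {0..T}"
        have "dist (\<mu>s n s) (\<mu> s) = dist (\<Psi> (\<gamma>s n) (\<mu>s n) s) (\<Psi> \<gamma> \<mu> s)"
          using \<mu>(1) \<mu>(2)[of n] s unfolding generates_def by metis
        also have "\<dots> \<le> dist (\<Psi> (\<gamma>s n) (\<mu>s n) s) (\<Psi> (\<gamma>s n) \<mu> s) + dist (\<Psi> (\<gamma>s n) \<mu> s) (\<Psi> \<gamma> \<mu> s)"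
          by (rule dist_triangle)
        also have "\<dots> \<le> R / 2 * exp (c * s) + \<delta>"
          by (intro add_mono \<Psi>_contraction \<gamma> \<mu>E R s) (simp_all add: \<Psi>_def push[OF s])
        also have "\<dots> \<le> (\<delta> + R / 2) * exp (c * s)"
        proof -
          have "\<delta> * 1 \<le> \<delta> * exp (c * s)" using \<delta> weight s by (intro mult_left_mono) auto
          then show ?thesis by (simp add: algebra_simps)
        qed
        finally show "dist (\<mu>s n s) (\<mu> s) \<le> (\<delta> + R / 2) * exp (c * s)" .
      qed simp
      also have "\<dots> \<le> 2 * \<delta> * exp (c * T)" using t weight \<delta> by (intro mult_left_mono) auto
      finally show "dist (\<mu>s n t) (\<mu> t) < e" using \<delta>(2) by simp
    qed
  qed
qed

end

section \<open>Payoffs as functions of law, player and control\<close>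

locale mean_field_game = mean_field_players T L M f X \<xi> A
  for T L M :: real and f :: "real \<Rightarrow> 'a::euclidean_space \<Rightarrow> 'a prob1 \<Rightarrow> 'p::metric_space \<Rightarrow> 'a"
    and X :: "'z::metric_space set" and \<xi> :: "'z \<Rightarrow> 'a" and A :: "'z \<Rightarrow> (real \<times> 'p) measure" +
  fixes g :: "real \<Rightarrow> 'a \<Rightarrow> 'a prob1 \<Rightarrow> 'p \<Rightarrow> real" and \<sigma> :: "'a \<Rightarrow> 'a prob1 \<Rightarrow> real"
  assumes g_cont: "continuous_on ({0..T} \<times> UNIV) (\<lambda>(t, x, m, u). g t x m u)"
    and \<sigma>_cont: "continuous_on UNIV (\<lambda>(x, m). \<sigma> x m)"
begin

text \<open>On \<open>{0..T}\<close> the choice is unique, by \<open>generates_stable\<close> for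
  constant sequences; values at other times do not enter the payoff.\<close>

definition "field \<gamma> = (SOME \<mu>. generates \<gamma> \<mu>)"

lemma generates_field: "\<gamma> \<in> laws \<Longrightarrow> generates \<gamma> (field \<gamma>)"
  unfolding field_def using generates_exists by (rule someI_ex)

definition "J \<gamma> z = \<sigma> (y (field \<gamma>) T z) (field \<gamma> T) -
  (\<integral>w. g (fst w) (y (field \<gamma>) (fst w) z) (field \<gamma> (fst w)) (snd w) \<partial>A z)"

text \<open>Supplies the continuity hypothesis of \<open>distributional_equilibrium\<close>. Fields
  and trajectories converge uniformly in time, so the integrand of the running payoff converges
  along moving arguments while the control measure converges weakly.\<close>

lemma J_converges:
  assumes \<gamma>: "\<gamma> \<in> laws" "\<And>n. \<gamma>s n \<in> laws" "weakly_converges X \<gamma>s \<gamma>"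
    and z: "\<And>n. zs n \<in> X" "z \<in> X" "zs \<longlonglongrightarrow> z"
  shows "(\<lambda>n. J (\<gamma>s n) (zs n)) \<longlonglongrightarrow> J \<gamma> z"
proof -
  define \<mu> where "\<mu> = field \<gamma>"
  define \<mu>s where "\<mu>s n = field (\<gamma>s n)" for n
  have gen: "generates \<gamma> \<mu>" "generates (\<gamma>s n) (\<mu>s n)" for n
    using generates_field \<gamma> by (auto simp: \<mu>_def \<mu>s_def)
  then have \<mu>E: "\<mu> \<in> external_fields T" "\<mu>s n \<in> external_fields T" for n by (auto simp: generates_def)
  have u: "uniform_limit {0..T} \<mu>s \<mu> sequentially" by (rule generates_stable[OF \<gamma> gen])
  have uy: "uniform_limit {0..T} (\<lambda>n t. y (\<mu>s n) t (zs n)) (\<lambda>t. y \<mu> t z) sequentially"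
    by (rule y_uniform_limit[OF \<mu>E(2,1) u z])
  have T0: "T \<in> {0..T}" and T': "0 \<le> T" using T by auto
  have \<mu>weight: "continuous_on {0..T} \<nu>" if "\<nu> \<in> external_fields T" for \<nu> :: "real \<Rightarrow> 'a prob1" using that by (simp add: external_fields_def)
  have yc: "continuous_on {0..T} (\<lambda>t. y \<nu> t x)" if "\<nu> \<in> external_fields T" "x \<in> X" for \<nu> x
    using traj_continuous[OF A_U[OF that(2)] that(1)] by (simp add: y_def)
  have "(\<lambda>n. (y (\<mu>s n) T (zs n), \<mu>s n T)) \<longlonglongrightarrow> (y \<mu> T z, \<mu> T)"
    by (intro tendsto_Pair tendsto_uniform_limitI[OF uy T0] tendsto_uniform_limitI[OF u T0])
  from continuous_on_tendsto_compose[OF \<sigma>_cont this]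
  have 1: "(\<lambda>n. \<sigma> (y (\<mu>s n) T (zs n)) (\<mu>s n T)) \<longlonglongrightarrow> \<sigma> (y \<mu> T z) (\<mu> T)" by simp
  define h where "h \<nu> x w = g (fst w) (y \<nu> (fst w) x) (\<nu> (fst w)) (snd w)" for \<nu> x w
  have hc: "continuous_on Y (h \<nu> x)" if "\<nu> \<in> external_fields T" "x \<in> X" for \<nu> x
  proof -
    have "continuous_on Y (\<lambda>w. \<nu> (fst w))" "continuous_on Y (\<lambda>w. y \<nu> (fst w) x)"
      by (auto intro!: continuous_on_compose2[OF \<mu>weight[OF that(1)] continuous_on_fst[OF continuous_on_id]]
          continuous_on_compose2[OF yc[OF that] continuous_on_fst[OF continuous_on_id]])
    then have "continuous_on Y (\<lambda>w. (fst w, y \<nu> (fst w) x, \<nu> (fst w), snd w))"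
      by (intro continuous_on_Pair continuous_on_fst continuous_on_snd continuous_on_id)
    moreover have "(\<lambda>w. (fst w, y \<nu> (fst w) x, \<nu> (fst w), snd w)) ` Y \<subseteq> {0..T} \<times> UNIV" by auto
    ultimately have "continuous_on Y (\<lambda>w. case (fst w, y \<nu> (fst w) x, \<nu> (fst w), snd w) of (t, x, m, u) \<Rightarrow> g t x m u)"
      by (rule continuous_on_compose2[OF g_cont])
    then show ?thesis by (simp add: h_def[abs_def])
  qed
  note aD = control_measuresD[OF A_U T']
  have 2: "(\<lambda>n. \<integral>w. h (\<mu>s n) (zs n) w \<partial>A (zs n)) \<longlonglongrightarrow> (\<integral>w. h \<mu> z w \<partial>A z)"
  proof (rule weakly_converges_integral[where C=T and Ms="\<lambda>n. A (zs n)", OF compact_Y])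
    show "integrable (A (zs n)) (h (\<mu>s n) (zs n))" for n
      by (rule integrable_continuous_on_compact[OF aD(3)[OF z(1)] aD(1)[OF z(1)] compact_Y hc[OF \<mu>E(2) z(1)]])
    show "continuous_on Y (h \<mu> z)" by (rule hc[OF \<mu>E(1) z(2)])
    show "weakly_converges Y (\<lambda>n. A (zs n)) (A z)" by (rule A_conv[OF z])
    fix ws w assume ws: "\<And>n. ws n \<in> Y" and w: "w \<in> Y" and lim: "ws \<longlonglongrightarrow> w"
    have m: "fst (ws n) \<in> {0..T}" "fst w \<in> {0..T}" for n using ws[of n] w by auto
    have "(\<lambda>n. (fst (ws n), y (\<mu>s n) (fst (ws n)) (zs n), \<mu>s n (fst (ws n)), snd (ws n)))
        \<longlonglongrightarrow> (fst w, y \<mu> (fst w) z, \<mu> (fst w), snd w)"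
      by (intro tendsto_Pair tendsto_fst tendsto_snd lim
          uniform_limit_tendsto_compose[OF u \<mu>weight[OF \<mu>E(1)] m tendsto_fst[OF lim]]
          uniform_limit_tendsto_compose[OF uy yc[OF \<mu>E(1) z(2)] m tendsto_fst[OF lim]])
    from continuous_on_tendsto_compose[OF g_cont this] m
    show "(\<lambda>n. h (\<mu>s n) (zs n) (ws n)) \<longlonglongrightarrow> h \<mu> z w" by (simp add: h_def)
  qed (use aD z in auto)
  show ?thesis
    using tendsto_diff[OF 1 2] by (simp add: J_def h_def \<mu>_def \<mu>s_def)
qed

end

section \<open>Existence of equilibria\<close>

lemma measurable_borel_of_comp:
  assumes "continuous_map Z (top_of_set X) q" "continuous_on X h"
  shows "(\<lambda>z. h (q z)) \<in> borel_measurable (borel_of Z)"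
proof -
  have "q \<in> measurable (borel_of Z) (borel_on X)"
    using continuous_map_measurable_borel_of[OF assms(1)]
      measurable_cong_sets[OF refl sets_borel_of_top_of_set] by blast
  then show ?thesis
    using measurable_compose[OF _ borel_measurable_continuous_on_restrict[OF assms(2)]] by blast
qed

theorem theorem1:
  fixes T L_fx L_fm :: real
    and f :: "real \<Rightarrow> real^'n \<Rightarrow> (real^'n) prob1 \<Rightarrow> 'p::metric_space \<Rightarrow> real^'n"
    and g :: "real \<Rightarrow> real^'n \<Rightarrow> (real^'n) prob1 \<Rightarrow> 'p \<Rightarrow> real"
    and \<sigma> :: "real^'n \<Rightarrow> (real^'n) prob1 \<Rightarrow> real"
    and G0 G :: "(real^'n) set"
    and \<eta> :: "'w::metric_space measure"
    and x0 :: "'w \<Rightarrow> real^'n"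
  assumes "T > 0"
    and "compact (UNIV :: 'p set)"
    and "continuous_on ({0..T} \<times> UNIV) (\<lambda>(t, x, m, u). f t x m u)"
    and "continuous_on ({0..T} \<times> UNIV) (\<lambda>(t, x, m, u). g t x m u)"
    and "\<And>t x' x'' m u. t \<in> {0..T} \<Longrightarrow> norm (f t x' m u - f t x'' m u) \<le> L_fx * norm (x' - x'')"
    and "\<And>t x m' m'' u. t \<in> {0..T} \<Longrightarrow> norm (f t x m' u - f t x m'' u) \<le> L_fm * dist m' m''"
    and "continuous_on UNIV (\<lambda>(x, m). \<sigma> x m)"
    and "compact G0"
    and "compact G"
    and "\<And>\<mu> u x t. \<mu> \<in> external_fields T \<Longrightarrow> u \<in> measurable (lebesgue_on {0..T}) borel \<Longrightarrow>
          is_solution T f \<mu> u x \<Longrightarrow> x 0 \<in> G0 \<Longrightarrow> t \<in> {0..T} \<Longrightarrow> x t \<in> G"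
    and "compact (UNIV :: 'w set)"
    and "prob_space \<eta>" and "sets \<eta> = sets borel" and "nonatomic \<eta>"
    and "continuous_on UNIV x0" and "range x0 \<subseteq> G0"
  shows "\<exists>\<gamma> \<in> strategy_profiles T \<eta>. \<exists>y \<mu> k.
    is_process T f x0 \<gamma> y \<mu> \<and>
    is_disintegration euclidean \<eta> (control_topology T) \<gamma> k \<and>
    (AE \<omega> in \<eta>. \<forall>\<rho> \<in> space (prob_algebra (borel_of (control_topology T))).
      (\<integral>\<alpha>. payoff T f g \<sigma> x0 \<omega> \<alpha> \<mu> \<partial>\<rho>) \<le> (\<integral>\<alpha>. payoff T f g \<sigma> x0 \<omega> \<alpha> \<mu> \<partial>k \<omega>))"
proof -
  note T = \<open>T > 0\<close> and P = \<open>compact (UNIV :: 'p set)\<close> and W = \<open>compact (UNIV :: 'w set)\<close>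
    and \<eta>s = \<open>sets \<eta> = sets borel\<close>
  interpret \<eta>: prob_space \<eta> by fact
  let ?CT = "control_topology T :: (real \<times> 'p) measure topology"
  let ?PT = "prod_topology (euclidean :: 'w topology) ?CT"

  \<comment> \<open>Coding of controls and players\<close>
  obtain E and d :: "(nat \<Rightarrow> real) \<Rightarrow> (real \<times> 'p) measure" and c where E: "compact E" "E \<noteq> {}"
    and dU: "\<And>a. a \<in> E \<Longrightarrow> d a \<in> control_measures T" and cE: "\<And>\<alpha>. \<alpha> \<in> control_measures T \<Longrightarrow> c \<alpha> \<in> E"
    and dc: "\<And>\<alpha>. \<alpha> \<in> control_measures T \<Longrightarrow> d (c \<alpha>) = \<alpha>" and cd: "\<And>a. a \<in> E \<Longrightarrow> c (d a) = a"
    and dconv: "\<And>(as :: nat \<Rightarrow> nat \<Rightarrow> real) a. (\<And>n. as n \<in> E) \<Longrightarrow> a \<in> E \<Longrightarrow> as \<longlonglongrightarrow> a \<Longrightarrow>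
      weakly_converges (control_space T) (\<lambda>n. d (as n)) (d a)"
    and dcont: "continuous_map (top_of_set E) ?CT d" and ccont: "continuous_map ?CT euclidean c"
  proof (rule control_measures_coding[OF T P])
    fix E and d :: "(nat \<Rightarrow> real) \<Rightarrow> (real \<times> 'p) measure" and c
    assume "compact E" "E \<noteq> {}" "\<And>a. a \<in> E \<Longrightarrow> d a \<in> control_measures T"
      "\<And>\<alpha>. \<alpha> \<in> control_measures T \<Longrightarrow> c \<alpha> \<in> E" "\<And>\<alpha>. \<alpha> \<in> control_measures T \<Longrightarrow> d (c \<alpha>) = \<alpha>"
      "\<And>a. a \<in> E \<Longrightarrow> c (d a) = a"
      "\<And>(as :: nat \<Rightarrow> nat \<Rightarrow> real) a. (\<And>n. as n \<in> E) \<Longrightarrow> a \<in> E \<Longrightarrow> as \<longlonglongrightarrow> a \<Longrightarrow> weakly_converges (control_space T) (\<lambda>n. d (as n)) (d a)"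
      "continuous_map (top_of_set E) ?CT d" "continuous_map ?CT euclidean c"
    then show thesis by (intro that[of E d c]) simp_all
  qed
  obtain \<psi> :: "nat \<Rightarrow> 'w \<Rightarrow> real" where \<psi>: "\<And>n. continuous_on UNIV (\<psi> n)"
    and sep: "\<And>x y. x \<noteq> y \<Longrightarrow> \<exists>n. \<psi> n x \<noteq> \<psi> n y"
  proof (rule countable_test_functions[OF W UNIV_not_empty])
    fix \<psi> :: "nat \<Rightarrow> 'w \<Rightarrow> real"
    assume 1: "\<And>n. continuous_on UNIV (\<psi> n)" and 2: "\<And>x y. x \<in> UNIV \<Longrightarrow> y \<in> UNIV \<Longrightarrow> x \<noteq> y \<Longrightarrow> \<exists>n. \<psi> n x \<noteq> \<psi> n y"
    show thesis by (rule that[OF 1 2[OF UNIV_I UNIV_I]])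
  qed
  \<comment> \<open>Players are coded as well: \<open>distributional_equilibrium\<close> needs a Polish space, whereas \<open>'w\<close> carries
    no type class for second countability.\<close>
  define \<iota> where "\<iota> \<omega> n = \<psi> n \<omega>" for \<omega> n
  define B where "B = range \<iota>"
  define iv where "iv = inv_into UNIV \<iota>"
  have \<iota>c: "continuous_on UNIV \<iota>"
    unfolding \<iota>_def[abs_def] by (intro continuous_on_coordinatewise_then_product \<psi>)
  have inj: "inj \<iota>" using sep by (auto simp: inj_def \<iota>_def fun_eq_iff)
  have iv\<iota>: "iv (\<iota> \<omega>) = \<omega>" for \<omega> using inj by (simp add: iv_def)
  have B: "compact B" unfolding B_def by (rule compact_continuous_image[OF \<iota>c W])
  have ivc: "continuous_on B iv"
    unfolding B_def by (rule continuous_on_inv[OF \<iota>c W]) (simp add: iv\<iota>)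
  have \<iota>B: "\<iota> \<omega> \<in> B" for \<omega> by (simp add: B_def)
  have \<iota>m: "\<iota> \<in> measurable \<eta> (borel_on B)"
    using borel_measurable_continuous_onI[OF \<iota>c] \<iota>B
    by (intro measurable_restrict_space2) (auto simp: measurable_cong_sets[OF \<eta>s refl])
  define \<eta>' where "\<eta>' = distr \<eta> (borel_on B) \<iota>"
  have \<eta>': "prob_space \<eta>'" "sets \<eta>' = sets (borel_on B)"
    unfolding \<eta>'_def using \<eta>.prob_space_distr[OF \<iota>m] by auto

  \<comment> \<open>The game on codes\<close>
  define X where "X = B \<times> E"
  have X: "compact X" unfolding X_def by (rule compact_Times[OF B E(1)])
  define \<xi> where "\<xi> z = x0 (iv (fst z))" for z :: "(nat \<Rightarrow> real) \<times> (nat \<Rightarrow> real)"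
  define A where "A z = d (snd z)" for z :: "(nat \<Rightarrow> real) \<times> (nat \<Rightarrow> real)"
  have ivX: "continuous_on X (\<lambda>z. iv (fst z))"
    by (rule continuous_on_compose2[OF ivc]) (auto simp: X_def intro: continuous_intros)
  \<comment> \<open>The Lipschitz constants come without a sign; truncation at 0 supplies the
    nonnegativity asked for by the locale.\<close>
  interpret mean_field_game T "max 0 L_fx" "max 0 L_fm" f X \<xi> A g \<sigma>
  proof unfold_locales
    show "norm (f t x' m u - f t x'' m u) \<le> max 0 L_fx * norm (x' - x'')" if "t \<in> {0..T}" for t x' x'' m u
      by (rule order_trans[OF assms(5)[OF that]]) (simp add: mult_right_mono)
    show "norm (f t x m' u - f t x m'' u) \<le> max 0 L_fm * dist m' m''" if "t \<in> {0..T}" for t x m' m'' u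
      by (rule order_trans[OF assms(6)[OF that]]) (simp add: mult_right_mono)
    show "continuous_on X \<xi>"
      unfolding \<xi>_def[abs_def] by (rule continuous_on_compose2[OF \<open>continuous_on UNIV x0\<close> ivX]) simp
    show "A z \<in> control_measures T" if "z \<in> X" for z
      using dU[of "snd z"] that by (auto simp: A_def X_def)
    show "weakly_converges (control_space T) (\<lambda>n. A (zs n)) (A z)"
      if "\<And>n. zs n \<in> X" "z \<in> X" "zs \<longlonglongrightarrow> z" for zs z
      unfolding A_def using that by (intro dconv tendsto_snd) (auto simp: X_def mem_Times_iff)
  qed (use assms X in auto)
  obtain \<gamma>' k' where \<gamma>': "prob_space \<gamma>'" "sets \<gamma>' = sets (borel_on X)" and marg: "distr \<gamma>' (borel_on B) fst = \<eta>'"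
    and k': "k' \<in> measurable \<eta>' (prob_algebra (borel_on E))"
    and dis: "\<And>\<phi>. continuous_on X \<phi> \<Longrightarrow> (\<integral>z. \<phi> z \<partial>\<gamma>') = (\<integral>b. (\<integral>a. (\<phi> (b, a) :: real) \<partial>k' b) \<partial>\<eta>')"
    and equ: "AE b in \<eta>'. \<forall>a\<in>E. J \<gamma>' (b, a) \<le> (\<integral>a'. J \<gamma>' (b, a') \<partial>k' b)"
  proof (rule distributional_equilibrium[OF B E \<eta>', of J])
    fix M Ms z zs
    assume "prob_space M" "sets M = sets (borel_on (B \<times> E))" "\<And>n. prob_space (Ms n)"
      "\<And>n. sets (Ms n) = sets (borel_on (B \<times> E))" "weakly_converges (B \<times> E) Ms M"
      "\<And>n::nat. zs n \<in> B \<times> E" "z \<in> B \<times> E" "zs \<longlonglongrightarrow> z"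
    then show "(\<lambda>n. J (Ms n) (zs n)) \<longlonglongrightarrow> J M z"
      unfolding X_def[symmetric] by (intro J_converges) (simp_all add: laws_def)
  next
    fix \<gamma> k
    assume "prob_space \<gamma>" "sets \<gamma> = sets (borel_on (B \<times> E))" "distr \<gamma> (borel_on B) fst = \<eta>'"
      "k \<in> measurable \<eta>' (prob_algebra (borel_on E))"
      "\<And>\<phi>. continuous_on (B \<times> E) \<phi> \<Longrightarrow> (\<integral>z. \<phi> z \<partial>\<gamma>) = (\<integral>b. (\<integral>a. (\<phi> (b, a) :: real) \<partial>k b) \<partial>\<eta>')"
      "AE b in \<eta>'. \<forall>a\<in>E. J \<gamma> (b, a) \<le> (\<integral>a'. J \<gamma> (b, a') \<partial>k b)"
    then show thesis by (intro that[of \<gamma> k]) (simp_all add: X_def)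
  qed
  have law: "\<gamma>' \<in> laws" using \<gamma>' by (simp add: laws_def)
  have sp\<gamma>': "space \<gamma>' = X" by (rule space_borel_onI[OF \<gamma>'(2)])
  have sp\<eta>': "space \<eta>' = B" by (rule space_borel_onI[OF \<eta>'(2)])
  have sp\<eta>: "space \<eta> = UNIV" using sets_eq_imp_space_eq[OF \<eta>s] by simp
  define \<mu> where "\<mu> = field \<gamma>'"
  have gen: "generates \<gamma>' \<mu>" unfolding \<mu>_def by (rule generates_field[OF law])
  then have \<mu>E: "\<mu> \<in> external_fields T" by (simp add: generates_def)
  \<comment> \<open>\<open>H\<close> decodes and \<open>Q\<close> encodes pairs of a player and a
    control. \<open>H\<close> carries the law to the abstract product space, while \<open>Q\<close>
    gives measurability there to functions that are known to be continuous on codes.\<close>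
  define H where "H z = (iv (fst z), d (snd z))" for z :: "(nat \<Rightarrow> real) \<times> (nat \<Rightarrow> real)"
  define Q where "Q z = (\<iota> (fst z), c (snd z))" for z :: "'w \<times> (real \<times> 'p) measure"
  have Hc: "continuous_map (top_of_set X) ?PT H"
  proof -
    have "continuous_map (top_of_set X) (top_of_set E) snd"
      using continuous_on_snd[OF continuous_on_id, of X] by (auto simp: X_def continuous_map_in_subtopology)
    from continuous_map_compose[OF this dcont]
    have "continuous_map (top_of_set X) ?CT (\<lambda>z. d (snd z))" by (simp add: o_def)
    moreover have "continuous_map (top_of_set X) euclidean (\<lambda>z. iv (fst z))" using ivX by simp
    ultimately show ?thesis unfolding H_def[abs_def] by (simp add: continuous_map_pairwise o_def)
  qed
  have Hm: "H \<in> measurable \<gamma>' (borel_of ?PT)"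
  proof -
    have "sets \<gamma>' = sets (borel_of (top_of_set X))" using \<gamma>'(2) sets_borel_of_top_of_set by metis
    then show ?thesis
      using continuous_map_measurable_borel_of[OF Hc] measurable_cong_sets[OF _ refl] by blast
  qed
  have Qc: "continuous_map ?PT (top_of_set X) Q"
  proof -
    have "continuous_map ?PT euclidean (\<lambda>z. \<iota> (fst z))"
    proof -
      have "continuous_map (euclidean :: 'w topology) euclidean \<iota>" using \<iota>c by simp
      from continuous_map_compose[OF continuous_map_fst this] show ?thesis by (simp add: o_def)
    qed
    moreover have "continuous_map ?PT euclidean (\<lambda>z. c (snd z))"
      using continuous_map_compose[OF continuous_map_snd ccont] by (simp add: o_def)
    ultimately have "continuous_map ?PT (prod_topology euclidean euclidean) Q"
      unfolding Q_def[abs_def] by (subst continuous_map_pairwise) (simp add: o_def)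
    then show ?thesis
      using cE \<iota>B by (auto simp: continuous_map_in_subtopology Q_def X_def)
  qed

  \<comment> \<open>The decoded profile and its process\<close>
  define \<gamma> where "\<gamma> = distr \<gamma>' (borel_of ?PT) H"
  have fstm: "fst \<in> measurable (borel_of ?PT) (borel_of euclidean)"
    by (rule continuous_map_measurable_borel_of[OF continuous_map_fst])
  have fst\<gamma>': "fst \<in> measurable \<gamma>' (borel_on B)"
    unfolding measurable_cong_sets[OF \<gamma>'(2) refl] X_def
    using borel_measurable_continuous_onI[OF continuous_on_fst[OF continuous_on_id]]
    by (intro measurable_restrict_space3) auto
  have \<gamma>D: "\<gamma> \<in> strategy_profiles T \<eta>"
    unfolding strategy_profiles_def marginal_measures_def mem_Collect_eq
  proof (intro conjI ballI)
    show "sets \<gamma> = sets (borel_of ?PT)" by (simp add: \<gamma>_def)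
    fix V assume "V \<in> sets (borel_of (euclidean :: 'w topology))"
    then have V: "V \<in> sets (borel_of (euclidean :: 'w topology))" "V \<in> sets borel" by (simp_all add: sets_borel_of_euclidean)
    have VU: "V \<times> control_measures T \<in> sets (borel_of ?PT)"
    proof -
      have "V \<times> control_measures T = fst -` V \<inter> space (borel_of ?PT)" by auto
      then show ?thesis using measurable_sets[OF fstm V(1)] by simp
    qed
    have ivV: "iv -` V \<inter> B \<in> sets (borel_on B)"
      using measurable_sets[OF borel_measurable_continuous_on_restrict[OF ivc] V(2)] by (simp add: space_restrict_space)
    have "emeasure \<gamma> (V \<times> control_measures T) = emeasure \<gamma>' (H -` (V \<times> control_measures T) \<inter> space \<gamma>')"
      unfolding \<gamma>_def by (rule emeasure_distr[OF Hm VU])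
    also have "H -` (V \<times> control_measures T) \<inter> space \<gamma>' = fst -` (iv -` V \<inter> B) \<inter> space \<gamma>'"
      using dU by (auto simp: sp\<gamma>' X_def H_def)
    also have "emeasure \<gamma>' \<dots> = emeasure \<eta>' (iv -` V \<inter> B)"
      unfolding marg[symmetric] by (rule emeasure_distr[OF fst\<gamma>' ivV, symmetric])
    also have "\<dots> = emeasure \<eta> (\<iota> -` (iv -` V \<inter> B) \<inter> space \<eta>)"
      unfolding \<eta>'_def by (rule emeasure_distr[OF \<iota>m ivV])
    also have "\<iota> -` (iv -` V \<inter> B) \<inter> space \<eta> = V" using \<iota>B iv\<iota> by (auto simp: sp\<eta>)
    finally show "emeasure \<gamma> (V \<times> topspace ?CT) = emeasure \<eta> V" by simp
  qed
  have traj_code: "trajectory T f x0 \<omega> \<alpha> \<mu> = (\<lambda>t. y \<mu> t (\<iota> \<omega>, c \<alpha>))" if "\<alpha> \<in> control_measures T" for \<omega> \<alpha>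
    using that by (simp add: trajectory_eq_traj y_def \<xi>_def A_def iv\<iota> dc)
  have proc: "is_process T f x0 \<gamma> (\<lambda>t \<omega> \<alpha>. trajectory T f x0 \<omega> \<alpha> \<mu> t) \<mu>"
    unfolding is_process_def
  proof (intro conjI ballI allI \<mu>E refl)
    fix t assume t: "t \<in> {0..T}"
    define \<tau> where "\<tau> = (\<lambda>(\<omega>, \<alpha>). trajectory T f x0 \<omega> \<alpha> \<mu> t)"
    have yc: "continuous_on X (y \<mu> t)" by (rule y_continuous_player[OF \<mu>E t])
    have \<tau>Q: "\<tau> w = y \<mu> t (Q w)" if "w \<in> space (borel_of ?PT)" for w
      using that traj_code[of "snd w" "fst w"] by (auto simp: \<tau>_def Q_def split: prod.splits)
    have "(\<lambda>w. y \<mu> t (Q w)) \<in> borel_measurable (borel_of ?PT)" by (rule measurable_borel_of_comp[OF Qc yc])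
    then have \<tau>m: "\<tau> \<in> borel_measurable (borel_of ?PT)" by (subst measurable_cong[OF \<tau>Q])
    have "measure_of_prob1 (\<mu> t) = measure_of_prob1 (push_prob1 \<gamma>' (y \<mu> t))"
      using gen t by (simp add: generates_def \<Psi>_def)
    also have "\<dots> = distr \<gamma>' borel (y \<mu> t)" by (rule measure_of_push_prob1_continuous[OF \<gamma>' X yc])
    also have "\<dots> = distr \<gamma>' borel (\<tau> \<circ> H)"
    proof (rule distr_cong[OF refl refl])
      fix z assume "z \<in> space \<gamma>'"
      then have "fst z \<in> B" "snd z \<in> E" by (auto simp: sp\<gamma>' X_def)
      then show "y \<mu> t z = (\<tau> \<circ> H) z"
        by (simp add: \<tau>_def H_def trajectory_eq_traj y_def \<xi>_def A_def)
    qed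
    also have "\<dots> = distr \<gamma> borel \<tau>" unfolding \<gamma>_def by (rule distr_distr[OF \<tau>m Hm, symmetric])
    finally show "measure_of_prob1 (\<mu> t) = distr \<gamma> borel (\<lambda>(\<omega>, \<alpha>). trajectory T f x0 \<omega> \<alpha> \<mu> t)"
      by (simp add: \<tau>_def)
  qed

  \<comment> \<open>Disintegration of the decoded profile\<close>
  have dm: "d \<in> measurable (borel_on E) (borel_of ?CT)"
    using continuous_map_measurable_borel_of[OF dcont] measurable_cong_sets[OF sets_borel_of_top_of_set refl] by blast
  define k where "k \<omega> = distr (k' (\<iota> \<omega>)) (borel_of ?CT) d" for \<omega>
  have k'p: "prob_space (k' (\<iota> \<omega>))" "sets (k' (\<iota> \<omega>)) = sets (borel_on E)" "space (k' (\<iota> \<omega>)) = E" for \<omega>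
    using kernel_prob_space[OF k', of "\<iota> \<omega>"] \<iota>B by (auto simp: sp\<eta>' space_restrict_space)
  have dm': "d \<in> measurable (k' (\<iota> \<omega>)) (borel_of ?CT)" for \<omega>
    using dm measurable_cong_sets[OF k'p(2) refl] by blast
  have intk: "(\<integral>r. h r \<partial>k \<omega>) = (\<integral>a. h (d a) \<partial>k' (\<iota> \<omega>))" if "h \<in> borel_measurable (borel_of ?CT)" for h :: "(real \<times> 'p) measure \<Rightarrow> real" and \<omega>
    unfolding k_def by (rule integral_distr[OF dm' that])
  have setsX: "sets (borel_on X) = sets (\<eta>' \<Otimes>\<^sub>M borel_on E)"
    using \<eta>'(2) by (simp add: X_def sets_borel_on_Times cong: sets_pair_measure_cong)
  have disk: "is_disintegration euclidean \<eta> ?CT \<gamma> k"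
    unfolding is_disintegration_def
  proof (intro conjI allI impI)
    have "\<iota> \<in> measurable (borel_of euclidean) \<eta>'"
      using \<iota>m measurable_cong_sets[OF trans[OF \<eta>s sets_borel_of_euclidean[symmetric]] \<eta>'(2)[symmetric]] by blast
    from measurable_compose[OF measurable_compose[OF this k'] measurable_distr_prob_space[OF dm]]
    show "k \<in> measurable (borel_of euclidean) (prob_algebra (borel_of ?CT))" by (simp add: k_def[abs_def])
    fix \<phi> :: "'w \<times> (real \<times> 'p) measure \<Rightarrow> real" assume \<phi>: "continuous_map ?PT euclideanreal \<phi>"
    have \<phi>m: "\<phi> \<in> borel_measurable (borel_of ?PT)"
      using continuous_map_measurable_borel_of[OF \<phi>] measurable_cong_sets[OF refl sets_borel_of_euclidean] by blast
    have \<phi>H: "continuous_on X (\<lambda>z. \<phi> (H z))"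
      using continuous_map_compose[OF Hc \<phi>] by (simp add: o_def)
    have "bounded ((\<lambda>z. \<phi> (H z)) ` X)" by (intro compact_imp_bounded compact_continuous_image \<phi>H X)
    then obtain C where C: "\<And>z. z \<in> X \<Longrightarrow> \<bar>\<phi> (H z)\<bar> \<le> C" by (auto simp: bounded_iff)
    have "(\<lambda>z. \<phi> (H z)) \<in> borel_measurable (\<eta>' \<Otimes>\<^sub>M borel_on E)"
      using borel_measurable_borel_on[OF refl \<phi>H] measurable_cong_sets[OF setsX refl] by blast
    then have m: "(\<lambda>b. \<integral>a. \<phi> (H (b, a)) \<partial>k' b) \<in> borel_measurable \<eta>'"
      by (rule kernel_integral_measurable[OF k', of _ C]) (use C in \<open>simp add: sp\<eta>' space_restrict_space X_def\<close>)
    have "(\<integral>z. \<phi> z \<partial>\<gamma>) = (\<integral>z. \<phi> (H z) \<partial>\<gamma>')" unfolding \<gamma>_def by (rule integral_distr[OF Hm \<phi>m])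
    also have "\<dots> = (\<integral>b. (\<integral>a. \<phi> (H (b, a)) \<partial>k' b) \<partial>\<eta>')" by (rule dis[OF \<phi>H])
    also have "\<dots> = (\<integral>\<omega>. (\<integral>a. \<phi> (H (\<iota> \<omega>, a)) \<partial>k' (\<iota> \<omega>)) \<partial>\<eta>)"
    proof -
      have "(\<lambda>b. \<integral>a. \<phi> (H (b, a)) \<partial>k' b) \<in> borel_measurable (borel_on B)"
        using m measurable_cong_sets[OF \<eta>'(2) refl] by blast
      then show ?thesis unfolding \<eta>'_def by (rule integral_distr[OF \<iota>m])
    qed
    also have "\<dots> = (\<integral>s. (\<integral>r. \<phi> (s, r) \<partial>k s) \<partial>\<eta>)"
    proof (rule Bochner_Integration.integral_cong[OF refl])
      fix \<omega>
      have "continuous_map ?CT ?PT (\<lambda>r. (\<omega>, r))" by (simp add: continuous_map_pairwise o_def)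
      from continuous_map_compose[OF this \<phi>] have "continuous_map ?CT euclideanreal (\<lambda>r. \<phi> (\<omega>, r))" by (simp add: o_def)
      then have "(\<lambda>r. \<phi> (\<omega>, r)) \<in> borel_measurable (borel_of ?CT)"
        using continuous_map_measurable_borel_of measurable_cong_sets[OF refl sets_borel_of_euclidean] by blast
      then show "(\<integral>a. \<phi> (H (\<iota> \<omega>, a)) \<partial>k' (\<iota> \<omega>)) = (\<integral>r. \<phi> (\<omega>, r) \<partial>k \<omega>)"
        by (simp add: intk H_def iv\<iota>)
    qed
    finally show "(\<integral>z. \<phi> z \<partial>\<gamma>) = (\<integral>s. (\<integral>r. \<phi> (s, r) \<partial>k s) \<partial>\<eta>)" .
  qed

  \<comment> \<open>The equilibrium inequality\<close>
  have pay: "payoff T f g \<sigma> x0 \<omega> \<alpha> \<mu> = J \<gamma>' (\<iota> \<omega>, c \<alpha>)" if "\<alpha> \<in> control_measures T" for \<omega> \<alpha>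
    unfolding payoff_def J_def traj_code[OF that] \<mu>_def[symmetric]
    using that by (simp add: A_def dc case_prod_unfold)
  have Jc: "continuous_on X (J \<gamma>')"
    unfolding continuous_on_sequentially o_def
    by (auto intro!: J_converges law simp: weakly_converges_def)
  have "bounded (J \<gamma>' ` X)" by (intro compact_imp_bounded compact_continuous_image Jc X)
  then obtain C where C: "\<And>z. z \<in> X \<Longrightarrow> \<bar>J \<gamma>' z\<bar> \<le> C" by (auto simp: bounded_iff)
  have paym: "(\<lambda>\<alpha>. payoff T f g \<sigma> x0 \<omega> \<alpha> \<mu>) \<in> borel_measurable (borel_of ?CT)" for \<omega>
  proof -
    have cc: "continuous_map ?CT (top_of_set E) c"
      using ccont cE by (auto simp: continuous_map_in_subtopology)
    have "continuous_on E (\<lambda>a. J \<gamma>' (\<iota> \<omega>, a))"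
      by (rule continuous_on_compose2[OF Jc]) (auto simp: X_def \<iota>B intro!: continuous_intros)
    then have m: "(\<lambda>\<alpha>. J \<gamma>' (\<iota> \<omega>, c \<alpha>)) \<in> borel_measurable (borel_of ?CT)"
      by (rule measurable_borel_of_comp[OF cc])
    have e: "payoff T f g \<sigma> x0 \<omega> \<alpha> \<mu> = J \<gamma>' (\<iota> \<omega>, c \<alpha>)" if "\<alpha> \<in> space (borel_of ?CT)" for \<alpha>
      using that by (intro pay) simp
    show ?thesis using m by (subst measurable_cong[OF e])
  qed
  have "AE \<omega> in \<eta>. \<forall>a\<in>E. J \<gamma>' (\<iota> \<omega>, a) \<le> (\<integral>a'. J \<gamma>' (\<iota> \<omega>, a') \<partial>k' (\<iota> \<omega>))"
    using equ unfolding \<eta>'_def by (rule AE_distrD[OF \<iota>m])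
  then have "AE \<omega> in \<eta>. \<forall>\<rho> \<in> space (prob_algebra (borel_of ?CT)).
      (\<integral>\<alpha>. payoff T f g \<sigma> x0 \<omega> \<alpha> \<mu> \<partial>\<rho>) \<le> (\<integral>\<alpha>. payoff T f g \<sigma> x0 \<omega> \<alpha> \<mu> \<partial>k \<omega>)"
  proof eventually_elim
    case (elim \<omega>)
    show ?case
    proof
      fix \<rho> assume "\<rho> \<in> space (prob_algebra (borel_of ?CT))"
      then have \<rho>: "prob_space \<rho>" "sets \<rho> = sets (borel_of ?CT)" by (auto simp: space_prob_algebra)
      interpret \<rho>: prob_space \<rho> by (rule \<rho>(1))
      have sp\<rho>: "space \<rho> = control_measures T" using sets_eq_imp_space_eq[OF \<rho>(2)] by (simp add:)
      have "(\<lambda>\<alpha>. payoff T f g \<sigma> x0 \<omega> \<alpha> \<mu>) \<in> borel_measurable \<rho>"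
        using paym measurable_cong_sets[OF \<rho>(2) refl] by blast
      then have i: "integrable \<rho> (\<lambda>\<alpha>. payoff T f g \<sigma> x0 \<omega> \<alpha> \<mu>)"
        using C cE \<iota>B by (intro \<rho>.integrable_const_bound[where B=C]) (auto simp: sp\<rho> pay X_def)
      have rhs: "(\<integral>\<alpha>. payoff T f g \<sigma> x0 \<omega> \<alpha> \<mu> \<partial>k \<omega>) = (\<integral>a. J \<gamma>' (\<iota> \<omega>, a) \<partial>k' (\<iota> \<omega>))"
        unfolding intk[OF paym] using k'p(3) by (intro Bochner_Integration.integral_cong) (auto simp: pay dU cd)
      \<comment> \<open>The right-hand side is constant in \<alpha> and bounds the payoff of every
        pure deviation, so it bounds the average over \<rho> as well.\<close>
      show "(\<integral>\<alpha>. payoff T f g \<sigma> x0 \<omega> \<alpha> \<mu> \<partial>\<rho>) \<le> (\<integral>\<alpha>. payoff T f g \<sigma> x0 \<omega> \<alpha> \<mu> \<partial>k \<omega>)"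
        unfolding rhs by (rule \<rho>.integral_le_const[OF i]) (use elim cE in \<open>auto simp: sp\<rho> pay intro!: AE_I2\<close>)
    qed
  qed
  then show ?thesis using \<gamma>D proc disk by blast
qed

end
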